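(* Let $\mathcal{M}:L^2([0,b],U)\times U^n\to H$ be the bounded linear operator (control-to-final-state operator) and $\Omega_{t_n}^b,\Psi_0^{t_n},\tilde\Omega_{t_n}^b,\tilde\Psi_0^{t_n}:H\to H$ the operators, all defined in the context, associated with the linear fractional impulsive system $$ \begin{cases} {}^{C}D^{\alpha}_{t_k^+}x(t)=Ax(t)+Bu(t), & t\in[0,b]\setminus\{t_1,\dots,t_n\},\\ \Delta x(t_k)=D_kx(t_k)+E_kv_k, & k=1,\dots,n,\\ x(0)=x_0, \end{cases} $$ with $0<\alpha\le 1$. The following conditions are equivalent: (i) The system is approximately controllable on $[0,b]$. (ii) For $\varphi\in H$, $\mathcal{M}^*\varphi=0$ implies $\varphi=0$. (iii) $\Omega_{t_n}^b+\Psi_0^{t_n}+\tilde\Omega_{t_n}^b+\tilde\Psi_0^{t_n}$ is strictly positive. (iv) $\varepsilon\left(\varepsilon\mathcal{I}+\Omega_{t_n}^b+\Psi_0^{t_n}+\tilde\Omega_{t_n}^b+\tilde\Psi_0^{t_n}\right)^{-1}$ converges to the zero operator as $\varepsilon\to0^+$ in the strong operator topology. (v) $\varepsilon\left(\varepsilon\mathcal{I}+\Omega_{t_n}^b+\Psi_0^{t_n}+\tilde\Omega_{t_n}^b+\tilde\Psi_0^{t_n}\right)^{-1}$ converges to the zero operator as $\varepsilon\to0^+$ in the weak operator topology.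
   Context: $H,U$ are real Hilbert spaces, $\mathcal I$ is the identity on $H$, $n\ge1$, $0=t_0<t_1<\dots<t_n<t_{n+1}=b$, $0<\alpha\le1$. $A:D(A)\subset H\to H$ generates a $C_0$-semigroup $\{S(t)\}_{t\ge0}$ on $H$; $B\in\mathcal L(U,H)$, $D_k\in\mathcal L(H)$, $E_k\in\mathcal L(U,H)$ ($k=1,\dots,n$). ${}^CD^\alpha_{t_k^+}$ is the Caputo derivative of order $\alpha$ with lower limit $t_k$, used on $(t_k,t_{k+1}]$; $\Delta x(t_k)=x(t_k^+)-x(t_k^-)$ with $x(t_k^-)=x(t_k)$. Controls are $u\in L^2([0,b],U)$ and $v_1,\dots,v_n\in U$. For $0<\alpha<1$ the Wright function is $\Psi_\alpha(\theta)=\sum_{m=0}^\infty\frac{(-\theta)^m}{m!\,\Gamma(-\alpha m+1-\alpha)}$, and for $t\ge0$ $$\mathcal S_\alpha(t)=\int_0^\infty\Psi_\alpha(\theta)S(t^\alpha\theta)\,d\theta,\qquad \mathcal P_\alpha(t)=\int_0^\infty\alpha\theta\Psi_\alpha(\theta)S(t^\alpha\theta)\,d\theta .$$ For $\alpha=1$, $\mathcal S_1(t)=\mathcal P_1(t)=S(t)$. Products are ordered: $\prod_{j=k}^{i}T_j=T_kT_{k-1}\cdots T_i$ when the index decreases ($k\ge i$), $\prod_{j=i}^{k}T_j=T_iT_{i+1}\cdots T_k$ when it increases; empty products are $\mathcal I$. $L^2([0,b],U)\times U^n$ is a Hilbert space with inner product $\langle(u_1,\{v_{1k}\}),(u_2,\{v_{2k}\})\rangle_1=\int_0^b\langle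 u_1(s),u_2(s)\rangle_U\,ds+\sum_{k=1}^n\langle v_{1k},v_{2k}\rangle_U$. The bounded linear operator $\mathcal M:L^2([0,b],U)\times U^n\to H$ is $$\begin{aligned}\mathcal M(u,\{v_k\}_{k=1}^n)=&\int_{t_n}^b(b-s)^{\alpha-1}\mathcal P_\alpha(b-s)Bu(s)\,ds\\&+\mathcal S_\alpha(b-t_n)\sum_{i=1}^n\Big[\prod_{j=n}^{i+1}(\mathcal I+D_j)\mathcal S_\alpha(t_j-t_{j-1})\Big](\mathcal I+D_i)\int_{t_{i-1}}^{t_i}(t_i-s)^{\alpha-1}\mathcal P_\alpha(t_i-s)Bu(s)\,ds\\&+\mathcal S_\alpha(b-t_n)\sum_{i=2}^n\Big[\prod_{j=n}^{i}(\mathcal I+D_j)\mathcal S_\alpha(t_j-t_{j-1})\Big]E_{i-1}v_{i-1}+\mathcal S_\alpha(b-t_n)E_nv_n,\end{aligned}$$ and $\mathcal M^*$ is its Hilbert space adjoint. The system is called approximately controllable on $[0,b]$ if $\overline{\operatorname{Im}\mathcal M}=H$. For $\varphi\in H$ define $$\Omega_{t_n}^b\varphi=\int_{t_n}^b(b-s)^{2\alpha-2}\mathcal P_\alpha(b-s)BB^*\mathcal P_\alpha^*(b-s)\varphi\,ds,\qquad \tilde\Omega_{t_n}^b\varphi=\mathcal S_\alpha(b-t_n)E_nE_n^*\mathcal S_\alpha^*(b-t_n)\varphi,$$ $$\begin{aligned}\Psi_0^{t_n}\varphi=\mathcal S_\alpha(b-t_n)\sum_{i=1}^n&\Big[\prod_{j=n}^{i+1}(\mathcal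 I+D_j)\mathcal S_\alpha(t_j-t_{j-1})\Big](\mathcal I+D_i)\int_{t_{i-1}}^{t_i}(t_i-s)^{2\alpha-2}\mathcal P_\alpha(t_i-s)BB^*\mathcal P_\alpha^*(t_i-s)\,ds\\&\times(\mathcal I+D_i^* )\Big[\prod_{j=i+1}^n\mathcal S_\alpha^*(t_j-t_{j-1})(\mathcal I+D_j^* )\Big]\mathcal S_\alpha^*(b-t_n)\varphi,\end{aligned}$$ $$\tilde\Psi_0^{t_n}\varphi=\mathcal S_\alpha(b-t_n)\sum_{i=2}^n\Big[\prod_{j=n}^{i}(\mathcal I+D_j)\mathcal S_\alpha(t_j-t_{j-1})\Big]E_{i-1}E_{i-1}^*\Big[\prod_{j=i}^n\mathcal S_\alpha^*(t_j-t_{j-1})(\mathcal I+D_j^* )\Big]\mathcal S_\alpha^*(b-t_n)\varphi .$$ A linear operator $T:H\to H$ is strictly positive if $\langle Ty,y\rangle>0$ for every nonzero $y\in H$.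
   Formalization: For α ≤ 1/2 it is an explicit hypothesis that the integrals in M exist for every L² control and that M is bounded; for such α and B ≠ 0 the formula for M is not defined on all of L², so this range in effect has B = 0. *)

theory Defs
  imports "HOL-Analysis.Analysis"
begin

text \<open>
  Real Hilbert spaces are types of sort \<open>{real_inner, banach}\<close>. They are not assumed separable.
  The library's Bochner integral is restricted to second countable range types, so
  strong measurability and the Bochner integral over a set of reals are defined here,
  on top of the library's integral of simple functions.
\<close>

definition strongly_measurable_on :: "real set \<Rightarrow> (real \<Rightarrow> 'a::real_normed_vector) \<Rightarrow> bool" where
  "strongly_measurable_on I f \<longleftrightarrow>
     (\<exists>g. (\<forall>i::nat. simple_function (lebesgue_on I) (g i)) \<and>
          (AE s in lebesgue_on I. (\<lambda>i. g i s) \<longlonglongrightarrow> f s))"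

definition bochner_integrable_on :: "(real \<Rightarrow> 'a::real_normed_vector) \<Rightarrow> real set \<Rightarrow> bool"
    (infixr "bochner'_integrable'_on" 46) where
  "f bochner_integrable_on I \<longleftrightarrow>
     strongly_measurable_on I f \<and> (\<integral>\<^sup>+s. ennreal (norm (f s)) \<partial>lebesgue_on I) < \<infinity>"

definition bochner_integral :: "real set \<Rightarrow> (real \<Rightarrow> 'a::real_normed_vector) \<Rightarrow> 'a" where
  "bochner_integral I f =
     (if f bochner_integrable_on I
      then THE y. \<exists>g. (\<forall>i::nat. Bochner_Integration.simple_bochner_integrable (lebesgue_on I) (g i)) \<and>
             (\<lambda>i. \<integral>\<^sup>+s. ennreal (norm (f s - g i s)) \<partial>lebesgue_on I) \<longlonglongrightarrow> 0 \<and>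
             (\<lambda>i. Bochner_Integration.simple_bochner_integral (lebesgue_on I) (g i)) \<longlonglongrightarrow> y
      else 0)"

definition C0_semigroup :: "(real \<Rightarrow> 'h::real_normed_vector \<Rightarrow> 'h) \<Rightarrow> bool" where
  "C0_semigroup S \<longleftrightarrow>
     (\<forall>r\<ge>0. bounded_linear (S r)) \<and>
     S 0 = id \<and>
     (\<forall>r\<ge>0. \<forall>s\<ge>0. S (r + s) = S r \<circ> S s) \<and>
     (\<forall>x. ((\<lambda>r. S r x) \<longlongrightarrow> x) (at_right 0))"

definition generates_C0_semigroup ::
    "'h::real_normed_vector set \<Rightarrow> ('h \<Rightarrow> 'h) \<Rightarrow> (real \<Rightarrow> 'h \<Rightarrow> 'h) \<Rightarrow> bool" where
  "generates_C0_semigroup DA A S \<longleftrightarrow>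
     C0_semigroup S \<and>
     DA = {x. \<exists>y. ((\<lambda>r. (1 / r) *\<^sub>R (S r x - x)) \<longlongrightarrow> y) (at_right 0)} \<and>
     (\<forall>x\<in>DA. ((\<lambda>r. (1 / r) *\<^sub>R (S r x - x)) \<longlongrightarrow> A x) (at_right 0))"

text \<open>\<open>rGamma\<close> is the entire function \<open>1 / \<Gamma>\<close>, equal to \<open>0\<close> at the poles of \<open>\<Gamma>\<close>.\<close>

definition wright :: "real \<Rightarrow> real \<Rightarrow> real" where
  "wright \<alpha> \<theta> = (\<Sum>m. (- \<theta>) ^ m / fact m * rGamma (- \<alpha> * real m + 1 - \<alpha>))"

definition frac_S :: "real \<Rightarrow> (real \<Rightarrow> 'h::real_normed_vector \<Rightarrow> 'h) \<Rightarrow> real \<Rightarrow> 'h \<Rightarrow> 'h" where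
  "frac_S \<alpha> S r x =
     (if \<alpha> = 1 then S r x
      else bochner_integral {0..} (\<lambda>\<theta>. wright \<alpha> \<theta> *\<^sub>R S (r powr \<alpha> * \<theta>) x))"

definition frac_P :: "real \<Rightarrow> (real \<Rightarrow> 'h::real_normed_vector \<Rightarrow> 'h) \<Rightarrow> real \<Rightarrow> 'h \<Rightarrow> 'h" where
  "frac_P \<alpha> S r x =
     (if \<alpha> = 1 then S r x
      else bochner_integral {0..} (\<lambda>\<theta>. (\<alpha> * \<theta> * wright \<alpha> \<theta>) *\<^sub>R S (r powr \<alpha> * \<theta>) x))"

text \<open>
  \<open>prod_down T k i\<close> is \<open>T k \<circ> T (k - 1) \<circ> \<dots> \<circ> T i\<close> and \<open>prod_up T i k\<close> is
  \<open>T i \<circ> T (i + 1) \<circ> \<dots> \<circ> T k\<close>; both are the identity if \<open>k < i\<close>.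
\<close>

definition prod_down :: "(nat \<Rightarrow> 'h \<Rightarrow> 'h) \<Rightarrow> nat \<Rightarrow> nat \<Rightarrow> 'h \<Rightarrow> 'h" where
  "prod_down T k i = foldr (\<lambda>j F. T j \<circ> F) (rev [i..<Suc k]) id"

definition prod_up :: "(nat \<Rightarrow> 'h \<Rightarrow> 'h) \<Rightarrow> nat \<Rightarrow> nat \<Rightarrow> 'h \<Rightarrow> 'h" where
  "prod_up T i k = foldr (\<lambda>j F. T j \<circ> F) [i..<Suc k] id"

text \<open>
  Elements of \<open>L\<^sup>2([0,b],U)\<close> are represented by square integrable functions, with almost
  everywhere equality as equality; elements of \<open>U\<^sup>n\<close> are families indexed by \<open>{1..n}\<close>.
\<close>

definition L2_on :: "real set \<Rightarrow> (real \<Rightarrow> 'u::real_normed_vector) set" where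
  "L2_on I = {u. strongly_measurable_on I u \<and>
                 (\<integral>\<^sup>+s. ennreal ((norm (u s))\<^sup>2) \<partial>lebesgue_on I) < \<infinity>}"

definition controls ::
    "nat \<Rightarrow> real \<Rightarrow> ((real \<Rightarrow> 'u::real_normed_vector) \<times> (nat \<Rightarrow> 'u)) set" where
  "controls n b = L2_on {0..b} \<times> ({1..n} \<rightarrow>\<^sub>E UNIV)"

definition control_inner :: "nat \<Rightarrow> real \<Rightarrow>
    (real \<Rightarrow> 'u::real_inner) \<times> (nat \<Rightarrow> 'u) \<Rightarrow> (real \<Rightarrow> 'u) \<times> (nat \<Rightarrow> 'u) \<Rightarrow> real" where
  "control_inner n b p q =
     (\<integral>s. fst p s \<bullet> fst q s \<partial>lebesgue_on {0..b}) + (\<Sum>k=1..n. snd p k \<bullet> snd q k)"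

definition control_is_zero ::
    "nat \<Rightarrow> real \<Rightarrow> (real \<Rightarrow> 'u::real_normed_vector) \<times> (nat \<Rightarrow> 'u) \<Rightarrow> bool" where
  "control_is_zero n b p \<longleftrightarrow>
     (AE s in lebesgue_on {0..b}. fst p s = 0) \<and> (\<forall>k\<in>{1..n}. snd p k = 0)"

definition control_integrand :: "real \<Rightarrow> (real \<Rightarrow> 'h::real_normed_vector \<Rightarrow> 'h) \<Rightarrow>
    ('u \<Rightarrow> 'h) \<Rightarrow> real \<Rightarrow> (real \<Rightarrow> 'u) \<Rightarrow> real \<Rightarrow> 'h" where
  "control_integrand \<alpha> S B c u s = (c - s) powr (\<alpha> - 1) *\<^sub>R frac_P \<alpha> S (c - s) (B (u s))"

definition jump_step :: "real \<Rightarrow> (real \<Rightarrow> 'h::real_normed_vector \<Rightarrow> 'h) \<Rightarrow>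
    (nat \<Rightarrow> 'h \<Rightarrow> 'h) \<Rightarrow> (nat \<Rightarrow> real) \<Rightarrow> nat \<Rightarrow> 'h \<Rightarrow> 'h" where
  "jump_step \<alpha> S D t j x =
     (let y = frac_S \<alpha> S (t j - t (j - 1)) x in y + D j y)"

definition jump_step_adj :: "real \<Rightarrow> (real \<Rightarrow> 'h::real_inner \<Rightarrow> 'h) \<Rightarrow>
    (nat \<Rightarrow> 'h \<Rightarrow> 'h) \<Rightarrow> (nat \<Rightarrow> real) \<Rightarrow> nat \<Rightarrow> 'h \<Rightarrow> 'h" where
  "jump_step_adj \<alpha> S D t j x =
     adjoint (frac_S \<alpha> S (t j - t (j - 1))) (x + adjoint (D j) x)"

definition control_map :: "real \<Rightarrow> (real \<Rightarrow> 'h::real_normed_vector \<Rightarrow> 'h) \<Rightarrow> ('u \<Rightarrow> 'h) \<Rightarrow>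
    (nat \<Rightarrow> 'h \<Rightarrow> 'h) \<Rightarrow> (nat \<Rightarrow> 'u \<Rightarrow> 'h) \<Rightarrow> nat \<Rightarrow> (nat \<Rightarrow> real) \<Rightarrow> real \<Rightarrow>
    (real \<Rightarrow> 'u) \<times> (nat \<Rightarrow> 'u) \<Rightarrow> 'h" where
  "control_map \<alpha> S B D E n t b = (\<lambda>(u, v).
     bochner_integral {t n..b} (control_integrand \<alpha> S B b u)
     + frac_S \<alpha> S (b - t n)
         (\<Sum>i=1..n. prod_down (jump_step \<alpha> S D t) n (i + 1)
            (let y = bochner_integral {t (i - 1)..t i} (control_integrand \<alpha> S B (t i) u)
             in y + D i y))
     + frac_S \<alpha> S (b - t n)
         (\<Sum>i=2..n. prod_down (jump_step \<alpha> S D t) n i (E (i - 1) (v (i - 1))))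
     + frac_S \<alpha> S (b - t n) (E n (v n)))"

text \<open>
  The integrals in \<open>control_map\<close> exist for every control and the map is bounded; linearity is
  then a consequence of the linearity of the integral. This holds automatically for
  \<open>\<alpha> > 1/2\<close>. For \<open>\<alpha> \<le> 1/2\<close> the kernel \<open>(c - s) powr (\<alpha> - 1)\<close> is not square integrable near
  \<open>c\<close>, and boundedness on \<open>L\<^sup>2\<close> is a genuine condition on the data.
\<close>

definition bounded_control_map :: "real \<Rightarrow> (real \<Rightarrow> 'h::real_normed_vector \<Rightarrow> 'h) \<Rightarrow>
    ('u::real_inner \<Rightarrow> 'h) \<Rightarrow> (nat \<Rightarrow> 'h \<Rightarrow> 'h) \<Rightarrow> (nat \<Rightarrow> 'u \<Rightarrow> 'h) \<Rightarrow> nat \<Rightarrow>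
    (nat \<Rightarrow> real) \<Rightarrow> real \<Rightarrow> bool" where
  "bounded_control_map \<alpha> S B D E n t b \<longleftrightarrow>
     (\<forall>u\<in>L2_on {0..b}. \<forall>k\<in>{1..n + 1}.
        control_integrand \<alpha> S B (t k) u bochner_integrable_on {t (k - 1)..t k}) \<and>
     (\<exists>C. \<forall>p\<in>controls n b.
        norm (control_map \<alpha> S B D E n t b p) \<le> C * sqrt (control_inner n b p p))"

definition approximately_controllable :: "real \<Rightarrow> (real \<Rightarrow> 'h::real_normed_vector \<Rightarrow> 'h) \<Rightarrow>
    ('u::real_normed_vector \<Rightarrow> 'h) \<Rightarrow> (nat \<Rightarrow> 'h \<Rightarrow> 'h) \<Rightarrow> (nat \<Rightarrow> 'u \<Rightarrow> 'h) \<Rightarrow> nat \<Rightarrow>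
    (nat \<Rightarrow> real) \<Rightarrow> real \<Rightarrow> bool" where
  "approximately_controllable \<alpha> S B D E n t b \<longleftrightarrow>
     closure (control_map \<alpha> S B D E n t b ` controls n b) = UNIV"

text \<open>
  The Hilbert space adjoint of \<open>control_map\<close>; its values are determined up to equality almost
  everywhere. The library's \<open>adjoint\<close> does not apply, since the domain is not a type.
\<close>

definition control_map_adj :: "real \<Rightarrow> (real \<Rightarrow> 'h::real_inner \<Rightarrow> 'h) \<Rightarrow>
    ('u::real_inner \<Rightarrow> 'h) \<Rightarrow> (nat \<Rightarrow> 'h \<Rightarrow> 'h) \<Rightarrow> (nat \<Rightarrow> 'u \<Rightarrow> 'h) \<Rightarrow> nat \<Rightarrow>
    (nat \<Rightarrow> real) \<Rightarrow> real \<Rightarrow> 'h \<Rightarrow> (real \<Rightarrow> 'u) \<times> (nat \<Rightarrow> 'u)" where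
  "control_map_adj \<alpha> S B D E n t b \<phi> =
     (SOME q. q \<in> controls n b \<and>
        (\<forall>p\<in>controls n b. control_map \<alpha> S B D E n t b p \<bullet> \<phi> = control_inner n b p q))"

definition gramian :: "real \<Rightarrow> (real \<Rightarrow> 'h::real_inner \<Rightarrow> 'h) \<Rightarrow> ('u::real_inner \<Rightarrow> 'h) \<Rightarrow>
    real \<Rightarrow> real \<Rightarrow> 'h \<Rightarrow> 'h" where
  "gramian \<alpha> S B a c \<phi> =
     bochner_integral {a..c} (\<lambda>s. (c - s) powr (2 * \<alpha> - 2) *\<^sub>R
       frac_P \<alpha> S (c - s) (B (adjoint B (adjoint (frac_P \<alpha> S (c - s)) \<phi>))))"

definition Omega_op :: "real \<Rightarrow> (real \<Rightarrow> 'h::real_inner \<Rightarrow> 'h) \<Rightarrow> ('u::real_inner \<Rightarrow> 'h) \<Rightarrow>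
    nat \<Rightarrow> (nat \<Rightarrow> real) \<Rightarrow> real \<Rightarrow> 'h \<Rightarrow> 'h" where
  "Omega_op \<alpha> S B n t b \<phi> = gramian \<alpha> S B (t n) b \<phi>"

definition Omega_tilde_op :: "real \<Rightarrow> (real \<Rightarrow> 'h::real_inner \<Rightarrow> 'h) \<Rightarrow>
    (nat \<Rightarrow> 'u::real_inner \<Rightarrow> 'h) \<Rightarrow> nat \<Rightarrow> (nat \<Rightarrow> real) \<Rightarrow> real \<Rightarrow> 'h \<Rightarrow> 'h" where
  "Omega_tilde_op \<alpha> S E n t b \<phi> =
     frac_S \<alpha> S (b - t n) (E n (adjoint (E n) (adjoint (frac_S \<alpha> S (b - t n)) \<phi>)))"

definition Psi_op :: "real \<Rightarrow> (real \<Rightarrow> 'h::real_inner \<Rightarrow> 'h) \<Rightarrow> ('u::real_inner \<Rightarrow> 'h) \<Rightarrow>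
    (nat \<Rightarrow> 'h \<Rightarrow> 'h) \<Rightarrow> nat \<Rightarrow> (nat \<Rightarrow> real) \<Rightarrow> real \<Rightarrow> 'h \<Rightarrow> 'h" where
  "Psi_op \<alpha> S B D n t b \<phi> =
     frac_S \<alpha> S (b - t n)
       (\<Sum>i=1..n. prod_down (jump_step \<alpha> S D t) n (i + 1)
          (let z = prod_up (jump_step_adj \<alpha> S D t) (i + 1) n (adjoint (frac_S \<alpha> S (b - t n)) \<phi>);
               y = gramian \<alpha> S B (t (i - 1)) (t i) (z + adjoint (D i) z)
           in y + D i y))"

definition Psi_tilde_op :: "real \<Rightarrow> (real \<Rightarrow> 'h::real_inner \<Rightarrow> 'h) \<Rightarrow>
    (nat \<Rightarrow> 'h \<Rightarrow> 'h) \<Rightarrow> (nat \<Rightarrow> 'u::real_inner \<Rightarrow> 'h) \<Rightarrow> nat \<Rightarrow> (nat \<Rightarrow> real) \<Rightarrow> real \<Rightarrow>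
    'h \<Rightarrow> 'h" where
  "Psi_tilde_op \<alpha> S D E n t b \<phi> =
     frac_S \<alpha> S (b - t n)
       (\<Sum>i=2..n. prod_down (jump_step \<alpha> S D t) n i
          (E (i - 1) (adjoint (E (i - 1))
             (prod_up (jump_step_adj \<alpha> S D t) i n (adjoint (frac_S \<alpha> S (b - t n)) \<phi>)))))"

definition controllability_op :: "real \<Rightarrow> (real \<Rightarrow> 'h::real_inner \<Rightarrow> 'h) \<Rightarrow>
    ('u::real_inner \<Rightarrow> 'h) \<Rightarrow> (nat \<Rightarrow> 'h \<Rightarrow> 'h) \<Rightarrow> (nat \<Rightarrow> 'u \<Rightarrow> 'h) \<Rightarrow> nat \<Rightarrow>
    (nat \<Rightarrow> real) \<Rightarrow> real \<Rightarrow> 'h \<Rightarrow> 'h" where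
  "controllability_op \<alpha> S B D E n t b \<phi> =
     Omega_op \<alpha> S B n t b \<phi> + Psi_op \<alpha> S B D n t b \<phi>
     + Omega_tilde_op \<alpha> S E n t b \<phi> + Psi_tilde_op \<alpha> S D E n t b \<phi>"

definition strictly_positive :: "('h::real_inner \<Rightarrow> 'h) \<Rightarrow> bool" where
  "strictly_positive T \<longleftrightarrow> (\<forall>y. y \<noteq> 0 \<longrightarrow> T y \<bullet> y > 0)"

definition scaled_resolvent :: "('h::real_vector \<Rightarrow> 'h) \<Rightarrow> real \<Rightarrow> 'h \<Rightarrow> 'h" where
  "scaled_resolvent T \<epsilon> \<phi> = \<epsilon> *\<^sub>R inv (\<lambda>x. \<epsilon> *\<^sub>R x + T x) \<phi>"

definition converges_SOT :: "('c \<Rightarrow> 'h::real_normed_vector \<Rightarrow> 'h) \<Rightarrow> ('h \<Rightarrow> 'h) \<Rightarrow> 'c filter \<Rightarrow> bool"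
  where "converges_SOT R L F \<longleftrightarrow> (\<forall>\<phi>. ((\<lambda>\<epsilon>. R \<epsilon> \<phi>) \<longlongrightarrow> L \<phi>) F)"

definition converges_WOT :: "('c \<Rightarrow> 'h::real_inner \<Rightarrow> 'h) \<Rightarrow> ('h \<Rightarrow> 'h) \<Rightarrow> 'c filter \<Rightarrow> bool"
  where "converges_WOT R L F \<longleftrightarrow> (\<forall>\<phi> \<psi>. ((\<lambda>\<epsilon>. R \<epsilon> \<phi> \<bullet> \<psi>) \<longlongrightarrow> L \<phi> \<bullet> \<psi>) F)"

end

(* The inner product of the control-to-state map M with phi is the inner product of the control with an
   explicit pair q(phi), so controllability_op is M composed with q, a symmetric nonnegative operator
   G with <G phi, psi> = <q phi, q psi>. Density of the range of M, triviality of the kernel of the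
   adjoint and strict positivity of G all say that q phi = 0 only for phi = 0. If G is injective, its
   range is dense, and the contractions e (e + G)^-1 tend to 0 on that range because they map G x to
   e (x - e (e + G)^-1 x); conversely they fix the kernel of G.

   The analytic input is that the operators S_alpha and P_alpha are bounded and depend strongly
   continuously on time, together with their adjoints. For alpha < 1 this rests on the decay of the
   Wright function, faster than every exponential, obtained by deforming a contour; for the adjoints
   it uses that the adjoint semigroup is strongly continuous. For alpha <= 1/2 the function component
   of q(phi) is square integrable because M is bounded, by testing M against truncations of it. *)
theory Submission
  imports Defs "HOL-Complex_Analysis.Complex_Analysis"
begin

section \<open>Hilbert spaces\<close>

text \<open>Vectors are identified by testing them against arbitrary vectors. This turns
  vector-valued integrals into real Lebesgue integrals and products of operators into products of
  adjoints, and linearity can be read off the pairing instead of the long defining formulas. The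
  decay of the Wright function is invisible termwise: the natural majorant of its series grows
  faster than every exponential, so the decay comes from cancellation, which a contour has to
  exhibit. Every exponential rate is required because the growth rate of the semigroup is arbitrary
  and gets multiplied by the time parameter. The spaces may be nonseparable, so measurability is
  drawn from norm continuity off finitely many points. For adjoints only weak continuity is
  automatic; norm continuity costs a separate argument. For \<alpha> \<le> 1/2 the kernel
  \<open>(c - s) powr (2 * \<alpha> - 2)\<close> is not integrable, and norm estimates cannot even
  show that the Gramian integrals exist; existence is inherited from square integrability of the
  adjoint control.\<close>

lemma closed_subspace_orthogonal:
  fixes V :: "'h::{real_inner, banach} set"
  assumes V: "subspace V" "closed V" "V \<noteq> UNIV"
  obtains w where "w \<noteq> 0" "\<And>v. v \<in> V \<Longrightarrow> v \<bullet> w = 0"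
proof -
  obtain x where x: "x \<notin> V" using V(3) by auto
  define d where "d = Inf ((\<lambda>v. (norm (x - v))\<^sup>2) ` V)"
  have ne: "V \<noteq> {}" using subspace_0[OF V(1)] by auto
  have bdd: "bdd_below ((\<lambda>v. (norm (x - v))\<^sup>2) ` V)"
    by (rule bdd_belowI[of _ 0]) auto
  have dle: "d \<le> (norm (x - v))\<^sup>2" if "v \<in> V" for v
    unfolding d_def using bdd that by (intro cInf_lower) auto
  have "\<exists>v\<in>V. (norm (x - v))\<^sup>2 < d + 1 / (real k + 1)" for k
  proof -
    have "Inf ((\<lambda>v. (norm (x - v))\<^sup>2) ` V) < d + 1 / (real k + 1)" by (simp add: d_def)
    then show ?thesis using cInf_lessD[of "(\<lambda>v. (norm (x - v))\<^sup>2) ` V"] ne by blast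
  qed
  then obtain f where fV: "\<And>k. f k \<in> V" and f: "\<And>k. (norm (x - f k))\<^sup>2 < d + 1 / (real k + 1)"
    by metis
  \<comment> \<open>Parallelogram law: the midpoint of \<open>u\<close> and \<open>v\<close> lies in
    \<open>V\<close>, so its distance from \<open>x\<close> cannot drop below the infimum, which
    forces two near-minimisers to be close to each other.\<close>
  have par: "(norm (u - v))\<^sup>2 \<le> 2 * (norm (x - u))\<^sup>2 + 2 * (norm (x - v))\<^sup>2 - 4 * d"
    if "u \<in> V" "v \<in> V" for u v
  proof -
    have "(1/2) *\<^sub>R (u + v) \<in> V" using that V(1) by (simp add: subspace_add subspace_scale)
    from dle[OF this] have "4 * d \<le> 4 * (norm (x - (1/2) *\<^sub>R (u + v)))\<^sup>2" by simp
    moreover have "2 * (norm (x - u))\<^sup>2 + 2 * (norm (x - v))\<^sup>2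
        = 4 * (norm (x - (1/2) *\<^sub>R (u + v)))\<^sup>2 + (norm (u - v))\<^sup>2"
      by (simp add: power2_norm_eq_inner algebra_simps inner_commute)
    ultimately show ?thesis by linarith
  qed
  have "Cauchy f"
  proof (rule metric_CauchyI)
    fix e :: real assume e: "e > 0"
    obtain N :: nat where N: "4 / e\<^sup>2 < real N + 1"
      using reals_Archimedean2[of "4 / e\<^sup>2"] by (metis add.commute less_add_one less_trans)
    have "dist (f m) (f k) < e" if "m \<ge> N" "k \<ge> N" for m k
    proof -
      have "1 / (real m + 1) \<le> 1 / (real N + 1)" "1 / (real k + 1) \<le> 1 / (real N + 1)"
        using that by (auto simp: frac_le)
      moreover have "4 / (real N + 1) < e\<^sup>2" using N e by (simp add: field_simps)
      ultimately have "(norm (f m - f k))\<^sup>2 < e\<^sup>2"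
        using par[OF fV[of m] fV[of k]] f[of m] f[of k] by linarith
      then show ?thesis using e by (simp add: dist_norm power2_less_imp_less)
    qed
    then show "\<exists>M. \<forall>m\<ge>M. \<forall>n\<ge>M. dist (f m) (f n) < e" by blast
  qed
  then obtain v where v: "f \<longlonglongrightarrow> v" using Cauchy_convergent convergent_def by blast
  have vV: "v \<in> V" using V(2) fV v closed_sequential_limits by blast
  have nv: "(norm (x - v))\<^sup>2 \<le> d"
  proof (rule LIMSEQ_le)
    show "(\<lambda>k. (norm (x - f k))\<^sup>2) \<longlonglongrightarrow> (norm (x - v))\<^sup>2" by (intro tendsto_intros v)
    show "(\<lambda>k. d + 1 / (real k + 1)) \<longlonglongrightarrow> d" by real_asymp
    show "\<exists>N. \<forall>n\<ge>N. (norm (x - f n))\<^sup>2 \<le> d + 1 / (real n + 1)" using f less_imp_le by blast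
  qed
  define w where "w = x - v"
  have "y \<bullet> w = 0" if y: "y \<in> V" for y
  proof (cases "y = 0")
    case False
    \<comment> \<open>The coefficient of the projection of \<open>w\<close> onto \<open>y\<close>.
      Moving \<open>v\<close> by \<open>c *\<^sub>R y\<close> would lower the squared distance by
      \<open>(y \<bullet> w)\<^sup>2 / (y \<bullet> y)\<close>, which minimality forbids unless this
      is 0.\<close>
    define c where "c = (y \<bullet> w) / (y \<bullet> y)"
    have yy: "y \<bullet> y > 0" using False by simp
    have "v + c *\<^sub>R y \<in> V" using vV y V(1) by (simp add: subspace_add subspace_scale)
    from dle[OF this] nv have "(norm (x - v))\<^sup>2 \<le> (norm (x - (v + c *\<^sub>R y)))\<^sup>2" by linarith
    also have "x - (v + c *\<^sub>R y) = w - c *\<^sub>R y" by (simp add: w_def)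
    also have "(norm (w - c *\<^sub>R y))\<^sup>2 = (norm w)\<^sup>2 - 2 * c * (y \<bullet> w) + c * c * (y \<bullet> y)"
      by (simp add: power2_norm_eq_inner algebra_simps inner_commute)
    also have "\<dots> = (norm w)\<^sup>2 - (y \<bullet> w)\<^sup>2 / (y \<bullet> y)"
      using yy by (simp add: c_def field_simps power2_eq_square)
    finally have "(y \<bullet> w)\<^sup>2 / (y \<bullet> y) \<le> 0" by (simp add: w_def)
    then show ?thesis using yy by (simp add: divide_le_0_iff)
  qed simp
  moreover have "w \<noteq> 0" using x vV by (auto simp: w_def)
  ultimately show ?thesis using that by blast
qed

lemma subspace_closure:
  fixes V :: "'a::real_normed_vector set"
  assumes V: "subspace V" shows "subspace (closure V)"
proof (rule subspaceI)
  show "0 \<in> closure V" using subspace_0[OF V] closure_subset by blast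
next
  fix x y assume "x \<in> closure V" "y \<in> closure V"
  then obtain f g where "\<And>n. f n \<in> V" "f \<longlonglongrightarrow> x" "\<And>n. g n \<in> V" "g \<longlonglongrightarrow> y"
    unfolding closure_sequential by blast
  then have "\<And>n. f n + g n \<in> V" "(\<lambda>n. f n + g n) \<longlonglongrightarrow> x + y"
    by (auto intro: subspace_add[OF V] tendsto_add)
  then show "x + y \<in> closure V" unfolding closure_sequential by fast
next
  fix c :: real and x assume "x \<in> closure V"
  then obtain f where "\<And>n. f n \<in> V" "f \<longlonglongrightarrow> x"
    unfolding closure_sequential by blast
  then have "\<And>n. c *\<^sub>R f n \<in> V" "(\<lambda>n. c *\<^sub>R f n) \<longlonglongrightarrow> c *\<^sub>R x"
    by (auto intro: subspace_scale[OF V] tendsto_intros)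
  then show "c *\<^sub>R x \<in> closure V" unfolding closure_sequential by fast
qed

lemma dense_subspace_iff:
  fixes V :: "'h::{real_inner, banach} set"
  assumes V: "subspace V"
  shows "closure V = UNIV \<longleftrightarrow> (\<forall>w. (\<forall>v\<in>V. v \<bullet> w = 0) \<longrightarrow> w = 0)"
proof
  assume cl: "closure V = UNIV"
  show "\<forall>w. (\<forall>v\<in>V. v \<bullet> w = 0) \<longrightarrow> w = 0"
  proof (intro allI impI)
    fix w assume w: "\<forall>v\<in>V. v \<bullet> w = 0"
    have "closure V \<subseteq> {v. v \<bullet> w = 0}"
      by (rule closure_minimal) (use w in \<open>auto intro!: closed_Collect_eq continuous_intros\<close>)
    then have "w \<bullet> w = 0" using cl by blast
    then show "w = 0" by simp
  qed
next
  assume *: "\<forall>w. (\<forall>v\<in>V. v \<bullet> w = 0) \<longrightarrow> w = 0"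
  show "closure V = UNIV"
  proof (rule ccontr)
    assume "closure V \<noteq> UNIV"
    then obtain w where "w \<noteq> 0" "\<And>v. v \<in> closure V \<Longrightarrow> v \<bullet> w = 0"
      using closed_subspace_orthogonal[of "closure V"] V subspace_closure by (metis closed_closure)
    then show False using * closure_subset by blast
  qed
qed

section \<open>Riesz representation, adjoints and uniform boundedness\<close>

lemma riesz_representation:
  fixes f :: "'h::{real_inner, banach} \<Rightarrow> real"
  assumes f: "bounded_linear f"
  obtains z where "\<And>x. f x = x \<bullet> z"
proof -
  interpret f: bounded_linear f by fact
  define V where "V = {x. f x = 0}"
  have sub: "subspace V" by (auto simp: V_def subspace_def f.zero f.add f.scaleR)
  have cl: "closed V" unfolding V_def
    by (intro closed_Collect_eq continuous_intros f.continuous_on)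
  show ?thesis
  proof (cases "V = UNIV")
    case True
    then show ?thesis using that[of 0] by (auto simp: V_def)
  next
    case False
    then obtain w where w: "w \<noteq> 0" "\<And>v. v \<in> V \<Longrightarrow> v \<bullet> w = 0"
      using closed_subspace_orthogonal[OF sub cl] by metis
    have fw: "f w \<noteq> 0" using w by (force simp: V_def)
    have ww: "w \<bullet> w \<noteq> 0" using w by simp
    \<comment> \<open>The kernel has codimension one, so \<open>x\<close> differs from a multiple of
      the normal vector \<open>w\<close> by an element of \<open>V\<close>.\<close>
    have "f x = x \<bullet> ((f w / (w \<bullet> w)) *\<^sub>R w)" for x
    proof -
      have "x - (f x / f w) *\<^sub>R w \<in> V" using fw by (simp add: V_def f.diff f.scaleR)
      from w(2)[OF this] have "x \<bullet> w = f x / f w * (w \<bullet> w)" by (simp add: inner_diff_left)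
      then show ?thesis using fw ww by simp
    qed
    then show ?thesis using that by blast
  qed
qed

text \<open>\<open>adjoint\<close> is defined by choice and obeys its identity only once some
  adjoint is known to exist; in infinite dimension the existence comes from Riesz
  representation.\<close>

lemma adjoint_bounded:
  fixes T :: "'a::{real_inner, banach} \<Rightarrow> 'b::real_inner"
  assumes T: "bounded_linear T"
  shows "T x \<bullet> y = x \<bullet> adjoint T y"
proof -
  have "\<exists>z. \<forall>x. T x \<bullet> y = x \<bullet> z" for y
    using riesz_representation[OF bounded_linear_compose[OF bounded_linear_inner_left T], of y]
    by (metis)
  then obtain g where g: "\<And>x y. T x \<bullet> y = x \<bullet> g y" by metis
  then have "adjoint T = g" by (intro adjoint_unique) auto
  then show ?thesis using g by simp
qed

lemma norm_adjoint_le: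
  fixes T :: "'a::{real_inner, banach} \<Rightarrow> 'b::real_inner"
  assumes T: "bounded_linear T" and K: "\<And>x. norm (T x) \<le> K * norm x" and K0: "K \<ge> 0"
  shows "norm (adjoint T y) \<le> K * norm y"
proof (cases "adjoint T y = 0")
  case True
  then show ?thesis using K0 by simp
next
  case False
  have "(norm (adjoint T y))\<^sup>2 = T (adjoint T y) \<bullet> y"
    by (simp add: adjoint_bounded[OF T] power2_norm_eq_inner)
  also have "\<dots> \<le> norm (T (adjoint T y)) * norm y" by (rule norm_cauchy_schwarz)
  also have "\<dots> \<le> K * norm (adjoint T y) * norm y" by (intro mult_right_mono K) auto
  finally show ?thesis using False by (simp add: power2_eq_square)
qed

lemma bounded_linear_adjoint:
  fixes T :: "'a::{real_inner, banach} \<Rightarrow> 'b::real_inner"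
  assumes T: "bounded_linear T"
  shows "bounded_linear (adjoint T)"
proof -
  obtain K where K: "\<And>x. norm (T x) \<le> K * norm x" and K0: "K \<ge> 0"
    using bounded_linear.nonneg_bounded[OF T] by (metis mult.commute)
  show ?thesis
  proof (rule bounded_linear_intro)
    fix x y :: 'b and r :: real
    have "z \<bullet> adjoint T (x + y) = z \<bullet> (adjoint T x + adjoint T y)" for z
      by (simp add: adjoint_bounded[OF T, symmetric] inner_add_right)
    then show "adjoint T (x + y) = adjoint T x + adjoint T y" by (metis vector_eq_ldot)
    have "z \<bullet> adjoint T (r *\<^sub>R x) = z \<bullet> (r *\<^sub>R adjoint T x)" for z
      by (simp add: adjoint_bounded[OF T, symmetric])
    then show "adjoint T (r *\<^sub>R x) = r *\<^sub>R adjoint T x" by (metis vector_eq_ldot)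
    show "norm (adjoint T x) \<le> norm x * K"
      using norm_adjoint_le[OF T K K0] by (simp add: mult.commute)
  qed
qed

text \<open>Baire category: the closed sets \<open>F k\<close> exhaust the complete space, so one of
  them contains a ball. A sequence of operators is all that is required later, for times shrinking
  to 0.\<close>

lemma banach_steinhaus_sequence:
  fixes T :: "nat \<Rightarrow> 'a::banach \<Rightarrow> 'b::real_normed_vector"
  assumes T: "\<And>i. bounded_linear (T i)" and bdd: "\<And>x. \<exists>C. \<forall>i. norm (T i x) \<le> C"
  obtains K where "\<And>i x. norm (T i x) \<le> K * norm x"
proof -
  define F where "F k = {x. \<forall>i. norm (T i x) \<le> real k}" for k
  have clF: "closed (F k)" for k
  proof -
    have "F k = (\<Inter>i. {x. norm (T i x) \<le> real k})" by (auto simp: F_def)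
    moreover have "closed {x. norm (T i x) \<le> real k}" for i
      by (intro closed_Collect_le continuous_intros bounded_linear.continuous_on[OF T])
    ultimately show ?thesis by auto
  qed
  have un: "(\<Union>k. F k) = UNIV"
  proof -
    have "\<exists>k. x \<in> F k" for x
    proof -
      obtain C where "\<forall>i. norm (T i x) \<le> C" using bdd by blast
      moreover obtain k :: nat where "C \<le> real k" using real_arch_simple by blast
      ultimately show ?thesis unfolding F_def using order_trans by blast
    qed
    then show ?thesis by auto
  qed
  have "\<exists>k. interior (F k) \<noteq> {}"
  proof (rule ccontr)
    assume "\<not> ?thesis"
    then have "Met_TC.mtopology interior_of \<Union> (range F) = {}"
      using clF
      by (intro Met_TC.metric_Baire_category_alt) (auto simp: complete_UNIV closed_closedin[symmetric])
    then show False using un by simp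
  qed
  then obtain k x0 where "x0 \<in> interior (F k)" by blast
  then obtain e where e: "e > 0" "cball x0 e \<subseteq> F k" by (meson mem_interior_cball)
  \<comment> \<open>Rescaling \<open>x\<close> to the radius \<open>e\<close> gives a vector
    \<open>y\<close> with \<open>x0\<close> and \<open>x0 + y\<close> both in \<open>F k\<close>;
    the difference of the two values costs the factor 2.\<close>
  have "norm (T i x) \<le> (2 * real k / e) * norm x" for i x
  proof (cases "x = 0")
    case True
    then show ?thesis using bounded_linear.linear[OF T] by (simp add: linear_0)
  next
    case False
    interpret T: bounded_linear "T i" by (rule T)
    define y where "y = (e / norm x) *\<^sub>R x"
    have "norm y = e" using False e by (simp add: y_def)
    then have "x0 + y \<in> cball x0 e" "x0 \<in> cball x0 e" using e by (auto simp: dist_norm)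
    then have "x0 + y \<in> F k" "x0 \<in> F k" using e(2) by auto
    then have "norm (T i (x0 + y)) \<le> k" "norm (T i x0) \<le> k" by (auto simp: F_def)
    moreover have "T i y = T i (x0 + y) - T i x0" by (simp add: T.add)
    ultimately have "norm (T i y) \<le> 2 * real k"
      using norm_triangle_ineq4[of "T i (x0 + y)" "T i x0"] by simp
    moreover have "norm (T i y) = e / norm x * norm (T i x)"
      using e by (simp add: y_def T.scaleR)
    ultimately show ?thesis using e False by (simp add: field_simps)
  qed
  then show ?thesis using that by blast
qed

section \<open>Resolvents of symmetric nonnegative operators\<close>

lemma subspace_linear_range:
  assumes "linear (T :: 'a::real_vector \<Rightarrow> 'b::real_vector)" shows "subspace (range T)"
  using assms by (simp add: linear_subspace_image subspace_UNIV)

text \<open>Symmetry makes the graph of \<open>T\<close> closed, so no bound on \<open>T\<close> has to be assumed.\<close>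

lemma bij_resolvent:
  fixes T :: "'h::{real_inner, banach} \<Rightarrow> 'h"
  assumes lin: "linear T" and sym: "\<And>x y. T x \<bullet> y = x \<bullet> T y" and pos: "\<And>x. T x \<bullet> x \<ge> 0"
    and e: "e > 0"
  shows "bij (\<lambda>x. e *\<^sub>R x + T x)" and "e * norm x \<le> norm (e *\<^sub>R x + T x)"
proof -
  interpret T: linear T by fact
  let ?R = "\<lambda>x. e *\<^sub>R x + T x"
  have linR: "linear ?R"
    by (rule linearI) (simp_all add: T.add T.scale algebra_simps)
  \<comment> \<open>Coercivity: nonnegativity of \<open>T\<close> leaves at least \<open>e\<close>
    times the squared norm in the quadratic form. The bound gives injectivity, a closed range and
    later the contraction property.\<close>
  have low: "e * norm x \<le> norm (?R x)" for x
  proof (cases "x = 0")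
    case False
    have "e * norm x * norm x \<le> ?R x \<bullet> x"
      using pos[of x] by (simp add: inner_add_left power2_norm_eq_inner[symmetric] power2_eq_square)
    also have "\<dots> \<le> norm (?R x) * norm x" by (rule norm_cauchy_schwarz)
    finally show ?thesis using False by simp
  qed simp
  then show "e * norm x \<le> norm (?R x)" .
  have inj: "inj ?R"
  proof (rule injI)
    fix x y assume "?R x = ?R y"
    then have "?R (x - y) = 0" by (simp add: T.diff algebra_simps)
    then show "x = y" using low[of "x - y"] e by (simp add: mult_le_0_iff)
  qed
  have cl: "closed (range ?R)"
    unfolding closed_sequential_limits
  proof (intro allI impI)
    fix f l assume "(\<forall>n. f n \<in> range ?R) \<and> f \<longlonglongrightarrow> l"
    then have l: "f \<longlonglongrightarrow> l" and "\<forall>n. \<exists>x. f n = ?R x" by auto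
    from choice[OF this(2)] obtain g where f: "\<And>n. f n = ?R (g n)" by blast
    have dist: "e * dist (g m) (g n) \<le> dist (f m) (f n)" for m n
    proof -
      have "f m - f n = ?R (g m - g n)" unfolding f T.diff scaleR_diff_right by simp
      then show ?thesis using low[of "g m - g n"] by (simp only: dist_norm)
    qed
    have "Cauchy g"
    proof (rule metric_CauchyI)
      fix r :: real assume "r > 0"
      then have "e * r > 0" using e by simp
      moreover have "Cauchy f" using l LIMSEQ_imp_Cauchy by blast
      ultimately obtain M where "\<forall>m\<ge>M. \<forall>n\<ge>M. dist (f m) (f n) < e * r"
        by (meson Cauchy_def)
      then have "\<forall>m\<ge>M. \<forall>n\<ge>M. e * dist (g m) (g n) < e * r" using dist le_less_trans by blast
      then show "\<exists>M. \<forall>m\<ge>M. \<forall>n\<ge>M. dist (g m) (g n) < r" using e by auto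
    qed
    then obtain x where x: "g \<longlonglongrightarrow> x" using Cauchy_convergent convergent_def by blast
    have "z \<bullet> l = z \<bullet> ?R x" for z
    proof (rule LIMSEQ_unique)
      show "(\<lambda>n. z \<bullet> f n) \<longlonglongrightarrow> z \<bullet> l" by (intro tendsto_intros l)
      have "(\<lambda>n. e * (z \<bullet> g n) + T z \<bullet> g n) \<longlonglongrightarrow> e * (z \<bullet> x) + T z \<bullet> x"
        by (intro tendsto_intros x)
      then show "(\<lambda>n. z \<bullet> f n) \<longlonglongrightarrow> z \<bullet> ?R x"
        by (simp add: f inner_add_right sym)
    qed
    then have "l = ?R x" by (metis vector_eq_ldot)
    then show "l \<in> range ?R" by blast
  qed
  have "range ?R = UNIV"
  proof (rule ccontr)
    assume "range ?R \<noteq> UNIV"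
    then obtain w where w: "w \<noteq> 0" "\<And>v. v \<in> range ?R \<Longrightarrow> v \<bullet> w = 0"
      using closed_subspace_orthogonal[OF subspace_linear_range[OF linR] cl] by metis
    then have "?R w \<bullet> w = 0" by blast
    then have "e * (w \<bullet> w) \<le> 0" using pos[of w] by (simp add: inner_add_left)
    moreover have "w \<bullet> w > 0" using w by simp
    ultimately show False using e by (simp add: mult_le_0_iff)
  qed
  with inj show "bij ?R" by (simp add: bij_def)
qed

text \<open>The three implications close a cycle. The weak topology suffices for the last one: if
  \<open>T y \<bullet> y = 0\<close> with \<open>y\<close> nonzero, then \<open>ker\<close> makes
  \<open>y\<close> a fixed vector of every scaled resolvent, and pairing with \<open>y\<close>
  itself detects this.\<close>

lemma resolvent_convergence:
  fixes T :: "'h::{real_inner, banach} \<Rightarrow> 'h"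
  assumes lin: "linear T" and sym: "\<And>x y. T x \<bullet> y = x \<bullet> T y" and pos: "\<And>x. T x \<bullet> x \<ge> 0"
    and ker: "\<And>x. T x \<bullet> x = 0 \<Longrightarrow> T x = 0"
  shows "strictly_positive T \<Longrightarrow> converges_SOT (scaled_resolvent T) (\<lambda>_. 0) (at_right 0)"
    and "converges_SOT (scaled_resolvent T) (\<lambda>_. 0) (at_right 0) \<Longrightarrow>
      converges_WOT (scaled_resolvent T) (\<lambda>_. 0) (at_right 0)"
    and "converges_WOT (scaled_resolvent T) (\<lambda>_. 0) (at_right 0) \<Longrightarrow> strictly_positive T"
proof -
  interpret T: linear T by fact
  let ?R = "\<lambda>e x. e *\<^sub>R x + T x"
  note bij = bij_resolvent(1)[OF lin sym pos] and low = bij_resolvent(2)[OF lin sym pos]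
  have inv_eq: "inv (?R e) y = x" if "e > 0" "?R e x = y" for e x y
    using inv_f_f[OF bij_is_inj[OF bij[OF that(1)]], of x] that(2) by simp
  have inv_right: "?R e (inv (?R e) y) = y" if "e > 0" for e y
    using surj_f_inv_f[OF bij_is_surj[OF bij[OF that]], of y] by simp
  have res_le: "norm (scaled_resolvent T e y) \<le> norm y" if "e > 0" for e y
    using low[OF that, of "inv (?R e) y"] that
    by (simp add: scaled_resolvent_def inv_right)
  have res_add: "scaled_resolvent T e (y + z) = scaled_resolvent T e y + scaled_resolvent T e z"
    if e: "e > 0" for e y z
  proof -
    have "?R e (inv (?R e) y + inv (?R e) z) = ?R e (inv (?R e) y) + ?R e (inv (?R e) z)"
      by (simp add: T.add algebra_simps)
    also have "\<dots> = y + z" using inv_right[OF e] by simp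
    finally show ?thesis
      unfolding scaled_resolvent_def scaleR_add_right[symmetric] by (subst inv_eq[OF e]) auto
  qed
  have res_T: "norm (scaled_resolvent T e (T x)) \<le> 2 * e * norm x" if e: "e > 0" for e x
  proof -
    have "?R e (x - scaled_resolvent T e x) = ?R e x - e *\<^sub>R ?R e (inv (?R e) x)"
      by (simp add: scaled_resolvent_def T.diff T.scale scaleR_diff_right scaleR_add_right)
    also have "\<dots> = T x" using inv_right[OF e] by simp
    finally have "scaled_resolvent T e (T x) = e *\<^sub>R (x - scaled_resolvent T e x)"
      unfolding scaled_resolvent_def[of T e "T x"] by (subst inv_eq[OF e]) auto
    moreover have "norm (x - scaled_resolvent T e x) \<le> 2 * norm x"
      using norm_triangle_ineq4[of x "scaled_resolvent T e x"] res_le[OF e, of x] by simp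
    ultimately show ?thesis using e by simp
  qed
  show "converges_SOT (scaled_resolvent T) (\<lambda>_. 0) (at_right 0)" if sp: "strictly_positive T"
  proof -
    have "closure (range T) = UNIV"
      unfolding dense_subspace_iff[OF subspace_linear_range[OF lin]]
    proof (intro allI impI)
      fix w assume "\<forall>v\<in>range T. v \<bullet> w = 0"
      then have "T w \<bullet> w = 0" by blast
      then show "w = 0" using sp unfolding strictly_positive_def by force
    qed
    show ?thesis unfolding converges_SOT_def
    proof (intro allI tendstoI)
      fix y :: 'h and r :: real assume r: "r > 0"
      obtain x where x: "norm (y - T x) < r / 2"
        using \<open>closure (range T) = UNIV\<close> r closure_approachable[of y "range T"]
        by (auto simp: dist_norm norm_minus_commute dest: spec[of _ "r/2"])
      have "\<forall>\<^sub>F e in at_right (0::real). 2 * e * norm x < r / 2"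
      proof -
        have "((\<lambda>e. 2 * e * norm x) \<longlongrightarrow> 2 * 0 * norm x) (at_right 0)"
          by (intro tendsto_intros)
        then show ?thesis using r by (intro order_tendstoD) auto
      qed
      moreover have "\<forall>\<^sub>F e in at_right (0::real). e > 0" by (simp add: eventually_at_right_less)
      ultimately show "\<forall>\<^sub>F e in at_right 0. dist (scaled_resolvent T e y) 0 < r"
      proof eventually_elim
        case (elim e)
        have "scaled_resolvent T e y = scaled_resolvent T e (y - T x) + scaled_resolvent T e (T x)"
          using res_add[OF elim(2), of "y - T x" "T x"] by simp
        then have "norm (scaled_resolvent T e y) \<le> norm (y - T x) + 2 * e * norm x"
          using norm_triangle_ineq[of "scaled_resolvent T e (y - T x)" "scaled_resolvent T e (T x)"]
            res_le[OF elim(2), of "y - T x"] res_T[OF elim(2), of x] by simp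
        then show ?case using x elim by simp
      qed
    qed
  qed
  show "converges_WOT (scaled_resolvent T) (\<lambda>_. 0) (at_right 0)"
    if "converges_SOT (scaled_resolvent T) (\<lambda>_. 0) (at_right 0)"
    using that tendsto_inner[OF _ tendsto_const] unfolding converges_SOT_def converges_WOT_def by fastforce
  show "strictly_positive T" if W: "converges_WOT (scaled_resolvent T) (\<lambda>_. 0) (at_right 0)"
    unfolding strictly_positive_def
  proof (intro allI impI)
    fix y :: 'h assume y: "y \<noteq> 0"
    have "T y \<bullet> y \<noteq> 0"
    proof
      assume "T y \<bullet> y = 0"
      then have T0: "T y = 0" by (rule ker)
      have "scaled_resolvent T e y = y" if "e > 0" for e
      proof -
        have "inv (?R e) y = (1 / e) *\<^sub>R y"
          using that T0 by (intro inv_eq) (auto simp: T.scale)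
        then show ?thesis using that by (simp add: scaled_resolvent_def)
      qed
      then have "\<forall>\<^sub>F e in at_right (0::real). scaled_resolvent T e y \<bullet> y = y \<bullet> y"
        by (auto intro: eventually_mono[OF eventually_at_right_less])
      moreover have "((\<lambda>e. scaled_resolvent T e y \<bullet> y) \<longlongrightarrow> 0) (at_right 0)"
        using W by (auto simp: converges_WOT_def)
      ultimately have "((\<lambda>e::real. y \<bullet> y) \<longlongrightarrow> 0) (at_right 0)"
        by (simp add: tendsto_cong)
      then show False using y by (simp add: tendsto_const_iff)
    qed
    then show "T y \<bullet> y > 0" using pos[of y] by simp
  qed
qed

section \<open>Strong measurability and the Bochner integral\<close>

text \<open>Rests on completeness of Lebesgue measure, since the limit exists only almost
  everywhere. Extension by 0 outside \<open>I\<close> moves the argument to the full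
  measure.\<close>

lemma borel_measurable_AE_limit:
  fixes h :: "real \<Rightarrow> real"
  assumes I: "I \<in> sets lebesgue" and f: "\<And>i. f i \<in> borel_measurable (lebesgue_on I)"
    and lim: "AE s in lebesgue_on I. (\<lambda>i::nat. f i s) \<longlonglongrightarrow> h s"
  shows "h \<in> borel_measurable (lebesgue_on I)"
proof -
  define f' where "f' i s = (if s \<in> I then f i s else 0)" for i s
  have [measurable]: "f' i \<in> borel_measurable lebesgue" for i
    unfolding f'_def using borel_measurable_if[OF I] f by blast
  have "(\<lambda>s. lim (\<lambda>i. f' i s)) \<in> borel_measurable lebesgue" by measurable
  moreover have "AE s in lebesgue. lim (\<lambda>i. f' i s) = (if s \<in> I then h s else 0)"
  proof -
    have "AE s in lebesgue. s \<in> I \<longrightarrow> (\<lambda>i. f i s) \<longlonglongrightarrow> h s"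
      using lim I by (subst (asm) AE_restrict_space_iff) auto
    then show ?thesis by eventually_elim (auto simp: f'_def intro: limI)
  qed
  ultimately have "(\<lambda>s. if s \<in> I then h s else 0) \<in> borel_measurable lebesgue"
    by (rule borel_measurable_AE)
  then show ?thesis using borel_measurable_if[OF I] by blast
qed

text \<open>Any function of two simple functions is simple, so continuity of \<open>\<phi>\<close>
  enters only in the limit, and only at the values actually taken. This admits kernels that are
  singular at the right end of an interval.\<close>

lemma strongly_measurable_compose2:
  assumes f: "strongly_measurable_on I f" and g: "strongly_measurable_on I g"
    and cont: "AE s in lebesgue_on I. isCont (\<lambda>(x, y). \<phi> x y) (f s, g s)"
  shows "strongly_measurable_on I (\<lambda>s. \<phi> (f s) (g s))"
proof -
  obtain F where F: "\<And>i::nat. simple_function (lebesgue_on I) (F i)"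
      "AE s in lebesgue_on I. (\<lambda>i. F i s) \<longlonglongrightarrow> f s"
    using f by (auto simp: strongly_measurable_on_def)
  obtain G where G: "\<And>i::nat. simple_function (lebesgue_on I) (G i)"
      "AE s in lebesgue_on I. (\<lambda>i. G i s) \<longlonglongrightarrow> g s"
    using g by (auto simp: strongly_measurable_on_def)
  have "\<And>i. simple_function (lebesgue_on I) (\<lambda>s. \<phi> (F i s) (G i s))"
    using simple_function_compose2[OF F(1) G(1), where h=\<phi>] .
  moreover have "AE s in lebesgue_on I. (\<lambda>i. \<phi> (F i s) (G i s)) \<longlonglongrightarrow> \<phi> (f s) (g s)"
    using F(2) G(2) cont
  proof eventually_elim
    case (elim s)
    have "(\<lambda>i. (F i s, G i s)) \<longlonglongrightarrow> (f s, g s)" using elim by (intro tendsto_intros)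
    from isCont_tendsto_compose[OF elim(3) this] show ?case by simp
  qed
  ultimately show ?thesis
    unfolding strongly_measurable_on_def by (intro exI[of _ "\<lambda>i s. \<phi> (F i s) (G i s)"] conjI allI)
qed

lemma strongly_measurable_const: "strongly_measurable_on I (\<lambda>_. c)"
  unfolding strongly_measurable_on_def by (intro exI[of _ "\<lambda>_ _. c"]) auto

lemma strongly_measurable_real_iff:
  fixes f :: "real \<Rightarrow> real"
  assumes I: "I \<in> sets lebesgue"
  shows "strongly_measurable_on I f \<longleftrightarrow> f \<in> borel_measurable (lebesgue_on I)"
proof
  assume "strongly_measurable_on I f"
  then show "f \<in> borel_measurable (lebesgue_on I)"
    unfolding strongly_measurable_on_def
    using borel_measurable_AE_limit[OF I] borel_measurable_simple_function by blast
next
  assume "f \<in> borel_measurable (lebesgue_on I)"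
  from borel_measurable_implies_sequence_metric[OF this, of 0]
  obtain F where "\<And>i. simple_function (lebesgue_on I) (F i)" "\<And>s. s \<in> I \<Longrightarrow> (\<lambda>i. F i s) \<longlonglongrightarrow> f s"
    by auto
  then show "strongly_measurable_on I f"
    unfolding strongly_measurable_on_def by (intro exI[of _ F]) auto
qed

lemma strongly_measurable_id: "I \<in> sets lebesgue \<Longrightarrow> strongly_measurable_on I (\<lambda>s. s)"
  using id_borel_measurable_lebesgue_on[of I] by (simp add: strongly_measurable_real_iff id_def)

lemma strongly_measurable_compose:
  assumes "strongly_measurable_on I f"
    and "AE s in lebesgue_on I. isCont \<phi> (f s)"
  shows "strongly_measurable_on I (\<lambda>s. \<phi> (f s))"
proof (rule strongly_measurable_compose2[OF assms(1) assms(1), where \<phi>="\<lambda>x y. \<phi> x"])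
  show "AE s in lebesgue_on I. isCont (\<lambda>(x, y). \<phi> x) (f s, f s)"
    using assms(2)
  proof eventually_elim
    case (elim s)
    have "isCont fst (f s, f s)" by (intro continuous_intros)
    from isCont_o2[OF this, of \<phi>] elim show ?case by (simp add: case_prod_unfold)
  qed
qed

text \<open>The source of measurability for orbits and adjoint controls: both are continuous off a
  finite set of times. The identity function is strongly measurable, and \<open>f\<close> is
  composed with it.\<close>

lemma strongly_measurable_AE_continuous:
  assumes "I \<in> sets lebesgue" "AE s in lebesgue_on I. isCont f s"
  shows "strongly_measurable_on I f"
  using strongly_measurable_compose[OF strongly_measurable_id, of I f] assms by simp

lemma strongly_measurable_norm:
  "strongly_measurable_on I f \<Longrightarrow> strongly_measurable_on I (\<lambda>s. norm (f s))"
  by (rule strongly_measurable_compose) (auto intro: continuous_intros)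

lemma strongly_measurable_add:
  "strongly_measurable_on I f \<Longrightarrow> strongly_measurable_on I g \<Longrightarrow>
    strongly_measurable_on I (\<lambda>s. f s + g s)"
  by (rule strongly_measurable_compose2[where \<phi>="(+)"])
     (auto intro!: continuous_intros simp: case_prod_unfold)

lemma strongly_measurable_diff:
  "strongly_measurable_on I f \<Longrightarrow> strongly_measurable_on I g \<Longrightarrow>
    strongly_measurable_on I (\<lambda>s. f s - g s)"
  by (rule strongly_measurable_compose2[where \<phi>="(-)"])
     (auto intro!: continuous_intros simp: case_prod_unfold)

lemma strongly_measurable_scaleR:
  "strongly_measurable_on I f \<Longrightarrow> strongly_measurable_on I g \<Longrightarrow>
    strongly_measurable_on I (\<lambda>s. f s *\<^sub>R g s)"
  by (rule strongly_measurable_compose2[where \<phi>="(*\<^sub>R)"])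
     (auto intro!: continuous_intros simp: case_prod_unfold)

lemma strongly_measurable_inner:
  fixes f g :: "real \<Rightarrow> 'a::real_inner"
  shows "strongly_measurable_on I f \<Longrightarrow> strongly_measurable_on I g \<Longrightarrow>
    strongly_measurable_on I (\<lambda>s. f s \<bullet> g s)"
  by (rule strongly_measurable_compose2[where \<phi>="(\<bullet>)"])
     (auto intro!: continuous_intros simp: case_prod_unfold)

lemma strongly_measurable_cong_AE:
  assumes f: "strongly_measurable_on I f" and eq: "AE s in lebesgue_on I. f s = g s"
  shows "strongly_measurable_on I g"
proof -
  obtain F where F: "\<And>i::nat. simple_function (lebesgue_on I) (F i)"
      "AE s in lebesgue_on I. (\<lambda>i. F i s) \<longlonglongrightarrow> f s"
    using f by (auto simp: strongly_measurable_on_def)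
  have "AE s in lebesgue_on I. (\<lambda>i. F i s) \<longlonglongrightarrow> g s"
    using F(2) eq by eventually_elim auto
  with F(1) show ?thesis unfolding strongly_measurable_on_def by blast
qed

lemma AE_lebesgue_on_subset:
  assumes "J \<subseteq> I" "I \<in> sets lebesgue" "J \<in> sets lebesgue" "AE s in lebesgue_on I. P s"
  shows "AE s in lebesgue_on J. P s"
  using assms by (auto simp: AE_restrict_space_iff elim: eventually_mono)

lemma AE_lebesgue_on_notin_finite:
  assumes "finite F" "I \<in> sets lebesgue"
  shows "AE s in lebesgue_on I. s \<notin> (F :: real set)"
proof -
  have "F \<in> null_sets lebesgue"
    using assms(1) by (intro null_sets_completionI finite_imp_null_set_lborel)
  then have "AE s in lebesgue. s \<notin> F" by (rule AE_not_in)
  then show ?thesis using assms(2) by (auto simp: AE_restrict_space_iff elim: eventually_mono)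
qed

lemma integrable_lebesgue_on_subset:
  fixes f :: "real \<Rightarrow> 'b::euclidean_space"
  assumes "integrable (lebesgue_on I) f" "J \<subseteq> I" "I \<in> sets lebesgue" "J \<in> sets lebesgue"
  shows "integrable (lebesgue_on J) f"
  using assms set_integrable_subset[of lebesgue I f J]
  by (simp add: set_integrable_def integrable_restrict_space)

lemma strongly_measurable_subset:
  assumes f: "strongly_measurable_on I f" and J: "J \<subseteq> I" "I \<in> sets lebesgue" "J \<in> sets lebesgue"
  shows "strongly_measurable_on J f"
proof -
  obtain F where F: "\<And>i::nat. simple_function (lebesgue_on I) (F i)"
      "AE s in lebesgue_on I. (\<lambda>i. F i s) \<longlonglongrightarrow> f s"
    using f by (auto simp: strongly_measurable_on_def)
  have "(\<lambda>s. s) \<in> measurable (lebesgue_on J) (lebesgue_on I)"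
    using J by (intro measurable_restrict_space2 measurable_restrict_space1) auto
  then have "simple_function (lebesgue_on J) (F i)" for i
    using simple_function_comp[OF _ F(1)[of i]] by fast
  moreover have "AE s in lebesgue_on J. (\<lambda>i. F i s) \<longlonglongrightarrow> f s"
    using AE_lebesgue_on_subset[OF J F(2)] .
  ultimately show ?thesis unfolding strongly_measurable_on_def by blast
qed

section \<open>Bochner integrability and the Bochner integral\<close>

lemma bochner_integrable_onI:
  assumes "I \<in> sets lebesgue" "strongly_measurable_on I f" "integrable (lebesgue_on I) g"
    and "AE s in lebesgue_on I. norm (f s) \<le> g s"
  shows "f bochner_integrable_on I"
proof -
  have "(\<integral>\<^sup>+s. ennreal (norm (f s)) \<partial>lebesgue_on I) \<le> (\<integral>\<^sup>+s. ennreal (norm (g s)) \<partial>lebesgue_on I)"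
    using assms(4) by (intro nn_integral_mono_AE) (auto elim!: eventually_mono)
  also have "\<dots> < \<infinity>" using assms(3) by (simp add: integrable_iff_bounded)
  finally show ?thesis using assms(2) by (simp add: bochner_integrable_on_def)
qed

lemma bochner_integrable_norm:
  assumes "I \<in> sets lebesgue" "f bochner_integrable_on I"
  shows "integrable (lebesgue_on I) (\<lambda>s. norm (f s))"
  using assms strongly_measurable_norm strongly_measurable_real_iff[OF assms(1)]
  unfolding bochner_integrable_on_def integrable_iff_bounded by auto

text \<open>Strong measurability gives simple functions converging only pointwise. Truncation
  relative to the norm of \<open>f\<close> dominates them by an integrable function, so that
  dominated convergence for real functions yields convergence in the mean.\<close>

lemma bochner_approximation:
  fixes f :: "real \<Rightarrow> 'a::real_normed_vector"
  assumes I: "I \<in> sets lebesgue" and f: "f bochner_integrable_on I"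
  obtains g where "\<And>i::nat. Bochner_Integration.simple_bochner_integrable (lebesgue_on I) (g i)"
    "(\<lambda>i. \<integral>\<^sup>+s. ennreal (norm (f s - g i s)) \<partial>lebesgue_on I) \<longlonglongrightarrow> 0"
proof -
  let ?M = "lebesgue_on I"
  have sm: "strongly_measurable_on I f" and fin: "(\<integral>\<^sup>+s. ennreal (norm (f s)) \<partial>?M) < \<infinity>"
    using f by (auto simp: bochner_integrable_on_def)
  have nf[measurable]: "(\<lambda>s. norm (f s)) \<in> borel_measurable ?M"
    using strongly_measurable_norm[OF sm] strongly_measurable_real_iff[OF I] by blast
  obtain F where F: "\<And>i::nat. simple_function ?M (F i)"
      "AE s in ?M. (\<lambda>i. F i s) \<longlonglongrightarrow> f s"
    using sm by (auto simp: strongly_measurable_on_def)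
  \<comment> \<open>The factor 2 leaves room: where \<open>f s\<close> is nonzero,
    \<open>F i s\<close> eventually passes the test and nothing is cut; where
    \<open>f s = 0\<close>, only the value 0 survives.\<close>
  define g where "g i s = (if norm (F i s) \<le> 2 * norm (f s) then F i s else 0)" for i s
  have nF[measurable]: "(\<lambda>s. norm (F i s)) \<in> borel_measurable ?M" for i
    using simple_function_compose1[OF F(1)[of i], of norm] by (rule borel_measurable_simple_function)
  have gs: "simple_function ?M (g i)" for i
    unfolding g_def by (intro simple_function_If F simple_function_const) measurable
  have gb: "norm (g i s) \<le> 2 * norm (f s)" for i s by (simp add: g_def)
  have gint: "Bochner_Integration.simple_bochner_integrable ?M (g i)" for i
  proof (rule simple_bochner_integrableI_bounded[OF gs])
    have "(\<integral>\<^sup>+s. ennreal (norm (g i s)) \<partial>?M) \<le> (\<integral>\<^sup>+s. 2 * ennreal (norm (f s)) \<partial>?M)"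
      by (rule nn_integral_mono) (use gb in \<open>auto simp: ennreal_mult[symmetric] simp flip: ennreal_numeral\<close>)
    also have "\<dots> < \<infinity>" using fin by (simp add: nn_integral_cmult ennreal_mult_less_top)
    finally show "(\<integral>\<^sup>+s. ennreal (norm (g i s)) \<partial>?M) < \<infinity>" .
  qed
  have lim: "AE s in ?M. (\<lambda>i. norm (f s - g i s)) \<longlonglongrightarrow> 0"
    using F(2)
  proof eventually_elim
    case (elim s)
    have "(\<lambda>i. g i s) \<longlonglongrightarrow> f s"
    proof (cases "f s = 0")
      case True
      then have "g i s = 0" for i by (simp add: g_def)
      then show ?thesis using True by simp
    next
      case False
      have "(\<lambda>i. norm (F i s)) \<longlonglongrightarrow> norm (f s)" by (intro tendsto_intros elim)
      moreover have "norm (f s) < 2 * norm (f s)" using False by simp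
      ultimately have "\<forall>\<^sub>F i in sequentially. norm (F i s) < 2 * norm (f s)"
        by (rule order_tendstoD)
      then have "\<forall>\<^sub>F i in sequentially. F i s = g i s"
        by eventually_elim (simp add: g_def)
      then show ?thesis using elim by (rule Lim_transform_eventually[rotated])
    qed
    then have "(\<lambda>i. norm (f s - g i s)) \<longlonglongrightarrow> norm (f s - f s)" by (intro tendsto_intros)
    then show ?case by simp
  qed
  have smd: "strongly_measurable_on I (\<lambda>s. f s - g i s)" for i
  proof -
    have "strongly_measurable_on I (g i)"
      unfolding strongly_measurable_on_def using gs by (intro exI[of _ "\<lambda>_. g i"]) auto
    then show ?thesis by (rule strongly_measurable_diff[OF sm])
  qed
  \<comment> \<open>The difference from 0 matches the form of the dominated convergence rule, whose
    limit function here is 0.\<close>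
  have "(\<lambda>i. \<integral>\<^sup>+s. ennreal (norm (0 - norm (f s - g i s))) \<partial>?M) \<longlonglongrightarrow> 0"
  proof (rule nn_integral_dominated_convergence_norm[where w="\<lambda>s. 3 * norm (f s)"])
    show "(\<lambda>s. norm (f s - g i s)) \<in> borel_measurable ?M" for i
      using strongly_measurable_norm[OF smd] strongly_measurable_real_iff[OF I] by blast
    show "AE s in ?M. norm (norm (f s - g i s)) \<le> 3 * norm (f s)" for i
    proof (rule AE_I2)
      fix s show "norm (norm (f s - g i s)) \<le> 3 * norm (f s)"
        using gb[of i s] norm_triangle_ineq4[of "f s" "g i s"] by simp
    qed
    show "(\<integral>\<^sup>+s. ennreal (3 * norm (f s)) \<partial>?M) < \<infinity>"
      using fin by (simp add: ennreal_mult nn_integral_cmult ennreal_mult_less_top)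
  qed (use lim in auto)
  then show ?thesis using that[OF gint] by simp
qed

text \<open>The Bochner integral is characterised by its inner products, from which linearity, the norm
  bound and commutation with adjoints follow without further approximation arguments.\<close>

lemma bochner_integral_inner:
  fixes f :: "real \<Rightarrow> 'h::{real_inner, banach}"
  assumes I: "I \<in> sets lebesgue" and f: "f bochner_integrable_on I"
  shows "integrable (lebesgue_on I) (\<lambda>s. f s \<bullet> \<phi>)"
    and "bochner_integral I f \<bullet> \<phi> = (\<integral>s. f s \<bullet> \<phi> \<partial>lebesgue_on I)"
proof -
  let ?M = "lebesgue_on I"
  have sm: "strongly_measurable_on I f" using f by (simp add: bochner_integrable_on_def)
  have fm[measurable]: "(\<lambda>s. f s \<bullet> \<phi>) \<in> borel_measurable ?M" for \<phi>
    using strongly_measurable_inner[OF sm strongly_measurable_const] strongly_measurable_real_iff[OF I]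
    by blast
  show int: "integrable ?M (\<lambda>s. f s \<bullet> \<phi>)" for \<phi>
  proof (rule Bochner_Integration.integrable_bound)
    show "integrable ?M (\<lambda>s. norm (f s) * norm \<phi>)"
      using bochner_integrable_norm[OF I f] by simp
    show "AE s in ?M. norm (f s \<bullet> \<phi>) \<le> norm (norm (f s) * norm \<phi>)"
      by (auto simp: Cauchy_Schwarz_ineq2)
  qed measurable
  have nfm: "(\<lambda>s. norm (f s - g s)) \<in> borel_measurable ?M"
    if "Bochner_Integration.simple_bochner_integrable ?M g" for g
  proof -
    have "simple_function ?M g" using that by (auto elim: simple_bochner_integrable.cases)
    then have "strongly_measurable_on I g"
      unfolding strongly_measurable_on_def by (intro exI[of _ "\<lambda>_. g"]) auto
    then have "strongly_measurable_on I (\<lambda>s. f s - g s)" by (rule strongly_measurable_diff[OF sm])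
    then show ?thesis using strongly_measurable_norm strongly_measurable_real_iff[OF I] by blast
  qed
  define good where "good g y \<longleftrightarrow>
    (\<forall>i::nat. Bochner_Integration.simple_bochner_integrable ?M (g i)) \<and>
    (\<lambda>i. \<integral>\<^sup>+s. ennreal (norm (f s - g i s)) \<partial>?M) \<longlonglongrightarrow> 0 \<and>
    (\<lambda>i. Bochner_Integration.simple_bochner_integral ?M (g i)) \<longlonglongrightarrow> y" for g and y :: 'h
  let ?sI = "Bochner_Integration.simple_bochner_integral ?M"
  \<comment> \<open>Serves twice: it yields the formula for the integral, and it shows that any two
    admissible limits \<open>y\<close> agree, since their inner products depend on \<open>f\<close>
    alone.\<close>
  have good_inner: "y \<bullet> \<phi> = (\<integral>s. f s \<bullet> \<phi> \<partial>?M)" if g: "good g y" for g y \<phi>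
  proof (rule LIMSEQ_unique)
    have gi: "Bochner_Integration.simple_bochner_integrable ?M (g i)" for i
      using g by (simp add: good_def)
    show "(\<lambda>i. ?sI (g i) \<bullet> \<phi>) \<longlonglongrightarrow> y \<bullet> \<phi>"
      using g by (intro tendsto_intros) (simp add: good_def)
    have lin: "linear (\<lambda>x::'h. x \<bullet> \<phi>)"
      by (rule linearI) (simp_all add: inner_add_left)
    have sgi: "Bochner_Integration.simple_bochner_integrable ?M (\<lambda>s. g i s \<bullet> \<phi>)" for i
      using simple_bochner_integrable_compose2[of "\<lambda>x y. x \<bullet> \<phi>", OF _ gi gi] by simp
    have hb: "has_bochner_integral ?M (\<lambda>s. g i s \<bullet> \<phi>) (?sI (g i) \<bullet> \<phi>)" for i
      using has_bochner_integral_simple_bochner_integrable[OF sgi[of i]]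
        simple_bochner_integral_linear[OF lin gi[of i]] by simp
    then have gint: "integrable ?M (\<lambda>s. g i s \<bullet> \<phi>)" and geq: "(\<integral>s. g i s \<bullet> \<phi> \<partial>?M) = ?sI (g i) \<bullet> \<phi>" for i
      by (auto simp: has_bochner_integral_iff)
    have "(\<lambda>i. \<integral>s. g i s \<bullet> \<phi> \<partial>?M) \<longlonglongrightarrow> (\<integral>s. f s \<bullet> \<phi> \<partial>?M)"
    proof (rule tendsto_L1_int)
      show "((\<lambda>i. \<integral>\<^sup>+s. ennreal (norm (g i s \<bullet> \<phi> - f s \<bullet> \<phi>)) \<partial>?M) \<longlongrightarrow> 0) sequentially"
      proof (rule tendsto_sandwich[OF _ _ tendsto_const])
        show "\<forall>\<^sub>F i in sequentially. (\<integral>\<^sup>+s. ennreal (norm (g i s \<bullet> \<phi> - f s \<bullet> \<phi>)) \<partial>?M)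
            \<le> (\<integral>\<^sup>+s. ennreal (norm (f s - g i s)) \<partial>?M) * ennreal (norm \<phi>)"
        proof (intro always_eventually allI)
          fix i
          have "norm (g i s \<bullet> \<phi> - f s \<bullet> \<phi>) \<le> norm (f s - g i s) * norm \<phi>" for s
            by (metis inner_diff_left norm_minus_commute real_norm_def Cauchy_Schwarz_ineq2)
          then have "(\<integral>\<^sup>+s. ennreal (norm (g i s \<bullet> \<phi> - f s \<bullet> \<phi>)) \<partial>?M)
              \<le> (\<integral>\<^sup>+s. ennreal (norm (f s - g i s)) * ennreal (norm \<phi>) \<partial>?M)"
            by (intro nn_integral_mono) (simp add: ennreal_mult[symmetric])
          then show "(\<integral>\<^sup>+s. ennreal (norm (g i s \<bullet> \<phi> - f s \<bullet> \<phi>)) \<partial>?M)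
            \<le> (\<integral>\<^sup>+s. ennreal (norm (f s - g i s)) \<partial>?M) * ennreal (norm \<phi>)"
            using nfm[OF gi] by (simp add: nn_integral_multc)
        qed
        have "(\<lambda>i. (\<integral>\<^sup>+s. ennreal (norm (f s - g i s)) \<partial>?M) * ennreal (norm \<phi>)) \<longlonglongrightarrow> 0 * ennreal (norm \<phi>)"
          using g by (intro tendsto_mult_ennreal tendsto_const) (auto simp: good_def)
        then show "(\<lambda>i. (\<integral>\<^sup>+s. ennreal (norm (f s - g i s)) \<partial>?M) * ennreal (norm \<phi>)) \<longlonglongrightarrow> 0"
          by simp
      qed auto
    qed (use gint int in auto)
    then show "(\<lambda>i. ?sI (g i) \<bullet> \<phi>) \<longlonglongrightarrow> (\<integral>s. f s \<bullet> \<phi> \<partial>?M)" by (simp add: geq)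
  qed
  have ex: "\<exists>y g. good g y"
  proof -
    obtain g where g: "\<And>i::nat. Bochner_Integration.simple_bochner_integrable ?M (g i)"
      "(\<lambda>i. \<integral>\<^sup>+s. ennreal (norm (f s - g i s)) \<partial>?M) \<longlonglongrightarrow> 0"
      using bochner_approximation[OF I f] by blast
    let ?e = "\<lambda>i. \<integral>\<^sup>+s. ennreal (norm (f s - g i s)) \<partial>?M"
    \<comment> \<open>Simple integrals differ by at most the mean distance of the integrands, so
      convergence in the mean makes them Cauchy; completeness of the space then supplies the
      value.\<close>
    have diff: "ennreal (norm (?sI (g i) - ?sI (g j))) \<le> ?e i + ?e j" for i j
    proof -
      let ?d = "\<lambda>s. g i s - g j s"
      have sd: "Bochner_Integration.simple_bochner_integrable ?M (\<lambda>s. norm (?d s))"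
        using simple_bochner_integrable_compose2[of "\<lambda>x y. norm (x - y)", OF _ g(1) g(1)]
        by simp
      have sd': "Bochner_Integration.simple_bochner_integrable ?M ?d"
        using simple_bochner_integrable_compose2[of "(-)", OF _ g(1) g(1)] by simp
      have "norm (?sI (g i) - ?sI (g j)) = norm (?sI ?d)"
        by (simp add: simple_bochner_integral_diff[OF g(1) g(1)])
      also have "\<dots> \<le> ?sI (\<lambda>s. norm (?d s))"
        by (rule simple_bochner_integral_norm_bound[OF sd'])
      finally have "ennreal (norm (?sI (g i) - ?sI (g j))) \<le> ennreal (?sI (\<lambda>s. norm (?d s)))"
        by (rule ennreal_leI)
      also have "\<dots> = (\<integral>\<^sup>+s. ennreal (norm (?d s)) \<partial>?M)"
        by (rule simple_bochner_integral_eq_nn_integral[OF sd]) simp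
      also have "\<dots> \<le> (\<integral>\<^sup>+s. ennreal (norm (f s - g i s)) + ennreal (norm (f s - g j s)) \<partial>?M)"
      proof (rule nn_integral_mono)
        fix s
        have "norm (?d s) \<le> norm (f s - g i s) + norm (f s - g j s)"
          using norm_triangle_ineq4[of "f s - g j s" "f s - g i s"] by simp
        then show "ennreal (norm (?d s)) \<le> ennreal (norm (f s - g i s)) + ennreal (norm (f s - g j s))"
          by (metis ennreal_leI ennreal_plus norm_ge_zero)
      qed
      also have "\<dots> = ?e i + ?e j"
        using nfm[OF g(1)] by (intro nn_integral_add) auto
      finally show ?thesis .
    qed
    have "Cauchy (\<lambda>i. ?sI (g i))"
    proof (rule metric_CauchyI)
      fix r :: real assume r: "r > 0"
      have "\<forall>\<^sub>F i in sequentially. ?e i < ennreal (r / 2)"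
        using g(2) r by (intro order_tendstoD(2)) auto
      then obtain N where N: "\<And>i. i \<ge> N \<Longrightarrow> ?e i < ennreal (r / 2)"
        by (auto simp: eventually_sequentially)
      have "dist (?sI (g i)) (?sI (g j)) < r" if "i \<ge> N" "j \<ge> N" for i j
      proof -
        have "ennreal (norm (?sI (g i) - ?sI (g j))) \<le> ?e i + ?e j" by (rule diff)
        also have "\<dots> < ennreal (r / 2) + ennreal (r / 2)"
          using N that by (intro add_strict_mono) auto
        also have "\<dots> = ennreal r" using r by (simp add: ennreal_plus[symmetric] del: ennreal_plus)
        finally show ?thesis using r by (simp add: dist_norm ennreal_less_iff)
      qed
      then show "\<exists>M. \<forall>m\<ge>M. \<forall>n\<ge>M. dist (?sI (g m)) (?sI (g n)) < r" by blast
    qed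
    then obtain y where "(\<lambda>i. ?sI (g i)) \<longlonglongrightarrow> y" using Cauchy_convergent convergent_def by blast
    then show ?thesis using g unfolding good_def by blast
  qed
  then obtain y g where y: "good g y" by blast
  have "bochner_integral I f = (THE y. \<exists>g. good g y)"
    using f by (simp add: bochner_integral_def good_def)
  also have "\<dots> = y"
  proof (rule the_equality)
    show "\<exists>g. good g y" using y by blast
    fix z assume "\<exists>g. good g z"
    then have "z \<bullet> \<phi> = y \<bullet> \<phi>" for \<phi> using good_inner y by fastforce
    then show "z = y" by (metis vector_eq_rdot)
  qed
  finally show "bochner_integral I f \<bullet> \<phi> = (\<integral>s. f s \<bullet> \<phi> \<partial>?M)" using good_inner[OF y] by simp
qed

lemma bochner_integral_eqI:
  fixes f :: "real \<Rightarrow> 'h::{real_inner, banach}"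
  assumes "I \<in> sets lebesgue" "f bochner_integrable_on I"
    and "\<And>\<phi>. (\<integral>s. f s \<bullet> \<phi> \<partial>lebesgue_on I) = y \<bullet> \<phi>"
  shows "bochner_integral I f = y"
  using bochner_integral_inner(2)[OF assms(1,2)] assms(3) by (metis vector_eq_rdot)

lemma norm_bochner_integral_le:
  fixes f :: "real \<Rightarrow> 'h::{real_inner, banach}"
  assumes I: "I \<in> sets lebesgue" and f: "f bochner_integrable_on I"
  shows "norm (bochner_integral I f) \<le> (\<integral>s. norm (f s) \<partial>lebesgue_on I)"
proof (cases "bochner_integral I f = 0")
  case False
  let ?y = "bochner_integral I f"
  have "norm ?y * norm ?y = (\<integral>s. f s \<bullet> ?y \<partial>lebesgue_on I)"
    using bochner_integral_inner(2)[OF I f, of ?y] by (simp add: power2_norm_eq_inner[symmetric] power2_eq_square)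
  also have "\<dots> \<le> (\<integral>s. norm (f s) * norm ?y \<partial>lebesgue_on I)"
    using bochner_integral_inner(1)[OF I f] bochner_integrable_norm[OF I f]
    by (intro integral_mono) (auto simp: norm_cauchy_schwarz)
  also have "\<dots> = (\<integral>s. norm (f s) \<partial>lebesgue_on I) * norm ?y" by simp
  finally show ?thesis using False by simp
qed (simp add: integral_nonneg_AE)

lemma bochner_integrable_cong_AE:
  assumes "f bochner_integrable_on I" "AE s in lebesgue_on I. f s = g s"
  shows "g bochner_integrable_on I"
proof -
  have "(\<integral>\<^sup>+s. ennreal (norm (g s)) \<partial>lebesgue_on I) = (\<integral>\<^sup>+s. ennreal (norm (f s)) \<partial>lebesgue_on I)"
    using assms(2) by (intro nn_integral_cong_AE) (auto elim: eventually_mono)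
  then show ?thesis
    using assms strongly_measurable_cong_AE unfolding bochner_integrable_on_def by metis
qed

lemma bochner_integral_cong_AE:
  fixes f g :: "real \<Rightarrow> 'h::{real_inner, banach}"
  assumes I: "I \<in> sets lebesgue" and f: "f bochner_integrable_on I"
    and eq: "AE s in lebesgue_on I. f s = g s"
  shows "bochner_integral I g = bochner_integral I f"
proof (rule bochner_integral_eqI[OF I])
  show g: "g bochner_integrable_on I" using bochner_integrable_cong_AE[OF f eq] .
  fix \<phi>
  have "(\<integral>s. g s \<bullet> \<phi> \<partial>lebesgue_on I) = (\<integral>s. f s \<bullet> \<phi> \<partial>lebesgue_on I)"
    using eq bochner_integral_inner(1)[OF I f] bochner_integral_inner(1)[OF I g]
    by (intro integral_cong_AE) (auto elim: eventually_mono)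
  then show "(\<integral>s. g s \<bullet> \<phi> \<partial>lebesgue_on I) = bochner_integral I f \<bullet> \<phi>"
    by (simp add: bochner_integral_inner(2)[OF I f])
qed

section \<open>The Wright function\<close>

lemma linear_minus_powr_bound:
  fixes c k p :: real
  assumes k: "k > 0" and p: "p > 1"
  obtains C where "\<And>x. x \<ge> 0 \<Longrightarrow> c * x - k * x powr p \<le> C - x"
proof -
  \<comment> \<open>The \<open>+ 1\<close> pays for the \<open>- x\<close> in the conclusion. The
    point \<open>x0\<close> is where \<open>d * x\<close> and \<open>k * x powr p\<close> balance:
    before it the linear term is at most \<open>d * x0\<close>, after it the power wins.\<close>
  define d where "d = max (c + 1) 0"
  define x0 where "x0 = (d / k) powr (1 / (p - 1))"
  have "c * x - k * x powr p \<le> d * x0 - x" if x: "x \<ge> 0" for x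
  proof (cases "x \<le> x0")
    case True
    have "(c + 1) * x \<le> d * x0"
      using x True by (intro mult_mono) (auto simp: d_def)
    moreover have "0 \<le> k * x powr p" using k by simp
    ultimately show ?thesis by (simp add: algebra_simps)
  next
    case False
    moreover have "x0 \<ge> 0" by (simp add: x0_def)
    ultimately have xp: "x > 0" by linarith
    have "d / k = x0 powr (p - 1)"
      using k p by (simp add: x0_def powr_powr d_def)
    also have "\<dots> \<le> x powr (p - 1)" using False p x0_def by (intro powr_mono2) auto
    finally have "d * x \<le> k * x powr (p - 1) * x"
      using k xp by (intro mult_right_mono) (auto simp: field_simps)
    also have "\<dots> = k * x powr p" using xp by (simp add: powr_diff)
    finally have "d * x \<le> k * x powr p" .
    moreover have "(c + 1) * x \<le> d * x" using xp by (intro mult_right_mono) (auto simp: d_def)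
    moreover have "0 \<le> d * x0" by (simp add: d_def x0_def)
    ultimately show ?thesis by (simp add: algebra_simps)
  qed
  then show ?thesis using that by blast
qed

lemma integrable_exp_minus: "integrable (lebesgue_on {0..}) (\<lambda>x::real. exp (- x))"
proof -
  have "(\<lambda>x::real. exp (- x)) integrable_on {0..}"
    using integrable_on_exp_minus_to_infinity[of 1 0] by simp
  then have "(\<lambda>x::real. exp (- x)) absolutely_integrable_on {0..}"
    by (rule nonnegative_absolutely_integrable_1) simp
  then show ?thesis by (rule absolutely_integrable_imp_integrable) auto
qed

lemma integrable_exp_minus_powr:
  fixes c p :: real
  assumes p: "p > 1"
  shows "integrable (lebesgue_on {0..}) (\<lambda>x. exp (c * x - x powr p))"
proof -
  obtain C where C: "\<And>x. x \<ge> 0 \<Longrightarrow> c * x - 1 * x powr p \<le> C - x"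
    using linear_minus_powr_bound[of 1 p c] p by auto
  show ?thesis
  proof (rule measurable_bounded_by_integrable_imp_lebesgue_integrable)
    show "(\<lambda>x. exp (c * x - x powr p)) \<in> borel_measurable (lebesgue_on {0..})"
      using p by (intro continuous_imp_measurable_on_sets_lebesgue continuous_intros continuous_on_powr') auto
    show "integrable (lebesgue_on {0..}) (\<lambda>x. exp C * exp (- x))"
      using integrable_exp_minus by simp
    show "norm (exp (c * x - x powr p)) \<le> exp C * exp (- x)" if "x \<in> {0..}" for x
      using C[of x] that by (simp add: exp_add[symmetric])
  qed auto
qed

text \<open>Euler's integral under the substitution \<open>t = x powr (1 / a)\<close>. The
  substitution is carried out on the open half line, where it is differentiable and injective; the
  end point is negligible. These moments turn the Wright series into an integral.\<close>

lemma Gamma_power_integral: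
  fixes a :: real
  assumes a: "0 < a" "a < 1"
  shows "((\<lambda>x. x ^ m * exp (- (x powr (1 / a)))) has_integral a * Gamma (a * (real m + 1))) {0..}"
proof -
  define p where "p = 1 / a"
  define y where "y = a * (real m + 1)"
  have y: "y > 0" using a by (simp add: y_def)
  have p: "p > 1" using a by (simp add: p_def)
  let ?f = "\<lambda>t. t powr (y - 1) / exp t"
  have "(?f has_integral Gamma y) {0<..}"
    using Gamma_integral_real[OF y]
    by (subst (asm) has_integral_spike_set_eq[where T="{0<..}"])
       (auto intro!: negligible_subset[OF negligible_sing[of 0]])
  moreover have "(\<lambda>x. x powr p) ` {0<..} = {0<..}"
  proof (intro equalityI subsetI)
    fix x :: real assume "x \<in> {0<..}"
    then have "x = (x powr a) powr p" "x powr a \<in> {0<..}" using a by (auto simp: p_def powr_powr)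
    then show "x \<in> (\<lambda>x. x powr p) ` {0<..}" by blast
  qed auto
  moreover have "?f absolutely_integrable_on {0<..}"
    using calculation(1) by (intro nonnegative_absolutely_integrable_1) (auto simp: integrable_on_def)
  ultimately have f: "?f absolutely_integrable_on (\<lambda>x. x powr p) ` {0<..} \<and>
      integral ((\<lambda>x. x powr p) ` {0<..}) ?f = Gamma y"
    by (simp add: integral_unique)
  have "(\<lambda>x. \<bar>p * x powr (p - 1)\<bar> * ?f (x powr p)) absolutely_integrable_on {0<..} \<and>
      integral {0<..} (\<lambda>x. \<bar>p * x powr (p - 1)\<bar> * ?f (x powr p)) = Gamma y"
  proof -
    have inj: "inj_on (\<lambda>x. x powr p) {0<..}"
      using a by (intro inj_on_inverseI[where g="\<lambda>x. x powr a"]) (auto simp: p_def powr_powr)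
    have der: "((\<lambda>x. x powr p) has_real_derivative p * x powr (p - 1)) (at x within {0<..})"
      if "x \<in> {0<..}" for x
      using that by (auto intro!: derivative_eq_intros)
    have "{0::real<..} \<in> sets lebesgue" by simp
    then show ?thesis
      by (rule has_absolute_integral_change_of_variables_1'[OF _ der inj, THEN iffD2, OF _ _ f])
  qed
  then have "((\<lambda>x. \<bar>p * x powr (p - 1)\<bar> * ?f (x powr p)) has_integral Gamma y) {0<..}"
    using has_integral_iff set_lebesgue_integral_eq_integral(1) by blast
  then have "((\<lambda>x. a * (\<bar>p * x powr (p - 1)\<bar> * ?f (x powr p))) has_integral a * Gamma y) {0<..}"
    by (rule has_integral_mult_right)
  moreover have "a * (\<bar>p * x powr (p - 1)\<bar> * ?f (x powr p)) = x ^ m * exp (- (x powr p))"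
    if "x \<in> {0<..}" for x
  proof -
    have x: "x > 0" using that by simp
    have "(p - 1) + p * (y - 1) = real m" using a by (simp add: p_def y_def field_simps)
    then have "x powr (p - 1) * (x powr p) powr (y - 1) = x ^ m"
      using x by (simp add: powr_powr powr_add[symmetric] powr_realpow)
    then show ?thesis using x p a by (simp add: abs_mult exp_minus field_simps p_def)
  qed
  ultimately have "((\<lambda>x. x ^ m * exp (- (x powr p))) has_integral a * Gamma y) {0<..}"
    by (rule has_integral_eq[rotated])
  then show ?thesis
    unfolding p_def y_def
    by (subst has_integral_spike_set_eq[where T="{0<..}"])
       (auto intro!: negligible_subset[OF negligible_sing[of 0]])
qed

text \<open>The form with \<open>rGamma\<close> covers positive integers \<open>x\<close> too, where
  both sides vanish. It converts the Wright coefficients, whose arguments run to minus infinity,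
  into Gamma values at positive arguments times a sine.\<close>

lemma rGamma_reflection_real:
  fixes x :: real
  assumes "x > 0"
  shows "rGamma (1 - x) = Gamma x * sin (pi * x) / pi"
proof -
  have "complex_of_real (rGamma x * rGamma (1 - x)) = complex_of_real (sin (pi * x) / pi)"
    using rGamma_reflection_complex[of "complex_of_real x"]
    by (simp add: rGamma_complex_of_real[symmetric] sin_of_real[symmetric])
  then have *: "rGamma x * rGamma (1 - x) = sin (pi * x) / pi" by (simp only: of_real_eq_iff)
  have "Gamma x * rGamma x = 1"
    using Gamma_real_pos[OF assms] by (simp add: Gamma_def)
  then have "rGamma (1 - x) = Gamma x * (rGamma x * rGamma (1 - x))" by (simp add: mult.assoc[symmetric])
  then show ?thesis using * by simp
qed

section \<open>The Wright series and its integral representation\<close>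

context
  fixes a :: real
  assumes a: "0 < a" "a < 1"
begin

lemma Gamma_power_integrable:
  "integrable (lebesgue_on {0..}) (\<lambda>x. x ^ m * exp (- (x powr (1 / a))))"
  "(\<integral>x. x ^ m * exp (- (x powr (1 / a))) \<partial>lebesgue_on {0..}) = a * Gamma (a * (real m + 1))"
proof -
  have "(\<lambda>x. x ^ m * exp (- (x powr (1 / a)))) absolutely_integrable_on {0..}"
    using Gamma_power_integral[OF a, of m]
    by (intro nonnegative_absolutely_integrable_1) (auto simp: integrable_on_def)
  then show *: "integrable (lebesgue_on {0..}) (\<lambda>x. x ^ m * exp (- (x powr (1 / a))))"
    by (rule absolutely_integrable_imp_integrable) auto
  show "(\<integral>x. x ^ m * exp (- (x powr (1 / a))) \<partial>lebesgue_on {0..}) = a * Gamma (a * (real m + 1))"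
    using lebesgue_integral_eq_integral[OF *] Gamma_power_integral[OF a, of m]
    by (simp add: integral_unique)
qed

text \<open>Each term is the integral of one term of the series of \<open>exp (y * x)\<close>
  against \<open>exp (- (x powr (1 / a)))\<close>, so all partial sums stay below one integral,
  finite because \<open>1 / a > 1\<close>. The series dominates the Wright series and also licenses
  the termwise integration in \<open>wright_integral\<close>.\<close>

lemma summable_Gamma_series:
  fixes y :: real
  assumes y: "y \<ge> 0"
  shows "summable (\<lambda>m. y ^ m / fact m * (a * Gamma (a * (real m + 1))))"
proof (rule summableI_nonneg_bounded)
  let ?M = "lebesgue_on {0::real..}"
  let ?t = "\<lambda>m x. (y ^ m / fact m) * (x ^ m * exp (- (x powr (1 / a))))"
  have Gpos: "Gamma (a * (real m + 1)) \<ge> 0" for m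
    using a by (intro less_imp_le Gamma_real_pos) auto
  show "0 \<le> y ^ m / fact m * (a * Gamma (a * (real m + 1)))" for m
    using y a Gpos by simp
  have int: "integrable ?M (?t m)" for m
    using Gamma_power_integrable(1) by simp
  fix n
  have "(\<Sum>m<n. y ^ m / fact m * (a * Gamma (a * (real m + 1)))) = (\<Sum>m<n. (\<integral>x. ?t m x \<partial>?M))"
    by (simp only: integral_mult_right_zero Gamma_power_integrable(2))
  also have "\<dots> = (\<integral>x. (\<Sum>m<n. ?t m x) \<partial>?M)" using int by (simp add: Bochner_Integration.integral_sum)
  also have "\<dots> \<le> (\<integral>x. exp (y * x - x powr (1 / a)) \<partial>?M)"
  proof (rule integral_mono)
    show "integrable ?M (\<lambda>x. \<Sum>m<n. ?t m x)" using int by auto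
    show "integrable ?M (\<lambda>x. exp (y * x - x powr (1 / a)))"
      using a by (intro integrable_exp_minus_powr) simp
    fix x assume "x \<in> space ?M"
    then have x: "x \<ge> 0" by simp
    have "(\<Sum>m<n. (y * x) ^ m / fact m) \<le> exp (y * x)"
    proof -
      have "(\<lambda>m. (y * x) ^ m / fact m) sums exp (y * x)"
        using exp_converges[of "y * x"] by (simp add: divide_inverse mult.commute)
      then show ?thesis using x y
        by (metis (no_types, lifting) sums_unique sums_summable sum_le_suminf finite_lessThan
            divide_nonneg_nonneg fact_ge_zero mult_nonneg_nonneg zero_le_power)
    qed
    then have "(\<Sum>m<n. (y * x) ^ m / fact m) * exp (- (x powr (1 / a)))
        \<le> exp (y * x) * exp (- (x powr (1 / a)))" by (intro mult_right_mono) auto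
    then show "(\<Sum>m<n. ?t m x) \<le> exp (y * x - x powr (1 / a))"
      by (simp add: sum_distrib_right power_mult_distrib exp_add[symmetric] mult.assoc)
  qed
  finally show "(\<Sum>m<n. y ^ m / fact m * (a * Gamma (a * (real m + 1))))
      \<le> (\<integral>x. exp (y * x - x powr (1 / a)) \<partial>?M)" .
qed

lemma wright_coeff:
  "rGamma (- a * real m + 1 - a) = Gamma (a * (real m + 1)) * sin (pi * (a * (real m + 1))) / pi"
proof -
  have "a * (real m + 1) > 0" using a by simp
  from rGamma_reflection_real[OF this] show ?thesis by (simp add: algebra_simps)
qed

lemma summable_wright:
  fixes \<theta> :: real
  shows "summable (\<lambda>m. (- \<theta>) ^ m / fact m * rGamma (- a * real m + 1 - a))"
proof (rule summable_comparison_test')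
  show "summable (\<lambda>m. 1 / (a * pi) * (\<bar>\<theta>\<bar> ^ m / fact m * (a * Gamma (a * (real m + 1)))))"
    by (intro summable_mult summable_Gamma_series) simp
  show "norm ((- \<theta>) ^ m / fact m * rGamma (- a * real m + 1 - a))
      \<le> 1 / (a * pi) * (\<bar>\<theta>\<bar> ^ m / fact m * (a * Gamma (a * (real m + 1))))" if "m \<ge> 0" for m
  proof -
    have G: "Gamma (a * (real m + 1)) > 0" using a by (intro Gamma_real_pos) auto
    have "\<bar>Gamma (a * (real m + 1)) * sin (pi * (a * (real m + 1))) / pi\<bar> \<le> Gamma (a * (real m + 1)) / pi"
      using G abs_sin_le_one[of "pi * (a * (real m + 1))"]
      by (simp add: abs_mult divide_right_mono mult_left_le)
    then have "\<bar>\<theta>\<bar> ^ m / fact m * \<bar>Gamma (a * (real m + 1)) * sin (pi * (a * (real m + 1))) / pi\<bar>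
       \<le> \<bar>\<theta>\<bar> ^ m / fact m * (Gamma (a * (real m + 1)) / pi)"
      by (rule mult_left_mono) auto
    then show ?thesis
      unfolding wright_coeff using a by (simp add: abs_mult power_abs field_simps)
  qed
qed

lemma isCont_wright: "isCont (wright a) \<theta>"
proof -
  have "isCont (\<lambda>x. \<Sum>m. ((-1) ^ m / fact m * rGamma (- a * real m + 1 - a)) * x ^ m) \<theta>"
  proof (rule isCont_powser_converges_everywhere)
    show "summable (\<lambda>m. (-1) ^ m / fact m * rGamma (- a * real m + 1 - a) * y ^ m)" for y :: real
      using summable_wright[of y] by (simp add: power_minus[of y] mult_ac)
  qed
  moreover have "wright a = (\<lambda>x. \<Sum>m. ((-1) ^ m / fact m * rGamma (- a * real m + 1 - a)) * x ^ m)"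
  proof
    fix x
    have "(- x) ^ m / fact m * c = ((-1) ^ m / fact m * c) * x ^ m" for m and c :: real
      by (subst power_minus) simp
    then show "wright a x = (\<Sum>m. ((-1) ^ m / fact m * rGamma (- a * real m + 1 - a)) * x ^ m)"
      by (simp only: wright_def)
  qed
  ultimately show ?thesis by simp
qed

text \<open>\<open>h\<close> is the function
  \<open>exp (\<tau> powr (1 / a) - \<theta> * \<tau>)\<close> times the differential along the ray
  \<open>\<tau> = x * cis (pi * a)\<close>, where \<open>\<tau> powr (1 / a)\<close> becomes
  \<open>- (x powr (1 / a))\<close>. Expanding the second factor in powers of
  \<open>\<theta>\<close> and integrating termwise produces the Wright series.\<close>

lemma wright_integral:
  fixes \<theta> :: real
  defines "h \<equiv> \<lambda>x::real. cis (pi * a) * exp (- of_real (x powr (1 / a)) - of_real (\<theta> * x) * cis (pi * a))"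
  shows "integrable (lebesgue_on {0..}) h"
    and "a * pi * wright a \<theta> = Im (\<integral>x. h x \<partial>lebesgue_on {0..})"
proof -
  let ?M = "lebesgue_on {0::real..}"
  let ?w = "cis (pi * a)"
  define f where "f m x = (?w * (- of_real \<theta> * ?w) ^ m / fact m) * of_real (x ^ m * exp (- (x powr (1 / a))))"
    for m and x :: real
  have fint: "integrable ?M (f m)" for m
    unfolding f_def by (intro integrable_mult_right integrable_of_real Gamma_power_integrable)
  have fn: "norm (f m x) = (\<bar>\<theta>\<bar> ^ m / fact m) * (x ^ m * exp (- (x powr (1 / a))))" if "x \<ge> 0" for m x
    using that by (simp add: f_def norm_mult norm_divide norm_power abs_mult)
  have fnint: "(\<integral>x. norm (f m x) \<partial>?M) = \<bar>\<theta>\<bar> ^ m / fact m * (a * Gamma (a * (real m + 1)))" for m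
  proof -
    have "(\<integral>x. norm (f m x) \<partial>?M) = (\<integral>x. (\<bar>\<theta>\<bar> ^ m / fact m) * (x ^ m * exp (- (x powr (1 / a)))) \<partial>?M)"
      by (rule Bochner_Integration.integral_cong) (auto simp: fn)
    then show ?thesis by (simp only: integral_mult_right_zero Gamma_power_integrable(2))
  qed
  have fsums: "(\<lambda>m. f m x) sums h x" for x
  proof -
    have "(\<lambda>m. (- of_real (\<theta> * x) * ?w) ^ m /\<^sub>R fact m) sums exp (- of_real (\<theta> * x) * ?w)"
      by (rule exp_converges)
    from sums_mult[OF this, of "?w * of_real (exp (- (x powr (1 / a))))"]
    have "(\<lambda>m. ?w * of_real (exp (- (x powr (1 / a)))) * ((- of_real (\<theta> * x) * ?w) ^ m /\<^sub>R fact m))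
      sums (?w * of_real (exp (- (x powr (1 / a)))) * exp (- of_real (\<theta> * x) * ?w))" .
    moreover have "?w * of_real (exp (- (x powr (1 / a)))) * ((- of_real (\<theta> * x) * ?w) ^ m /\<^sub>R fact m) = f m x" for m
    proof -
      have "(- of_real (\<theta> * x) * ?w) ^ m = (- of_real \<theta> * ?w) ^ m * of_real x ^ m"
        by (simp add: power_mult_distrib[symmetric] mult_ac)
      then show ?thesis by (simp add: f_def scaleR_conv_of_real field_simps)
    qed
    moreover have "?w * of_real (exp (- (x powr (1 / a)))) * exp (- of_real (\<theta> * x) * ?w) = h x"
      by (simp add: h_def exp_diff exp_minus exp_of_real field_simps)
    ultimately show ?thesis by simp
  qed
  have summ: "AE x in ?M. summable (\<lambda>m. norm (f m x))"
  proof (rule AE_I2)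
    fix x assume "x \<in> space ?M"
    then have x: "x \<ge> 0" by simp
    have "summable (\<lambda>m. (\<bar>\<theta>\<bar> * x) ^ m / fact m)"
      using summable_exp[of "\<bar>\<theta>\<bar> * x"] by (simp add: divide_inverse mult.commute)
    from summable_mult2[OF this, of "exp (- (x powr (1 / a)))"]
    show "summable (\<lambda>m. norm (f m x))" by (simp add: fn[OF x] power_mult_distrib mult_ac)
  qed
  have summ2: "summable (\<lambda>m. \<integral>x. norm (f m x) \<partial>?M)"
    unfolding fnint by (intro summable_Gamma_series) simp
  have hs: "h x = (\<Sum>m. f m x)" for x using fsums sums_unique by blast
  show "integrable ?M h"
    using integrable_suminf[OF fint summ summ2] by (simp add: hs[abs_def])
  have "(\<lambda>m. \<integral>x. f m x \<partial>?M) sums (\<integral>x. h x \<partial>?M)"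
    using sums_integral[OF fint summ summ2] by (simp add: hs[abs_def])
  then have "(\<lambda>m. Im (\<integral>x. f m x \<partial>?M)) sums Im (\<integral>x. h x \<partial>?M)" by (rule sums_Im)
  moreover have "Im (\<integral>x. f m x \<partial>?M) = a * pi * ((- \<theta>) ^ m / fact m * rGamma (- a * real m + 1 - a))" for m
  proof -
    have "(\<integral>x. f m x \<partial>?M) = (?w * (- of_real \<theta> * ?w) ^ m / fact m) * of_real (a * Gamma (a * (real m + 1)))"
      unfolding f_def integral_mult_right_zero integral_complex_of_real Gamma_power_integrable(2) ..
    \<comment> \<open>The \<open>m\<close> phases of the expansion and the one of the differential
      add up to the angle \<open>pi * (a * (m + 1))\<close>; its sine is the one given by the
      reflection formula.\<close>
    also have "?w * (- of_real \<theta> * ?w) ^ m = of_real ((- \<theta>) ^ m) * cis (pi * (a * (real m + 1)))"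
    proof -
      have "?w * (- of_real \<theta> * ?w) ^ m = of_real ((- \<theta>) ^ m) * (?w ^ Suc m)"
        by (simp only: power_mult_distrib of_real_power of_real_minus power_Suc mult_ac)
      also have "?w ^ Suc m = cis (pi * (a * (real m + 1)))"
        by (simp only: Complex.DeMoivre) (simp add: algebra_simps)
      finally show ?thesis .
    qed
    finally have "(\<integral>x. f m x \<partial>?M) = of_real ((- \<theta>) ^ m / fact m * (a * Gamma (a * (real m + 1)))) * cis (pi * (a * (real m + 1)))"
      by simp
    then have "Im (\<integral>x. f m x \<partial>?M) = (- \<theta>) ^ m / fact m * (a * Gamma (a * (real m + 1))) * sin (pi * (a * (real m + 1)))"
      by (simp only: times_complex.sel Re_complex_of_real Im_complex_of_real cis.sel mult_zero_left add_0_right)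
    then show ?thesis unfolding wright_coeff by simp
  qed
  ultimately have "(\<lambda>m. a * pi * ((- \<theta>) ^ m / fact m * rGamma (- a * real m + 1 - a))) sums Im (\<integral>x. h x \<partial>?M)"
    by simp
  moreover have "(\<lambda>m. a * pi * ((- \<theta>) ^ m / fact m * rGamma (- a * real m + 1 - a))) sums (a * pi * wright a \<theta>)"
    unfolding wright_def by (intro sums_mult summable_sums summable_wright)
  ultimately show "a * pi * wright a \<theta> = Im (\<integral>x. h x \<partial>?M)" using sums_unique2 by blast
qed

end

section \<open>Contour deformation and decay of the Wright function\<close>

lemma cis_powr_real:
  fixes r \<psi> p :: real
  assumes "r \<ge> 0" "0 \<le> \<psi>" "\<psi> \<le> pi"
  shows "(of_real r * cis \<psi>) powr of_real p = of_real (r powr p) * cis (p * \<psi>)"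
proof (cases "r = 0")
  case False
  have "Ln (of_real r * cis \<psi>) = of_real (ln r) + \<i> * of_real \<psi>"
  proof (rule Ln_unique)
    show "exp (of_real (ln r) + \<i> * of_real \<psi>) = of_real r * cis \<psi>"
      using assms False by (simp add: exp_add exp_of_real cis_conv_exp)
    show "- pi < Im (of_real (ln r) + \<i> * of_real \<psi>)"
      using assms pi_gt_zero by (simp, linarith)
    show "Im (of_real (ln r) + \<i> * of_real \<psi>) \<le> pi" using assms by simp
  qed
  then have "(of_real r * cis \<psi>) powr of_real p = exp (of_real (p * ln r) + \<i> * of_real (p * \<psi>))"
    using False by (simp add: powr_def algebra_simps)
  also have "\<dots> = of_real (r powr p) * cis (p * \<psi>)"
    using False assms by (simp add: exp_add cis_conv_exp powr_def exp_of_real[symmetric])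
  finally show ?thesis .
qed simp

text \<open>Substituting \<open>\<tau> powr (1 / a)\<close> for the variable of the Hankel contour integral removes the
  singularity of the integrand at the origin. The path runs along the real axis, where the integrand is real, up to \<open>c\<close>, and then
  stays in the half plane \<open>Re \<tau> \<ge> c\<close>, which yields the factor \<open>exp (- c * \<theta>)\<close>.\<close>

lemma wright_contour_bound:
  fixes a c :: real
  assumes a: "0 < a" "a < 1" and c: "c > 0"
  shows "\<exists>K. \<forall>\<theta>\<ge>0. \<exists>C. \<forall>L\<ge>K.
    \<bar>Im (integral {0..L} (\<lambda>x. cis (pi * a) *
        exp (- of_real (x powr (1 / a)) - of_real (\<theta> * x) * cis (pi * a))))\<bar>
      \<le> K * exp (- c * \<theta>) + C * L * exp (- L)"
proof -
  define p where "p = 1 / a"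
  have p: "p > 1" using a by (simp add: p_def)
  have pa: "p * a = 1" using a by (simp add: p_def)
  \<comment> \<open>The direction of the escaping ray: above \<open>pi * a / 2\<close> the factor
    \<open>exp (\<tau> powr p)\<close> decays along it, below \<open>pi / 2\<close> the real part of
    \<tau> grows, and below \<open>pi * a\<close> the ray stays inside the sector used for Cauchy's
    theorem.\<close>
  have "pi * a / 2 < min (pi * a) (pi / 2)" using a by auto
  then obtain \<beta> where \<beta>: "pi * a / 2 < \<beta>" "\<beta> < pi * a" "\<beta> < pi / 2"
    using dense by (metis min_less_iff_conj)
  have \<beta>0: "0 < \<beta>" using \<beta>(1) a by (smt (verit) divide_pos_pos mult_pos_pos pi_gt_zero)
  have pia: "pi * a < pi" "0 < pi * a" using a by auto
  \<comment> \<open>The decay constant on the ray at angle \<beta>. It serves the whole arc as well,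
    since \<open>p * \<psi>\<close> stays in \<open>{p * \<beta>..pi}\<close>, where the cosine
    decreases.\<close>
  define \<kappa> where "\<kappa> = - cos (p * \<beta>)"
  have pb: "pi / 2 < p * \<beta>" "p * \<beta> < pi"
  proof -
    have "p * (pi * a / 2) < p * \<beta>" using \<beta>(1) p by simp
    then show "pi / 2 < p * \<beta>" using pa by (simp add: algebra_simps)
    have "p * \<beta> < p * (pi * a)" using \<beta>(2) p by simp
    also have "p * (pi * a) = (p * a) * pi" by (simp only: mult_ac)
    finally show "p * \<beta> < pi" by (simp add: pa)
  qed
  have \<kappa>: "\<kappa> > 0"
    using pb cos_lt_zero_pi[of "p * \<beta>"] by (simp add: \<kappa>_def)
  have cos\<kappa>: "cos (p * \<psi>) \<le> - \<kappa>" if "\<beta> \<le> \<psi>" "\<psi> \<le> pi * a" for \<psi>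
  proof -
    have "p * \<psi> \<le> p * (pi * a)" using that p by simp
    also have "p * (pi * a) = (p * a) * pi" by (simp only: mult_ac)
    finally have "p * \<psi> \<le> pi" by (simp add: pa)
    moreover have "p * \<beta> \<le> p * \<psi>" using that p by simp
    ultimately show ?thesis using pb \<kappa>_def pi_gt_zero
      by (auto intro!: cos_monotone_0_pi_le)
  qed
  have cb: "cos \<beta> > 0" using \<beta> \<beta>0 by (intro cos_gt_zero_pi) auto
  \<comment> \<open>The radius at which the ray at angle \<beta> meets the line
    \<open>Re \<tau> = c\<close>.\<close>
  define q where "q = c / cos \<beta>"
  have q: "q > 0" "q * cos \<beta> = c" using c cb by (auto simp: q_def)
  define \<omega> where "\<omega> = cis (pi * a)"
  define \<nu> where "\<nu> = cis \<beta>"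
  \<comment> \<open>The closed sector of angles from 0 to \<open>pi * a\<close>, written as an
    intersection of two half planes so that convexity is immediate. Its only branch point, the
    origin, is the exceptional point allowed by Cauchy's theorem for convex sets.\<close>
  define X where "X = {z. Im z \<ge> 0 \<and> Im (z * cis (- (pi * a))) \<le> 0}"
  have convX: "convex X"
  proof -
    have "X = {z. Im z \<ge> 0} \<inter> {z. Im (z * cis (- (pi * a))) \<le> 0}" by (auto simp: X_def)
    moreover have "convex {z. Im (z * cis (- (pi * a))) \<le> 0}"
      unfolding convex_def
    proof (intro ballI allI impI)
      fix x y :: complex and u v :: real
      let ?w = "cis (- (pi * a))"
      assume "x \<in> {z. Im (z * ?w) \<le> 0}" "y \<in> {z. Im (z * ?w) \<le> 0}" "0 \<le> u" "0 \<le> v"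
      moreover have "Im ((u *\<^sub>R x + v *\<^sub>R y) * ?w) = u * Im (x * ?w) + v * Im (y * ?w)"
        by (simp only: distrib_right mult_scaleR_left plus_complex.sel scaleR_complex.sel)
      ultimately show "u *\<^sub>R x + v *\<^sub>R y \<in> {z. Im (z * ?w) \<le> 0}"
        by (simp only: mem_Collect_eq) (simp add: add_nonpos_nonpos mult_nonneg_nonpos del: times_complex.sel)
    qed
    ultimately show ?thesis by (simp add: convex_Int convex_halfspace_Im_ge)
  qed
  have inX: "of_real r * cis \<psi> \<in> X" if "r \<ge> 0" "0 \<le> \<psi>" "\<psi> \<le> pi * a" for r \<psi>
  proof -
    have "of_real r * cis \<psi> * cis (- (pi * a)) = of_real r * cis (\<psi> - pi * a)"
      by (simp add: mult.assoc cis_mult)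
    then have "Im (of_real r * cis \<psi> * cis (- (pi * a))) = r * sin (\<psi> - pi * a)"
      by (simp only: times_complex.sel Re_complex_of_real Im_complex_of_real cis.sel mult_zero_left add_0_right)
    moreover have "sin \<psi> \<ge> 0" using that pia by (intro sin_ge_zero) linarith+
    moreover have "sin (pi * a - \<psi>) \<ge> 0" using that pia by (intro sin_ge_zero) linarith+
    moreover have "sin (\<psi> - pi * a) = - sin (pi * a - \<psi>)" by (metis minus_diff_eq sin_minus)
    ultimately have "Im (of_real r * cis \<psi> * cis (- (pi * a))) \<le> 0" "Im (of_real r * cis \<psi>) \<ge> 0"
      using that by (simp_all add: mult_nonneg_nonpos del: times_complex.sel) (simp add: mult_nonneg_nonpos)
    then show ?thesis unfolding X_def by blast
  qed
  \<comment> \<open>Since \<open>pi * a < pi\<close>, the sector avoids the negative real axis, the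
    cut of \<open>powr\<close>.\<close>
  have Xneg: "Re z \<ge> 0" if "z \<in> X" "Im z = 0" for z
  proof -
    have "- (Re z * sin (pi * a)) \<le> 0" using that by (simp add: X_def)
    moreover have "sin (pi * a) > 0" using pia by (intro sin_gt_zero) auto
    ultimately show ?thesis by (simp add: zero_le_mult_iff)
  qed
  define f where "f \<theta> \<tau> = exp (\<tau> powr of_real p - of_real \<theta> * \<tau>)" for \<theta> :: real and \<tau> :: complex
  have contf: "continuous_on X (f \<theta>)" for \<theta>
    unfolding f_def using Xneg p by (intro continuous_intros) force+
  have difff: "f \<theta> field_differentiable at z" if "z \<in> interior X - {0}" for \<theta> z
  proof -
    have "z \<in> X" "z \<noteq> 0" using that interior_subset by auto
    then have "z \<notin> \<real>\<^sub>\<le>\<^sub>0" using Xneg[OF \<open>z \<in> X\<close>] by (auto elim!: nonpos_Reals_cases)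
    then have "f \<theta> analytic_on {z}" unfolding f_def by (intro analytic_intros) auto
    then show ?thesis by (rule analytic_on_imp_differentiable_at) simp
  qed
  have normf: "norm (f \<theta> (of_real r * cis \<psi>)) = exp (r powr p * cos (p * \<psi>) - \<theta> * (r * cos \<psi>))"
    if "r \<ge> 0" "0 \<le> \<psi>" "\<psi> \<le> pi" for r \<psi> \<theta>
    using that by (simp add: f_def cis_powr_real norm_exp_eq_Re)
  obtain C0 where C0: "\<And>x. x \<ge> 0 \<Longrightarrow> 0 * x - \<kappa> * x powr p \<le> C0 - x"
    using linear_minus_powr_bound[OF \<kappa> p, of 0] by auto
  \<comment> \<open>\<open>K2\<close> is the maximum bound times the length for the segment from
    \<open>c\<close> to the ray, and \<open>exp C0\<close> bounds the integral along the ray. Adding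
    \<open>q\<close> to \<open>K\<close> ensures that \<open>L \<ge> K\<close> reaches beyond the
    corner of the path. None of these depends on \<theta>.\<close>
  define K2 where "K2 = exp (q powr p) * norm (of_real q * \<nu> - of_real c)"
  define K where "K = K2 + exp C0 + q"
  have K2: "K2 \<ge> 0" by (simp add: K2_def)
  have main: "\<exists>C. \<forall>L\<ge>K. \<bar>Im (integral {0..L} (\<lambda>x. \<omega> *
        exp (- of_real (x powr p) - of_real (\<theta> * x) * \<omega>)))\<bar>
      \<le> K * exp (- c * \<theta>) + C * L * exp (- L)" if \<theta>: "\<theta> \<ge> 0" for \<theta>
  proof -
    \<comment> \<open>This constant may depend on \<theta>: on the arc \<open>cos \<psi>\<close> can
      be negative, and then \<open>exp (- \<theta> * L * cos \<psi>)\<close> grows with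
      \<open>L\<close>. The power \<open>L powr p\<close> still wins, and the dependence on \<theta>
      disappears in the limit of large \<open>L\<close>.\<close>
    obtain C1 where C1: "\<And>x. x \<ge> 0 \<Longrightarrow> \<theta> * x - \<kappa> * x powr p \<le> C1 - x"
      using linear_minus_powr_bound[OF \<kappa> p] by auto
    have "\<bar>Im (integral {0..L} (\<lambda>x. \<omega> * exp (- of_real (x powr p) - of_real (\<theta> * x) * \<omega>)))\<bar>
      \<le> K * exp (- c * \<theta>) + (exp C1 * pi) * L * exp (- L)" if L: "L \<ge> K" for L
    proof -
      have Lq: "L \<ge> q" using L K2 by (simp add: K_def) (smt (verit) exp_gt_zero)
      have L0: "L > 0" using Lq q by simp
      \<comment> \<open>Closed path: along the real axis to \<open>c\<close>, up the line
        \<open>Re \<tau> = c\<close> to the ray at angle \<beta>, out to radius \<open>L\<close>,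
        along the arc to angle \<open>pi * a\<close>, and back to the origin on the ray of
        \<open>wright_integral\<close>.\<close>
      define g1 where "g1 = linepath 0 (complex_of_real c)"
      define g2 where "g2 = linepath (complex_of_real c) (of_real q * \<nu>)"
      define g3 where "g3 = linepath (of_real q * \<nu>) (of_real L * \<nu>)"
      define g4 where "g4 = part_circlepath 0 L \<beta> (pi * a)"
      define g5 where "g5 = linepath (of_real L * \<omega>) 0"
      have pts: "0 \<in> X" "complex_of_real c \<in> X" "of_real q * \<nu> \<in> X" "of_real L * \<nu> \<in> X"
          "of_real L * \<omega> \<in> X"
        using inX[of 0 0] inX[of c 0] inX[of q \<beta>] inX[of L \<beta>] inX[of L "pi * a"]
          pia \<beta> \<beta>0 q L0 c by (auto simp: \<omega>_def \<nu>_def)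
      have seg: "closed_segment x y \<subseteq> X" if "x \<in> X" "y \<in> X" for x y
        using that convX by (simp add: closed_segment_subset)
      have pim: "path_image g1 \<subseteq> X" "path_image g2 \<subseteq> X" "path_image g3 \<subseteq> X" "path_image g5 \<subseteq> X"
        using seg pts by (auto simp: g1_def g2_def g3_def g5_def)
      have pi4: "path_image g4 = (\<lambda>\<psi>. of_real L * cis \<psi>) ` {\<beta>..pi * a}"
        unfolding g4_def path_image_part_circlepath' using \<beta> by (simp add: closed_segment_eq_real_ivl)
      then have pim4: "path_image g4 \<subseteq> X" using inX L0 \<beta>0 by auto
      have vp: "valid_path g1" "valid_path g2" "valid_path g3" "valid_path g4" "valid_path g5"
        by (auto simp: g1_def g2_def g3_def g4_def g5_def)
      have ends: "pathfinish g1 = pathstart g2" "pathfinish g2 = pathstart g3"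
          "pathfinish g3 = pathstart g4" "pathfinish g4 = pathstart g5"
          "pathfinish g5 = pathstart g1"
        by (auto simp: g1_def g2_def g3_def g4_def g5_def \<nu>_def \<omega>_def cis_conv_exp exp_of_real)
      have ci: "f \<theta> contour_integrable_on g1" "f \<theta> contour_integrable_on g2"
          "f \<theta> contour_integrable_on g3" "f \<theta> contour_integrable_on g4" "f \<theta> contour_integrable_on g5"
        using pim pim4 contf[of \<theta>] unfolding g1_def g2_def g3_def g4_def g5_def
        by (auto intro!: contour_integrable_continuous_linepath contour_integrable_continuous_part_circlepath
            intro: continuous_on_subset)
      have "(f \<theta> has_contour_integral 0) (g1 +++ g2 +++ g3 +++ g4 +++ g5)"
        using contf convX difff vp pim pim4 ends
        by (intro Cauchy_theorem_convex[where S=X and K="{0}"])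
           (auto simp: path_image_join intro!: valid_path_join)
      then have sum0: "contour_integral g1 (f \<theta>) + (contour_integral g2 (f \<theta>) +
          (contour_integral g3 (f \<theta>) + (contour_integral g4 (f \<theta>) + contour_integral g5 (f \<theta>)))) = 0"
        using ci vp ends by (simp add: contour_integral_unique contour_integrable_joinI valid_path_join flip: contour_integral_join)
      have b1: "Im (contour_integral g1 (f \<theta>)) = 0"
      proof -
        have "contour_integral g1 (f \<theta>) = integral {0..c} (\<lambda>x. f \<theta> (of_real x))"
          using contour_integral_linepath_Reals_eq[of 0 "of_real c" "f \<theta>"] c by (simp add: g1_def)
        also have "\<dots> = integral {0..c} (\<lambda>x. of_real (exp (x powr p - \<theta> * x)))"
          by (rule integral_cong) (auto simp: f_def powr_of_real exp_of_real[symmetric])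
        also have "\<dots> = of_real (integral {0..c} (\<lambda>x. exp (x powr p - \<theta> * x)))"
          by (intro integral_unique has_integral_of_real integrable_integral
              integrable_continuous_real continuous_intros continuous_on_powr') (use p in auto)
        finally show ?thesis by simp
      qed
      have b2: "norm (contour_integral g2 (f \<theta>)) \<le> K2 * exp (- c * \<theta>)"
      proof -
        have "norm (contour_integral g2 (f \<theta>)) \<le> (exp (q powr p) * exp (- c * \<theta>)) * norm (of_real q * \<nu> - of_real c)"
        proof (rule has_contour_integral_bound_linepath)
          show "(f \<theta> has_contour_integral contour_integral g2 (f \<theta>)) (linepath (complex_of_real c) (of_real q * \<nu>))"
            using has_contour_integral_integral[OF ci(2)] by (simp add: g2_def)
          fix z assume "z \<in> closed_segment (complex_of_real c) (of_real q * \<nu>)"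
          then obtain u where u: "0 \<le> u" "u \<le> 1" and z: "z = (1 - u) *\<^sub>R of_real c + u *\<^sub>R (of_real q * \<nu>)"
            by (auto simp: closed_segment_def)
          have Rez: "Re z = c" using q by (simp add: z \<nu>_def algebra_simps)
          have "c \<le> q" using q c cb by (simp add: q_def field_simps)
          have "norm z \<le> (1 - u) * c + u * q"
            using norm_triangle_ineq[of "(1 - u) *\<^sub>R complex_of_real c" "u *\<^sub>R (of_real q * \<nu>)"] u c q
            by (simp add: z \<nu>_def norm_mult)
          also have "\<dots> \<le> (1 - u) * q + u * q" using \<open>c \<le> q\<close> u by (intro add_mono mult_left_mono) auto
          finally have nz: "norm z \<le> q" by (simp add: algebra_simps)
          have "Re (z powr of_real p) \<le> norm (z powr of_real p)" by (rule complex_Re_le_cmod)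
          also have "\<dots> = norm z powr p" by (simp add: norm_powr_real_powr')
          also have "\<dots> \<le> q powr p" using nz p by (intro powr_mono2) auto
          finally show "norm (f \<theta> z) \<le> exp (q powr p) * exp (- c * \<theta>)"
            by (simp add: f_def Rez exp_add[symmetric] algebra_simps)
        qed auto
        then show ?thesis by (simp add: K2_def mult_ac)
      qed
      have b3: "norm (contour_integral g3 (f \<theta>)) \<le> exp C0 * exp (- c * \<theta>)"
      proof -
        define \<rho> where "\<rho> x = (1 - x) * q + x * L" for x
        have eq: "linepath (of_real q * \<nu>) (of_real L * \<nu>) x = of_real (\<rho> x) * \<nu>" for x
          by (simp add: linepath_def \<rho>_def scaleR_conv_of_real algebra_simps)
        have "((\<lambda>x. f \<theta> (of_real (\<rho> x) * \<nu>) * (of_real L * \<nu> - of_real q * \<nu>)) has_integral contour_integral g3 (f \<theta>)) {0..1}"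
          using has_contour_integral_integral[OF ci(3)] unfolding g3_def has_contour_integral_linepath eq .
        \<comment> \<open>The majorant \<open>exp (- \<rho> x)\<close> is an exact derivative up to
          scaling, so the bound on the ray is uniform in its length.\<close>
        moreover have "((\<lambda>x. exp C0 * exp (- c * \<theta>) * ((L - q) * exp (- \<rho> x))) has_integral
            exp C0 * exp (- c * \<theta>) * (exp (- q) - exp (- L))) {0..1}"
        proof (rule has_integral_mult_right)
          have "((\<lambda>x. (L - q) * exp (- \<rho> x)) has_integral (- exp (- \<rho> 1)) - (- exp (- \<rho> 0))) {0..1}"
          proof (rule fundamental_theorem_of_calculus)
            show "((\<lambda>x. - exp (- \<rho> x)) has_vector_derivative (L - q) * exp (- \<rho> x)) (at x within {0..1})" for x
              unfolding \<rho>_def has_real_derivative_iff_has_vector_derivative[symmetric]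
              by (auto intro!: derivative_eq_intros simp: algebra_simps)
          qed simp
          then show "((\<lambda>x. (L - q) * exp (- \<rho> x)) has_integral exp (- q) - exp (- L)) {0..1}"
            by (simp add: \<rho>_def)
        qed
        moreover have "norm (f \<theta> (of_real (\<rho> x) * \<nu>) * (of_real L * \<nu> - of_real q * \<nu>))
            \<le> exp C0 * exp (- c * \<theta>) * ((L - q) * exp (- \<rho> x))" if x: "x \<in> {0..1}" for x
        proof -
          have "q = (1 - x) * q + x * q" by (simp add: algebra_simps)
          also have "\<dots> \<le> \<rho> x" unfolding \<rho>_def using x Lq by (intro add_mono mult_left_mono) auto
          finally have r: "\<rho> x \<ge> q" .
          then have r0: "\<rho> x \<ge> 0" using q by simp
          have "norm (f \<theta> (of_real (\<rho> x) * \<nu>)) = exp (\<rho> x powr p * cos (p * \<beta>) - \<theta> * (\<rho> x * cos \<beta>))"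
            unfolding \<nu>_def using r0 \<beta> \<beta>0 pia by (intro normf) linarith+
          also have "\<dots> \<le> exp (C0 - \<rho> x - c * \<theta>)"
          proof -
            have "c \<le> \<rho> x * cos \<beta>" using r cb q by (metis mult_right_mono less_imp_le)
            then have "c * \<theta> \<le> \<theta> * (\<rho> x * cos \<beta>)" using \<theta> by (simp add: mult.commute mult_left_mono)
            moreover have "\<rho> x powr p * cos (p * \<beta>) \<le> C0 - \<rho> x"
              using C0[OF r0] by (simp add: \<kappa>_def mult.commute)
            ultimately show ?thesis by simp
          qed
          finally have n: "norm (f \<theta> (of_real (\<rho> x) * \<nu>)) \<le> exp (C0 - \<rho> x - c * \<theta>)" .
          have "norm (of_real L * \<nu> - of_real q * \<nu>) = L - q"
          proof -
            have "of_real L * \<nu> - of_real q * \<nu> = of_real (L - q) * \<nu>" by (simp add: algebra_simps)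
            then show ?thesis using Lq by (simp only: norm_mult norm_of_real) (simp add: \<nu>_def)
          qed
          then have "norm (f \<theta> (of_real (\<rho> x) * \<nu>) * (of_real L * \<nu> - of_real q * \<nu>))
              \<le> exp (C0 - \<rho> x - c * \<theta>) * (L - q)"
            unfolding norm_mult using n Lq by (simp add: mult_right_mono)
          also have "exp (C0 - \<rho> x - c * \<theta>) = exp C0 * exp (- c * \<theta>) * exp (- \<rho> x)"
            by (simp add: exp_add[symmetric])
          finally show ?thesis by (simp add: mult_ac)
        qed
        ultimately have "norm (contour_integral g3 (f \<theta>)) \<le> exp C0 * exp (- c * \<theta>) * (exp (- q) - exp (- L))"
          using integral_norm_bound_integral by (metis (no_types, lifting) has_integral_integrable_integral)
        also have "\<dots> \<le> exp C0 * exp (- c * \<theta>) * 1"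
        proof (rule mult_left_mono)
          have "exp (- q) \<le> 1" using q by simp
          then show "exp (- q) - exp (- L) \<le> 1" using exp_gt_zero[of "- L"] by linarith
        qed simp
        finally show ?thesis by simp
      qed
      have b4: "norm (contour_integral g4 (f \<theta>)) \<le> (exp C1 * pi) * L * exp (- L)"
      proof -
        have "norm (contour_integral g4 (f \<theta>)) \<le> exp (C1 - L) * L * (pi * a - \<beta>)"
        proof (rule has_contour_integral_bound_part_circlepath)
          show "(f \<theta> has_contour_integral contour_integral g4 (f \<theta>)) (part_circlepath 0 L \<beta> (pi * a))"
            using has_contour_integral_integral[OF ci(4)] by (simp add: g4_def)
          fix z assume "z \<in> path_image (part_circlepath 0 L \<beta> (pi * a))"
          then obtain \<psi> where \<psi>: "\<beta> \<le> \<psi>" "\<psi> \<le> pi * a" and z: "z = of_real L * cis \<psi>"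
            using pi4 by (auto simp: g4_def)
          have "norm (f \<theta> z) = exp (L powr p * cos (p * \<psi>) - \<theta> * (L * cos \<psi>))"
            unfolding z using \<psi> \<beta>0 pia L0 by (intro normf) linarith+
          also have "L powr p * cos (p * \<psi>) - \<theta> * (L * cos \<psi>) \<le> C1 - L"
          proof -
            have "L powr p * cos (p * \<psi>) \<le> L powr p * (- \<kappa>)"
              using cos\<kappa>[OF \<psi>] by (intro mult_left_mono) auto
            moreover have "\<theta> * L * (- cos \<psi>) \<le> \<theta> * L * 1"
              using \<theta> L0 cos_ge_minus_one[of \<psi>] by (intro mult_left_mono) auto
            ultimately show ?thesis using C1[of L] L0 by (simp add: algebra_simps)
          qed
          finally show "norm (f \<theta> z) \<le> exp (C1 - L)" by simp
        qed (use L0 \<beta> in auto)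
        also have "\<dots> \<le> exp (C1 - L) * L * pi"
        proof (rule mult_left_mono)
          show "pi * a - \<beta> \<le> pi" using pia \<beta>0 by linarith
        qed (use L0 in simp)
        also have "\<dots> = (exp C1 * pi) * L * exp (- L)" by (simp add: exp_diff exp_minus field_simps)
        finally show ?thesis .
      qed
      have b5: "contour_integral g5 (f \<theta>) =
          - integral {0..L} (\<lambda>x. \<omega> * exp (- of_real (x powr p) - of_real (\<theta> * x) * \<omega>))"
      proof -
        have eq: "linepath 0 (of_real L * \<omega>) x = of_real (L * x) * \<omega>" for x
          by (simp add: linepath_def scaleR_conv_of_real algebra_simps)
        \<comment> \<open>At angle \<open>pi * a\<close> the power \<open>p = 1 / a\<close> rotates
          the point onto the negative real axis; this identifies the last piece with the integrand
          of \<open>wright_integral\<close>.\<close>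
        have fx: "f \<theta> (of_real x * \<omega>) = exp (- of_real (x powr p) - of_real (\<theta> * x) * \<omega>)" if "x \<ge> 0" for x
        proof -
          have pp: "p * (pi * a) = pi" using pa by (metis mult.left_commute mult.right_neutral)
          have "(of_real x * \<omega>) powr of_real p = of_real (x powr p) * cis (p * (pi * a))"
            unfolding \<omega>_def using that pia by (intro cis_powr_real) linarith+
          then have "(of_real x * \<omega>) powr of_real p = - of_real (x powr p)"
            unfolding pp by simp
          then show ?thesis by (simp add: f_def mult_ac)
        qed
        let ?h = "\<lambda>x. \<omega> * exp (- of_real (x powr p) - of_real (\<theta> * x) * \<omega>)"
        have "?h integrable_on {0..L}"
          by (intro integrable_continuous_real continuous_intros continuous_on_powr') (use p in auto)
        then have "(?h has_integral integral {0..L} ?h) {0..L}" by (rule integrable_integral)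
        have img: "(\<lambda>x. x / L) ` {0..L} = {0..1::real}"
        proof (intro equalityI subsetI)
          fix x :: real assume "x \<in> {0..1}"
          then have "x = (x * L) / L" "x * L \<in> {0..L}" using L0 by (auto simp: mult_left_le_one_le)
          then show "x \<in> (\<lambda>x. x / L) ` {0..L}" by blast
        qed (use L0 in auto)
        from has_integral_stretch_real[OF \<open>(?h has_integral integral {0..L} ?h) {0..L}\<close>, of L] L0
        have "((\<lambda>x. ?h (L * x)) has_integral (1 / L) *\<^sub>R integral {0..L} ?h) {0..1}"
          by (simp add: img)
        from has_integral_mult_right[OF this, of "of_real L"]
        have sc: "((\<lambda>x. of_real L * ?h (L * x)) has_integral integral {0..L} ?h) {0..1}"
          using L0 by (simp add: scaleR_conv_of_real)
        have hf: "of_real L * ?h (L * x) = f \<theta> (linepath 0 (of_real L * \<omega>) x) * (of_real L * \<omega> - 0)"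
          if "x \<in> {0..1}" for x
          unfolding eq using that L0 by (subst fx) auto
        have "((\<lambda>x. f \<theta> (linepath 0 (of_real L * \<omega>) x) * (of_real L * \<omega> - 0)) has_integral integral {0..L} ?h) {0..1}"
          by (rule has_integral_eq[OF hf sc])
        then have "(f \<theta> has_contour_integral integral {0..L} ?h) (linepath 0 (of_real L * \<omega>))"
          by (simp only: has_contour_integral_linepath)
        then have "contour_integral (linepath 0 (of_real L * \<omega>)) (f \<theta>) = integral {0..L} ?h"
          by (rule contour_integral_unique)
        moreover have "contour_integral (linepath (of_real L * \<omega>) 0) (f \<theta>)
            = - contour_integral (linepath 0 (of_real L * \<omega>)) (f \<theta>)"
          by (rule contour_integral_reverse_linepath[OF continuous_on_subset[OF contf seg[OF pts(5,1)]]])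
        ultimately show ?thesis by (simp add: g5_def)
      qed
      have "Im (integral {0..L} (\<lambda>x. \<omega> * exp (- of_real (x powr p) - of_real (\<theta> * x) * \<omega>)))
          = Im (contour_integral g2 (f \<theta>)) + Im (contour_integral g3 (f \<theta>)) + Im (contour_integral g4 (f \<theta>))"
        using arg_cong[OF sum0, of Im] b1 unfolding b5 by simp
      also have "\<bar>\<dots>\<bar> \<le> K2 * exp (- c * \<theta>) + exp C0 * exp (- c * \<theta>) + (exp C1 * pi) * L * exp (- L)"
        using b2 b3 b4 abs_Im_le_cmod[of "contour_integral g2 (f \<theta>)"]
          abs_Im_le_cmod[of "contour_integral g3 (f \<theta>)"] abs_Im_le_cmod[of "contour_integral g4 (f \<theta>)"]
        by linarith
      also have "\<dots> \<le> K * exp (- c * \<theta>) + (exp C1 * pi) * L * exp (- L)"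
        using q by (simp add: K_def algebra_simps)
      finally show ?thesis .
    qed
    then show ?thesis by blast
  qed
  show ?thesis
    using main unfolding p_def \<omega>_def by blast
qed

text \<open>For fixed \<theta> the radius \<open>L\<close> tends to infinity, which removes the arc
  term and its constant; what remains carries a constant uniform in \<theta>.\<close>

lemma wright_decay:
  fixes a c :: real
  assumes a: "0 < a" "a < 1"
  obtains C where "\<And>\<theta>. \<theta> \<ge> 0 \<Longrightarrow> \<bar>wright a \<theta>\<bar> \<le> C * exp (- c * \<theta>)"
proof -
  \<comment> \<open>The contour needs a positive rate, and a larger rate is stronger for \<theta>
    \<ge> 0.\<close>
  define c' where "c' = max c 1"
  have c': "c' > 0" by (simp add: c'_def)
  obtain K where K: "\<And>\<theta>. \<theta> \<ge> 0 \<Longrightarrow> \<exists>C. \<forall>L\<ge>K.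
    \<bar>Im (integral {0..L} (\<lambda>x. cis (pi * a) *
        exp (- of_real (x powr (1 / a)) - of_real (\<theta> * x) * cis (pi * a))))\<bar>
      \<le> K * exp (- c' * \<theta>) + C * L * exp (- L)"
    using wright_contour_bound[OF a c'] by blast
  have "\<bar>wright a \<theta>\<bar> \<le> \<bar>K\<bar> / (a * pi) * exp (- c * \<theta>)" if \<theta>: "\<theta> \<ge> 0" for \<theta>
  proof -
    let ?M = "lebesgue_on {0::real..}"
    define h where "h x = cis (pi * a) * exp (- of_real (x powr (1 / a)) - of_real (\<theta> * x) * cis (pi * a))"
      for x :: real
    have hint: "integrable ?M h" and hw: "a * pi * wright a \<theta> = Im (\<integral>x. h x \<partial>?M)"
      using wright_integral[OF a, of \<theta>] by (simp_all add: h_def[abs_def])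
    obtain C where C: "\<And>L. L \<ge> K \<Longrightarrow> \<bar>Im (integral {0..L} h)\<bar> \<le> K * exp (- c' * \<theta>) + C * L * exp (- L)"
      using K[OF \<theta>] by (auto simp: h_def[abs_def])
    define F where "F k x = (if x \<in> {0..real k} then h x else 0)" for k x
    have Fint: "integrable ?M (F k)" "(\<integral>x. F k x \<partial>?M) = integral {0..real k} h" for k
    proof -
      have "integrable (lebesgue_on {0..real k}) h"
        using hint by (rule integrable_lebesgue_on_subset) auto
      then show "(\<integral>x. F k x \<partial>?M) = integral {0..real k} h"
        unfolding F_def by (subst integral_restrict) (auto simp: lebesgue_integral_eq_integral)
      show "integrable ?M (F k)"
        using integrable_mult_indicator[of "{0..real k}" ?M h] hint
        by (auto simp: F_def[abs_def] indicator_scaleR_eq_if sets_restrict_space_iff)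
    qed
    have "(\<lambda>k. \<integral>x. F k x \<partial>?M) \<longlonglongrightarrow> (\<integral>x. h x \<partial>?M)"
    proof (rule integral_dominated_convergence[where w="\<lambda>x. norm (h x)"])
      show "AE x in ?M. (\<lambda>k. F k x) \<longlonglongrightarrow> h x"
      proof (rule AE_I2)
        fix x assume "x \<in> space ?M"
        then have "x \<ge> 0" by simp
        obtain N :: nat where "x \<le> real N" using real_arch_simple by blast
        then have "\<forall>k\<ge>N. F k x = h x" using \<open>x \<ge> 0\<close> by (auto simp: F_def)
        then show "(\<lambda>k. F k x) \<longlonglongrightarrow> h x"
          by (intro tendsto_eventually) (auto simp: eventually_sequentially)
      qed
      show "F k \<in> borel_measurable ?M" for k using Fint(1) by (rule borel_measurable_integrable)
      show "AE x in ?M. norm (F k x) \<le> norm (h x)" for k by (simp add: F_def)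
    qed (use hint in auto)
    then have "(\<lambda>k. integral {0..real k} h) \<longlonglongrightarrow> (\<integral>x. h x \<partial>?M)" by (simp add: Fint(2))
    then have "(\<lambda>k. \<bar>Im (integral {0..real k} h)\<bar>) \<longlonglongrightarrow> \<bar>Im (\<integral>x. h x \<partial>?M)\<bar>" by (intro tendsto_intros)
    moreover have "(\<lambda>k. K * exp (- c' * \<theta>) + C * real k * exp (- real k)) \<longlonglongrightarrow> K * exp (- c' * \<theta>) + 0"
      by (intro tendsto_add tendsto_const) real_asymp
    moreover have "\<exists>N. \<forall>k\<ge>N. \<bar>Im (integral {0..real k} h)\<bar> \<le> K * exp (- c' * \<theta>) + C * real k * exp (- real k)"
    proof -
      obtain N :: nat where "K \<le> real N" using real_arch_simple by blast
      then show ?thesis using C by (intro exI[of _ N]) auto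
    qed
    ultimately have "\<bar>Im (\<integral>x. h x \<partial>?M)\<bar> \<le> K * exp (- c' * \<theta>) + 0" by (rule LIMSEQ_le)
    then have "a * pi * \<bar>wright a \<theta>\<bar> \<le> K * exp (- c' * \<theta>)"
      using a by (simp flip: hw add: abs_mult)
    also have "\<dots> \<le> \<bar>K\<bar> * exp (- c * \<theta>)"
      using \<theta> by (intro mult_mono) (auto simp: c'_def mult_right_mono)
    finally show ?thesis using a by (simp add: field_simps)
  qed
  then show ?thesis using that by blast
qed

section \<open>Strongly continuous semigroups\<close>

lemma C0_semigroupD:
  assumes "C0_semigroup S"
  shows "r \<ge> 0 \<Longrightarrow> bounded_linear (S r)" "S 0 x = x"
    "r \<ge> 0 \<Longrightarrow> s \<ge> 0 \<Longrightarrow> S (r + s) x = S r (S s x)"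
    "((\<lambda>r. S r x) \<longlongrightarrow> x) (at_right 0)"
  using assms by (auto simp: C0_semigroup_def)

lemma C0_semigroup_tendsto_0:
  assumes S: "C0_semigroup S"
  shows "((\<lambda>r. S r x) \<longlongrightarrow> x) (at 0 within {0..})"
proof -
  have "at (0::real) within {0..} = at_right 0"
    by (rule at_within_nhd[of 0 UNIV]) auto
  then show ?thesis using C0_semigroupD(4)[OF S] by simp
qed

text \<open>If no bound held near 0, there would be times \<open>r k\<close> tending to 0 with
  operators growing without bound, yet \<open>S (r k) y\<close> tends to \<open>y\<close> for every
  \<open>y\<close>, contradicting uniform boundedness. \<open>K \<ge> 1\<close> is arranged so that
  powers of \<open>K\<close> increase.\<close>

lemma C0_semigroup_locally_bounded:
  fixes S :: "real \<Rightarrow> 'h::banach \<Rightarrow> 'h"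
  assumes S: "C0_semigroup S"
  obtains d K where "d > 0" "K \<ge> 1" "\<And>r x. 0 \<le> r \<Longrightarrow> r \<le> d \<Longrightarrow> norm (S r x) \<le> K * norm x"
proof -
  have "\<exists>d>0. \<exists>K. \<forall>r x. 0 \<le> r \<longrightarrow> r \<le> d \<longrightarrow> norm (S r x) \<le> K * norm x"
  proof (rule ccontr)
    assume neg: "\<not> ?thesis"
    have "\<exists>r x. 0 \<le> r \<and> r \<le> 1 / (real k + 1) \<and> real k * norm x < norm (S r x)" for k
    proof -
      have "1 / (real k + 1) > 0" by simp
      then show ?thesis using neg by (meson not_le)
    qed
    then obtain r x where r: "\<And>k. 0 \<le> r k" "\<And>k. r k \<le> 1 / (real k + 1)"
      and x: "\<And>k. real k * norm (x k) < norm (S (r k) (x k))" by metis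
    have "r \<longlonglongrightarrow> 0"
    proof (rule tendsto_sandwich[OF _ _ tendsto_const])
      show "(\<lambda>k. 1 / (real k + 1)) \<longlonglongrightarrow> 0" by real_asymp
    qed (use r in auto)
    have "(\<lambda>k. S (r k) y) \<longlonglongrightarrow> y" for y
    proof -
      have "continuous (at 0 within {0..}) (\<lambda>r. S r y)"
        using C0_semigroup_tendsto_0[OF S] by (simp add: continuous_within C0_semigroupD(2)[OF S])
      from continuous_within_tendsto_compose'[OF this _ \<open>r \<longlonglongrightarrow> 0\<close>] r
      show ?thesis by (simp add: C0_semigroupD(2)[OF S])
    qed
    then have "Bseq (\<lambda>k. S (r k) y)" for y using convergent_imp_Bseq convergentI by blast
    then have "\<exists>C. \<forall>k. norm (S (r k) y) \<le> C" for y by (auto simp: Bseq_def)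
    then obtain K where K: "\<And>k y. norm (S (r k) y) \<le> K * norm y"
      using banach_steinhaus_sequence[of "\<lambda>k. S (r k)"] C0_semigroupD(1)[OF S] r(1) by metis
    obtain k :: nat where "K \<le> real k" using real_arch_simple by blast
    then have "K * norm (x k) \<le> real k * norm (x k)" by (rule mult_right_mono) simp
    with x[of k] K[of k "x k"] show False by linarith
  qed
  then obtain d K where d: "d > 0" and K: "\<And>r x. 0 \<le> r \<Longrightarrow> r \<le> d \<Longrightarrow> norm (S r x) \<le> K * norm x"
    by blast
  have "norm (S r x) \<le> max K 1 * norm x" if "0 \<le> r" "r \<le> d" for r x
    using K[OF that, of x] mult_right_mono[of K "max K 1" "norm x"] by simp
  then show ?thesis using that d by (metis max.cobounded2)
qed

text \<open>A time \<open>r\<close> is covered by about \<open>r / d\<close> steps of length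
  \<open>d\<close>, each costing a factor \<open>K\<close>; rounding up costs one more factor, which
  becomes the constant in front.\<close>

lemma C0_semigroup_growth:
  fixes S :: "real \<Rightarrow> 'h::banach \<Rightarrow> 'h"
  assumes S: "C0_semigroup S"
  obtains M \<omega> where "M \<ge> 1" "\<omega> \<ge> 0" "\<And>r x. 0 \<le> r \<Longrightarrow> norm (S r x) \<le> M * exp (\<omega> * r) * norm x"
proof -
  obtain d K where d: "d > 0" and K1: "K \<ge> 1"
    and K: "\<And>r x. 0 \<le> r \<Longrightarrow> r \<le> d \<Longrightarrow> norm (S r x) \<le> K * norm x"
    using C0_semigroup_locally_bounded[OF S] by blast
  have pow: "0 \<le> r \<Longrightarrow> r \<le> real n * d \<Longrightarrow> norm (S r x) \<le> K ^ n * norm x" for n r x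
  proof (induction n arbitrary: r)
    case 0
    then show ?case by (simp add: C0_semigroupD(2)[OF S])
  next
    case (Suc n)
    show ?case
    proof (cases "r \<le> d")
      case True
      have "K \<le> K ^ Suc n" using K1 by (simp add: mult_le_cancel_left1 one_le_power)
      then have "K * norm x \<le> K ^ Suc n * norm x" by (rule mult_right_mono) simp
      with K[OF Suc.prems(1) True, of x] show ?thesis by linarith
    next
      case False
      have "S (d + (r - d)) x = S d (S (r - d) x)"
        using False d by (intro C0_semigroupD(3)[OF S]) auto
      then have "norm (S r x) \<le> K * norm (S (r - d) x)" using K[of d] d by simp
      also have "\<dots> \<le> K * (K ^ n * norm x)"
        using Suc.IH[of "r - d"] Suc.prems False K1 by (intro mult_left_mono) (auto simp: algebra_simps)
      finally show ?thesis by (simp add: mult.assoc)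
    qed
  qed
  have "norm (S r x) \<le> K * exp (ln K / d * r) * norm x" if r: "0 \<le> r" for r x
  proof -
    define n where "n = nat \<lceil>r / d\<rceil>"
    have n: "r / d \<le> real n" "real n \<le> r / d + 1" using r d by (auto simp: n_def) 
    have "r \<le> real n * d" using n(1) d by (simp add: field_simps)
    from pow[OF r this] have "norm (S r x) \<le> K ^ n * norm x" .
    also have "K ^ n = K powr real n" using K1 by (simp add: powr_realpow)
    also have "\<dots> \<le> K powr (r / d + 1)" using n(2) K1 by (rule powr_mono)
    also have "\<dots> = K * exp (ln K / d * r)" using K1 by (simp add: powr_add) (simp add: powr_def mult_ac)
    finally show ?thesis by (simp add: mult_right_mono)
  qed
  moreover have "ln K / d \<ge> 0" using K1 d by simp
  ultimately show ?thesis using that K1 by blast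
qed

lemma C0_semigroup_bounded_on:
  fixes S :: "real \<Rightarrow> 'h::banach \<Rightarrow> 'h"
  assumes S: "C0_semigroup S"
  obtains K where "K \<ge> 1" "\<And>r x. 0 \<le> r \<Longrightarrow> r \<le> R \<Longrightarrow> norm (S r x) \<le> K * norm x"
proof -
  obtain M \<omega> where M: "M \<ge> 1" "\<omega> \<ge> 0" "\<And>r x. 0 \<le> r \<Longrightarrow> norm (S r x) \<le> M * exp (\<omega> * r) * norm x"
    using C0_semigroup_growth[OF S] by blast
  have "norm (S r x) \<le> (M * exp (\<omega> * \<bar>R\<bar>)) * norm x" if "0 \<le> r" "r \<le> R" for r x
  proof -
    have "M * exp (\<omega> * r) * norm x \<le> M * exp (\<omega> * \<bar>R\<bar>) * norm x"
      using that M by (intro mult_right_mono mult_left_mono) (auto intro: mult_left_mono)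
    then show ?thesis using M(3)[OF that(1), of x] by linarith
  qed
  moreover have "M * exp (\<omega> * \<bar>R\<bar>) \<ge> 1" using M by (simp add: mult_ge1_I)
  ultimately show ?thesis using that by blast
qed

lemma C0_semigroup_continuous:
  fixes S :: "real \<Rightarrow> 'h::banach \<Rightarrow> 'h"
  assumes S: "C0_semigroup S"
  shows "continuous_on {0..} (\<lambda>r. S r x)"
  unfolding continuous_on_sequentially
proof (intro allI ballI impI)
  fix f r0 assume "r0 \<in> {0::real..}" and "(\<forall>n. f n \<in> {0..}) \<and> f \<longlonglongrightarrow> r0"
  then have r0: "r0 \<ge> 0" and f0: "\<And>n. f n \<ge> 0" and f: "f \<longlonglongrightarrow> r0" by auto
  obtain K where bound: "\<And>r y. 0 \<le> r \<Longrightarrow> r \<le> r0 \<Longrightarrow> norm (S r y) \<le> K * norm y"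
    using C0_semigroup_bounded_on[OF S] by metis
  \<comment> \<open>The smaller of the two times is factored out. It never exceeds
    \<open>r0\<close>, so one bound \<open>K\<close> serves both sides, and only continuity at 0 of
    the remaining factor is left.\<close>
  have le: "norm (S r x - S r0 x) \<le> K * norm (S \<bar>r - r0\<bar> x - x)" if r: "r \<ge> 0" for r
  proof (cases "r \<ge> r0")
    case True
    have "S (r0 + (r - r0)) x = S r0 (S (r - r0) x)"
      using True r0 by (intro C0_semigroupD(3)[OF S]) auto
    then have "S r x - S r0 x = S r0 (S (r - r0) x - x)"
      using bounded_linear.linear[OF C0_semigroupD(1)[OF S r0]] by (simp add: linear_diff)
    then show ?thesis using bound[OF r0 order_refl, of "S (r - r0) x - x"] True by simp
  next
    case False
    have "S (r + (r0 - r)) x = S r (S (r0 - r) x)"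
      using False r by (intro C0_semigroupD(3)[OF S]) auto
    then have "S r0 x - S r x = S r (S (r0 - r) x - x)"
      using bounded_linear.linear[OF C0_semigroupD(1)[OF S r]] by (simp add: linear_diff)
    then show ?thesis using bound[OF r, of "S (r0 - r) x - x"] False by (simp add: norm_minus_commute[of "S r x"])
  qed
  have "(\<lambda>n. S \<bar>f n - r0\<bar> x) \<longlonglongrightarrow> x"
  proof -
    have "continuous (at 0 within {0..}) (\<lambda>r. S r x)"
      using C0_semigroup_tendsto_0[OF S] by (simp add: continuous_within C0_semigroupD(2)[OF S])
    moreover have "(\<lambda>n. \<bar>f n - r0\<bar>) \<longlonglongrightarrow> 0" using f LIM_zero tendsto_rabs_zero by blast
    ultimately show ?thesis
      using continuous_within_tendsto_compose'[of 0 "{0..}" "\<lambda>r. S r x" "\<lambda>n. \<bar>f n - r0\<bar>"]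
      by (simp add: C0_semigroupD(2)[OF S])
  qed
  then have "(\<lambda>n. K * norm (S \<bar>f n - r0\<bar> x - x)) \<longlonglongrightarrow> K * norm (x - x)"
    by (intro tendsto_intros)
  then have lim0: "(\<lambda>n. K * norm (S \<bar>f n - r0\<bar> x - x)) \<longlonglongrightarrow> 0" by simp
  have "(\<lambda>n. S (f n) x - S r0 x) \<longlonglongrightarrow> 0"
    by (rule Lim_null_comparison[OF _ lim0]) (use le f0 in auto)
  then show "((\<lambda>r. S r x) \<circ> f) \<longlonglongrightarrow> S r0 x" by (simp add: o_def LIM_zero_iff)
qed

text \<open>On a Hilbert space the adjoint semigroup is again strongly continuous: the adjoints of the means
  of \<open>S\<close> over \<open>{0..e}\<close> have ranges consisting of vectors of strong continuity, and those ranges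
  span a dense subspace.\<close>

lemma adjoint_C0_semigroup:
  fixes S :: "real \<Rightarrow> 'h::{real_inner, banach} \<Rightarrow> 'h"
  assumes S: "C0_semigroup S"
  shows "C0_semigroup (\<lambda>r. adjoint (S r))"
proof -
  define A where "A r = adjoint (S r)" for r
  note bl = C0_semigroupD(1)[OF S]
  have A: "S r x \<bullet> y = x \<bullet> A r y" if "r \<ge> 0" for r x y
    unfolding A_def by (rule adjoint_bounded[OF bl[OF that]])
  have Abl: "bounded_linear (A r)" if "r \<ge> 0" for r
    unfolding A_def by (rule bounded_linear_adjoint[OF bl[OF that]])
  note Alin = linear_simps[OF Abl] and Slin = linear_simps[OF bl]
  have A0: "A 0 = id" unfolding A_def
    by (rule adjoint_unique) (simp add: C0_semigroupD(2)[OF S])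
  have Aadd: "A (r + s) = A r \<circ> A s" if "r \<ge> 0" "s \<ge> 0" for r s
  proof -
    have "S (r + s) x = S s (S r x)" for x
      using C0_semigroupD(3)[OF S that(2,1)] by (simp add: add.commute)
    then show ?thesis unfolding A_def[of "r + s"]
      by (intro adjoint_unique) (simp add: A that)
  qed
  define X where "X = {y. ((\<lambda>r. A r y) \<longlongrightarrow> y) (at_right 0)}"
  have evr: "\<forall>\<^sub>F r::real in at_right 0. 0 < r \<and> r < e" if "e > 0" for e
    using that by (auto simp: eventually_at_right_field)
  have subX: "subspace X"
  proof (rule subspaceI)
    have "\<forall>\<^sub>F r in at_right 0. A r 0 = 0"
      using evr[OF zero_less_one] by eventually_elim (simp add: Alin)
    then show "0 \<in> X" by (simp add: X_def tendsto_eventually)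
  next
    fix x y assume "x \<in> X" "y \<in> X"
    then have "((\<lambda>r. A r x + A r y) \<longlongrightarrow> x + y) (at_right 0)" by (auto simp: X_def intro: tendsto_add)
    moreover have "\<forall>\<^sub>F r in at_right 0. A r x + A r y = A r (x + y)"
      using evr[OF zero_less_one] by eventually_elim (simp add: Alin)
    ultimately have "((\<lambda>r. A r (x + y)) \<longlongrightarrow> x + y) (at_right 0)" by (rule Lim_transform_eventually)
    then show "x + y \<in> X" by (simp add: X_def)
  next
    fix c and x assume "x \<in> X"
    then have "((\<lambda>r. c *\<^sub>R A r x) \<longlongrightarrow> c *\<^sub>R x) (at_right 0)" by (auto simp: X_def intro: tendsto_intros)
    moreover have "\<forall>\<^sub>F r in at_right 0. c *\<^sub>R A r x = A r (c *\<^sub>R x)"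
      using evr[OF zero_less_one] by eventually_elim (simp add: Alin)
    ultimately have "((\<lambda>r. A r (c *\<^sub>R x)) \<longlongrightarrow> c *\<^sub>R x) (at_right 0)" by (rule Lim_transform_eventually)
    then show "c *\<^sub>R x \<in> X" by (simp add: X_def)
  qed
  \<comment> \<open>The uniform bound on \<open>{0..1}\<close> passes to the adjoints, so
    \<open>z\<close> can replace \<open>y\<close> at small cost, uniformly in
    \<open>r\<close>.\<close>
  have clX: "closure X \<subseteq> X"
  proof
    fix y assume y: "y \<in> closure X"
    obtain N where N: "N \<ge> 1" and SN: "\<And>r x. 0 \<le> r \<Longrightarrow> r \<le> 1 \<Longrightarrow> norm (S r x) \<le> N * norm x"
      using C0_semigroup_bounded_on[OF S] by blast
    have "((\<lambda>r. A r y) \<longlongrightarrow> y) (at_right 0)"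
    proof (rule tendstoI)
      fix e :: real assume e: "e > 0"
      then have "e / (3 * N) > 0" using N by simp
      then obtain z where z: "z \<in> X" "norm (y - z) < e / (3 * N)"
        using y unfolding closure_approachable by (metis dist_commute dist_norm)
      have "N * norm (y - z) < e / 3" using z(2) N by (simp add: field_simps)
      moreover have "norm (y - z) \<le> N * norm (y - z)"
        using N mult_right_mono[of 1 N "norm (y - z)"] by simp
      ultimately have sm: "N * norm (y - z) < e / 3" "norm (y - z) < e / 3" by auto
      have "\<forall>\<^sub>F r in at_right 0. dist (A r z) z < e / 3"
        using z(1) e unfolding X_def by (intro tendstoD) auto
      then show "\<forall>\<^sub>F r in at_right 0. dist (A r y) y < e"
        using evr[OF zero_less_one]
      proof eventually_elim
        case (elim r)
        have "A r (y - z) = A r y - A r z"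
          using elim by (simp add: Alin)
        then have eq: "A r y - y = A r (y - z) + (A r z - z) + (z - y)" by simp
        have "norm (A r y - y) \<le> norm (A r (y - z)) + norm (A r z - z) + norm (z - y)"
          unfolding eq using norm_triangle_ineq[of "A r (y - z) + (A r z - z)" "z - y"]
            norm_triangle_ineq[of "A r (y - z)" "A r z - z"] by linarith
        also have "norm (A r (y - z)) \<le> N * norm (y - z)"
          unfolding A_def using elim SN N by (intro norm_adjoint_le bl) auto
        finally show ?case using elim sm by (simp add: dist_norm norm_minus_commute[of z y])
      qed
    qed
    then show "y \<in> X" by (simp add: X_def)
  qed
  \<comment> \<open>Orbits are norm continuous, so the integral over compact intervals exists for
    vector values directly, together with its additivity over intervals.\<close>
  define V where "V e x = integral {0..e} (\<lambda>s. S s x)" for e :: real and x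
  have Sint: "(\<lambda>s. S s x) integrable_on {u..v}" if "u \<ge> 0" for u v x
    using that by (intro integrable_continuous_real continuous_on_subset[OF C0_semigroup_continuous[OF S]]) auto
  have Inorm: "norm (integral {u..v} (\<lambda>s. S s x)) \<le> K * norm x * (v - u)"
    if "0 \<le> u" "u \<le> v" "\<And>r. 0 \<le> r \<Longrightarrow> r \<le> v \<Longrightarrow> norm (S r x) \<le> K * norm x" for u v x K
    using that by (intro integral_bound continuous_on_subset[OF C0_semigroup_continuous[OF S]]) auto
  have Vbl: "bounded_linear (V e)" if "e \<ge> 0" for e
  proof -
    obtain K where K: "\<And>r x. 0 \<le> r \<Longrightarrow> r \<le> e \<Longrightarrow> norm (S r x) \<le> K * norm x"
      using C0_semigroup_bounded_on[OF S] by blast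
    show ?thesis
    proof (rule bounded_linear_intro)
      fix x y and c :: real
      have "V e (x + y) = integral {0..e} (\<lambda>s. S s x + S s y)"
        unfolding V_def by (intro integral_cong) (simp add: Slin)
      then show "V e (x + y) = V e x + V e y" unfolding V_def using Sint by (simp add: integral_add)
      have "V e (c *\<^sub>R x) = integral {0..e} (\<lambda>s. c *\<^sub>R S s x)"
        unfolding V_def by (intro integral_cong) (simp add: Slin)
      then show "V e (c *\<^sub>R x) = c *\<^sub>R V e x" unfolding V_def using Sint by simp
      show "norm (V e x) \<le> norm x * (K * e)"
        using Inorm[of 0 e x K] K that by (simp add: V_def mult_ac)
    qed
  qed
  have VX: "adjoint (V e) y \<in> X" if e: "e > 0" for e y
  proof -
    obtain N where N: "N \<ge> 1" and SN: "\<And>r x. 0 \<le> r \<Longrightarrow> r \<le> 2 * e \<Longrightarrow> norm (S r x) \<le> N * norm x"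
      using C0_semigroup_bounded_on[OF S] by blast
    define z where "z = adjoint (V e) y"
    \<comment> \<open>After the shift, the integrals over \<open>{r..e + r}\<close> and
      \<open>{0..e}\<close> cancel except for two pieces of length \<open>r\<close>. Smoothing thus
      gives an operator estimate of order \<open>r\<close>, which survives passage to
      adjoints.\<close>
    have Vd: "norm (V e (S r x) - V e x) \<le> 2 * N * r * norm x" if r: "0 < r" "r < e" for r x
    proof -
      have "V e (S r x) = integral {0..e} (\<lambda>s. S (s + r) x)"
        unfolding V_def using C0_semigroupD(3)[OF S] r by (intro integral_cong) simp
      also have "\<dots> = integral {r..e + r} (\<lambda>s. S s x)"
        using integral_shift_real_ivl[of r r "e + r" "\<lambda>s. S s x"] by simp
      finally have VS: "V e (S r x) = integral {r..e + r} (\<lambda>s. S s x)" .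
      have c1: "integral {r..e} (\<lambda>s. S s x) + integral {e..e + r} (\<lambda>s. S s x) = integral {r..e + r} (\<lambda>s. S s x)"
        using r Sint by (intro Henstock_Kurzweil_Integration.integral_combine) auto
      have c2: "integral {0..r} (\<lambda>s. S s x) + integral {r..e} (\<lambda>s. S s x) = integral {0..e} (\<lambda>s. S s x)"
        using r Sint by (intro Henstock_Kurzweil_Integration.integral_combine) auto
      have "V e (S r x) - V e x = integral {e..e + r} (\<lambda>s. S s x) - integral {0..r} (\<lambda>s. S s x)"
        unfolding VS unfolding V_def c1[symmetric] c2[symmetric] by simp
      then have "norm (V e (S r x) - V e x) \<le> norm (integral {e..e + r} (\<lambda>s. S s x)) + norm (integral {0..r} (\<lambda>s. S s x))"
        by (simp add: norm_triangle_ineq4)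
      also have "\<dots> \<le> N * norm x * r + N * norm x * r"
        using Inorm[of e "e + r" x N] Inorm[of 0 r x N] SN r e by (intro add_mono) auto
      finally show ?thesis by (simp add: algebra_simps)
    qed
    \<comment> \<open>Pairing the difference with itself moves \<open>A r\<close> and
      \<open>adjoint (V e)\<close> back to \<open>S r\<close> and \<open>V e\<close>, where the
      estimate \<open>Vd\<close> applies.\<close>
    have zb: "norm (A r z - z) \<le> 2 * N * r * norm y" if r: "0 < r" "r < e" for r
    proof (cases "A r z = z")
      case False
      let ?d = "A r z - z"
      have adjV: "V e u \<bullet> y = u \<bullet> z" for u
        unfolding z_def using e by (intro adjoint_bounded Vbl) auto
      have "norm ?d * norm ?d = ?d \<bullet> ?d" by (simp add: power2_norm_eq_inner[symmetric] power2_eq_square)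
      also have "\<dots> = S r ?d \<bullet> z - ?d \<bullet> z" using r by (simp add: A inner_diff_right)
      also have "\<dots> = (V e (S r ?d) - V e ?d) \<bullet> y"
        by (simp add: adjV inner_diff_left)
      also have "\<dots> \<le> norm (V e (S r ?d) - V e ?d) * norm y" by (rule norm_cauchy_schwarz)
      also have "\<dots> \<le> 2 * N * r * norm ?d * norm y" using Vd[OF r] by (intro mult_right_mono) auto
      finally have "norm ?d * norm ?d \<le> (2 * N * r * norm y) * norm ?d" by (simp add: mult_ac)
      then show ?thesis using False by simp
    qed (use N that in simp)
    have "((\<lambda>r. A r z - z) \<longlongrightarrow> 0) (at_right 0)"
    proof (rule Lim_null_comparison)
      show "\<forall>\<^sub>F r in at_right 0. norm (A r z - z) \<le> 2 * N * r * norm y"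
        using evr[OF e] by eventually_elim (use zb in auto)
      have "((\<lambda>r. 2 * N * r * norm y) \<longlongrightarrow> 2 * N * 0 * norm y) (at_right 0)" by (intro tendsto_intros)
      then show "((\<lambda>r. 2 * N * r * norm y) \<longlongrightarrow> 0) (at_right 0)" by simp
    qed
    then show ?thesis by (simp add: X_def z_def LIM_zero_iff)
  qed
  have "closure X = UNIV"
    unfolding dense_subspace_iff[OF subX]
  proof (intro allI impI)
    fix w assume w: "\<forall>v\<in>X. v \<bullet> w = 0"
    \<comment> \<open>A vector orthogonal to all the ranges is annihilated by every
      \<open>V e\<close>; differentiating \<open>V e w\<close> at \<open>e = 0\<close> then recovers
      \<open>w\<close> itself as 0.\<close>
    have V0: "V e w = 0" if "e > 0" for e
    proof -
      have "V e w \<bullet> y = 0" for y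
        using w[rule_format, OF VX[OF that, of y]] adjoint_bounded[OF Vbl, of e w y] that
        by (simp add: inner_commute)
      then show ?thesis by (metis inner_eq_zero_iff)
    qed
    have "((\<lambda>e. integral {0..e} (\<lambda>s. S s w)) has_vector_derivative S 0 w) (at 0 within {0..1})"
      by (intro integral_has_vector_derivative continuous_on_subset[OF C0_semigroup_continuous[OF S]]) auto
    then have d: "((\<lambda>e. V e w) has_vector_derivative w) (at 0 within {0..1})"
      by (simp add: V_def C0_semigroupD(2)[OF S])
    have "V 0 w = 0" by (simp add: V_def)
    then have "((\<lambda>e::real. 0) has_vector_derivative w) (at 0 within {0..1})"
      using V0 by (intro has_vector_derivative_transform[OF _ _ d]) (auto simp: le_less)
    moreover have "at 0 within {0..1::real} \<noteq> bot" by (simp add: trivial_limit_within islimpt_Icc)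
    ultimately show "w = 0"
      using vector_derivative_unique_within has_vector_derivative_const by blast
  qed
  then have "X = UNIV" using clX by auto
  then show ?thesis
    using Abl A0 Aadd unfolding C0_semigroup_def A_def[symmetric] X_def by auto
qed

section \<open>Fractional solution operators\<close>

text \<open>The properties shared by the semigroup, the fractional operators and their adjoints. The
  locally uniform bound is what upgrades strong continuity to joint continuity in time and
  vector.\<close>

definition bounded_operator_family :: "(real \<Rightarrow> 'a::real_normed_vector \<Rightarrow> 'b::real_normed_vector) \<Rightarrow> bool" where
  "bounded_operator_family P \<longleftrightarrow>
     (\<forall>r\<ge>0. bounded_linear (P r)) \<and>
     (\<forall>R. \<exists>K\<ge>0. \<forall>r\<in>{0..R}. \<forall>x. norm (P r x) \<le> K * norm x) \<and>
     (\<forall>x. continuous_on {0..} (\<lambda>r. P r x))"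

lemma bounded_operator_familyD:
  assumes "bounded_operator_family P"
  shows "r \<ge> 0 \<Longrightarrow> bounded_linear (P r)"
    "\<exists>K\<ge>0. \<forall>r\<in>{0..R}. \<forall>x. norm (P r x) \<le> K * norm x"
    "continuous_on {0..} (\<lambda>r. P r x)"
  using assms by (auto simp: bounded_operator_family_def)

text \<open>Along a sequence of pairs, the vector is split into its limit \<open>x\<close>, handled
  by strong continuity, and a remainder tending to 0, handled by the local bound. Only
  \<open>r > 0\<close> has a full neighbourhood of admissible times.\<close>

lemma bounded_operator_family_isCont:
  assumes P: "bounded_operator_family P" and r: "r > 0"
  shows "isCont (\<lambda>(r, x). P r x) (r, x)"
  unfolding continuous_at_sequentially
proof (intro allI impI)
  fix z :: "nat \<Rightarrow> real \<times> 'a" assume z: "z \<longlonglongrightarrow> (r, x)"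
  obtain K where K0: "K \<ge> 0" and K: "\<And>s y. 0 \<le> s \<Longrightarrow> s \<le> r + 1 \<Longrightarrow> norm (P s y) \<le> K * norm y"
    using bounded_operator_familyD(2)[OF P, of "r + 1"] by fastforce
  have f: "(\<lambda>n. fst (z n)) \<longlonglongrightarrow> r" and s: "(\<lambda>n. snd (z n)) \<longlonglongrightarrow> x"
    using tendsto_fst[OF z] tendsto_snd[OF z] by simp_all
  have ev: "\<forall>\<^sub>F n in sequentially. 0 < fst (z n) \<and> fst (z n) < r + 1"
    using order_tendstoD(1)[OF f r] order_tendstoD(2)[OF f, of "r + 1"] by (auto elim: eventually_elim2)
  have "continuous_on {0<..} (\<lambda>r. P r x)"
    using bounded_operator_familyD(3)[OF P] by (rule continuous_on_subset) auto
  then have "isCont (\<lambda>r. P r x) r" using r by (simp add: continuous_on_eq_continuous_at)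
  then have "(\<lambda>n. P (fst (z n)) x) \<longlonglongrightarrow> P r x" using f by (rule isCont_tendsto_compose)
  moreover have "(\<lambda>n. P (fst (z n)) (snd (z n) - x)) \<longlonglongrightarrow> 0"
  proof (rule Lim_null_comparison)
    show "\<forall>\<^sub>F n in sequentially. norm (P (fst (z n)) (snd (z n) - x)) \<le> K * norm (snd (z n) - x)"
      using ev by eventually_elim (use K in auto)
    have "(\<lambda>n. K * norm (snd (z n) - x)) \<longlonglongrightarrow> K * norm (x - x)" by (intro tendsto_intros s)
    then show "(\<lambda>n. K * norm (snd (z n) - x)) \<longlonglongrightarrow> 0" by simp
  qed
  ultimately have "(\<lambda>n. P (fst (z n)) x + P (fst (z n)) (snd (z n) - x)) \<longlonglongrightarrow> P r x + 0"
    by (rule tendsto_add)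
  moreover have "\<forall>\<^sub>F n in sequentially. P (fst (z n)) x + P (fst (z n)) (snd (z n) - x) = P (fst (z n)) (snd (z n))"
    using ev
  proof eventually_elim
    case (elim n)
    have "bounded_linear (P (fst (z n)))" using bounded_operator_familyD(1)[OF P] elim by simp
    then show ?case by (simp add: linear_simps(2))
  qed
  ultimately have "(\<lambda>n. P (fst (z n)) (snd (z n))) \<longlonglongrightarrow> P r x"
    using Lim_transform_eventually by force
  then show "((\<lambda>(r, x). P r x) \<circ> z) \<longlonglongrightarrow> (case (r, x) of (r, x) \<Rightarrow> P r x)"
    by (simp add: o_def case_prod_unfold)
qed

lemma C0_semigroup_family:
  fixes S :: "real \<Rightarrow> 'h::banach \<Rightarrow> 'h"
  assumes S: "C0_semigroup S"
  shows "bounded_operator_family S"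
  unfolding bounded_operator_family_def
proof (intro conjI allI impI)
  fix R
  obtain K where "K \<ge> 1" "\<And>r x. 0 \<le> r \<Longrightarrow> r \<le> R \<Longrightarrow> norm (S r x) \<le> K * norm x"
    using C0_semigroup_bounded_on[OF S, of R] by blast
  then show "\<exists>K\<ge>0. \<forall>r\<in>{0..R}. \<forall>x. norm (S r x) \<le> K * norm x" by (intro exI[of _ K]) auto
qed (use C0_semigroupD(1)[OF S] C0_semigroup_continuous[OF S] in auto)

section \<open>Weighted integrals of semigroup orbits\<close>

text \<open>Common form of \<open>frac_S\<close> and \<open>frac_P\<close> for \<alpha> < 1, with
  \<rho> standing for \<open>r powr \<alpha>\<close>.\<close>

definition orbit_integral :: "(real \<Rightarrow> real) \<Rightarrow> (real \<Rightarrow> 'h::real_normed_vector \<Rightarrow> 'h) \<Rightarrow> real \<Rightarrow> 'h \<Rightarrow> 'h" where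
  "orbit_integral w S \<rho> x = bochner_integral {0..} (\<lambda>\<theta>. w \<theta> *\<^sub>R S (\<rho> * \<theta>) x)"

text \<open>The decay holds for every rate \<open>c\<close>: over \<rho> \<le> \<open>R\<close> an
  orbit may grow like \<open>exp (\<omega> * R * \<theta>)\<close> with no restriction on \<omega>
  or \<open>R\<close>.\<close>

locale exponential_weight =
  fixes w :: "real \<Rightarrow> real"
  assumes isCont_weight: "isCont w \<theta>"
    and weight_decay: "\<exists>C. \<forall>\<theta>\<ge>0. \<bar>w \<theta>\<bar> \<le> C * exp (- c * \<theta>)"
begin

text \<open>One majorant, uniform over \<rho> \<le> \<open>R\<close>, serves integrability, the
  operator bound and dominated convergence in \<rho>.\<close>

lemma orbit_bound:
  fixes S :: "real \<Rightarrow> 'h::{real_inner, banach} \<Rightarrow> 'h"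
  assumes S: "C0_semigroup S"
  obtains K where "K \<ge> 0"
    "\<And>\<rho> \<theta> x. 0 \<le> \<rho> \<Longrightarrow> \<rho> \<le> R \<Longrightarrow> 0 \<le> \<theta> \<Longrightarrow> norm (w \<theta> *\<^sub>R S (\<rho> * \<theta>) x) \<le> K * norm x * exp (- \<theta>)"
proof -
  obtain M \<omega> where M: "M \<ge> 1" "\<omega> \<ge> 0" "\<And>r x. 0 \<le> r \<Longrightarrow> norm (S r x) \<le> M * exp (\<omega> * r) * norm x"
    using C0_semigroup_growth[OF S] by blast
  \<comment> \<open>The part \<open>\<omega> * R\<close> of the rate cancels the growth of the
    orbit; the extra 1 leaves \<open>exp (- \<theta>)\<close>.\<close>
  obtain C where C: "\<And>\<theta>. \<theta> \<ge> 0 \<Longrightarrow> \<bar>w \<theta>\<bar> \<le> C * exp (- (\<omega> * R + 1) * \<theta>)"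
    using weight_decay by blast
  have C0: "C \<ge> 0" using C[of 0] by simp
  have "norm (w \<theta> *\<^sub>R S (\<rho> * \<theta>) x) \<le> (C * M) * norm x * exp (- \<theta>)"
    if "0 \<le> \<rho>" "\<rho> \<le> R" "0 \<le> \<theta>" for \<rho> \<theta> x
  proof -
    have "norm (S (\<rho> * \<theta>) x) \<le> M * exp (\<omega> * (\<rho> * \<theta>)) * norm x" using M(3) that by simp
    also have "\<dots> \<le> M * exp (\<omega> * (R * \<theta>)) * norm x"
    proof -
      have "\<omega> * (\<rho> * \<theta>) \<le> \<omega> * (R * \<theta>)"
        by (intro mult_left_mono mult_right_mono that M)
      then show ?thesis using M(1) by (simp add: mult_right_mono)
    qed
    finally have "\<bar>w \<theta>\<bar> * norm (S (\<rho> * \<theta>) x)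
        \<le> (C * exp (- (\<omega> * R + 1) * \<theta>)) * (M * exp (\<omega> * (R * \<theta>)) * norm x)"
      using C[OF that(3)] C0 by (intro mult_mono) auto
    also have "\<dots> = (C * M) * norm x * (exp (- (\<omega> * R + 1) * \<theta>) * exp (\<omega> * (R * \<theta>)))" by simp
    also have "exp (- (\<omega> * R + 1) * \<theta>) * exp (\<omega> * (R * \<theta>)) = exp (- \<theta>)"
      by (simp add: exp_add[symmetric] algebra_simps)
    finally show ?thesis by simp
  qed
  moreover have "C * M \<ge> 0" using C0 M by simp
  ultimately show ?thesis using that by blast
qed

lemma orbit_measurable:
  fixes S :: "real \<Rightarrow> 'h::{real_inner, banach} \<Rightarrow> 'h"
  assumes S: "C0_semigroup S" and \<rho>: "\<rho> \<ge> 0"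
  shows "strongly_measurable_on {0..} (\<lambda>\<theta>. w \<theta> *\<^sub>R S (\<rho> * \<theta>) x)"
proof (rule strongly_measurable_AE_continuous)
  have "isCont (\<lambda>\<theta>. w \<theta> *\<^sub>R S (\<rho> * \<theta>) x) \<theta>" if "\<theta> > 0" for \<theta>
  proof -
    have "continuous_on {0<..} (\<lambda>\<theta>. S (\<rho> * \<theta>) x)"
      by (rule continuous_on_compose2[OF C0_semigroup_continuous[OF S]])
         (use \<rho> in \<open>auto intro!: continuous_intros\<close>)
    then have "isCont (\<lambda>\<theta>. S (\<rho> * \<theta>) x) \<theta>" using that by (simp add: continuous_on_eq_continuous_at)
    then show ?thesis by (intro continuous_scaleR isCont_weight)
  qed
  \<comment> \<open>Semigroup laws constrain \<open>S\<close> only at nonnegative times, so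
    two-sided continuity may fail at 0; that point is null.\<close>
  moreover have "AE \<theta> in lebesgue_on {0..}. \<theta> \<noteq> (0::real)"
    using AE_lebesgue_on_notin_finite[of "{0}" "{0..}"] by simp
  moreover have "AE \<theta> in lebesgue_on {0::real..}. \<theta> \<in> {0..}"
    using AE_space[of "lebesgue_on {0::real..}"] by simp
  ultimately show "AE \<theta> in lebesgue_on {0..}. isCont (\<lambda>\<theta>. w \<theta> *\<^sub>R S (\<rho> * \<theta>) x) \<theta>"
    by (auto elim!: eventually_elim2 simp: less_le)
qed simp

lemma orbit_integrable:
  fixes S :: "real \<Rightarrow> 'h::{real_inner, banach} \<Rightarrow> 'h"
  assumes S: "C0_semigroup S" and \<rho>: "\<rho> \<ge> 0"
  shows "(\<lambda>\<theta>. w \<theta> *\<^sub>R S (\<rho> * \<theta>) x) bochner_integrable_on {0..}"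
proof -
  obtain K where K: "\<And>\<rho>' \<theta> x. 0 \<le> \<rho>' \<Longrightarrow> \<rho>' \<le> \<rho> \<Longrightarrow> 0 \<le> \<theta> \<Longrightarrow>
      norm (w \<theta> *\<^sub>R S (\<rho>' * \<theta>) x) \<le> K * norm x * exp (- \<theta>)"
    using orbit_bound[OF S] by metis
  show ?thesis
  proof (rule bochner_integrable_onI[OF _ orbit_measurable[OF S \<rho>]])
    show "integrable (lebesgue_on {0..}) (\<lambda>\<theta>. K * norm x * exp (- \<theta>))"
      using integrable_exp_minus by simp
    show "AE s in lebesgue_on {0..}. norm (w s *\<^sub>R S (\<rho> * s) x) \<le> K * norm x * exp (- s)"
      using K[OF \<rho> order_refl] by (intro AE_I2) auto
  qed simp
qed

lemmas weighted_inner = bochner_integral_inner(2)[OF _ orbit_integrable, folded orbit_integral_def]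

lemma weighted_orbit_norm_le:
  fixes S :: "real \<Rightarrow> 'h::{real_inner, banach} \<Rightarrow> 'h"
  assumes S: "C0_semigroup S"
  obtains K where "K \<ge> 0" "\<And>\<rho> x. 0 \<le> \<rho> \<Longrightarrow> \<rho> \<le> R \<Longrightarrow> norm (orbit_integral w S \<rho> x) \<le> K * norm x"
proof -
  obtain K where K0: "K \<ge> 0" and K: "\<And>\<rho> \<theta> x. 0 \<le> \<rho> \<Longrightarrow> \<rho> \<le> R \<Longrightarrow> 0 \<le> \<theta> \<Longrightarrow>
      norm (w \<theta> *\<^sub>R S (\<rho> * \<theta>) x) \<le> K * norm x * exp (- \<theta>)"
    using orbit_bound[OF S] by metis
  define I where "I = (\<integral>\<theta>. exp (- \<theta>) \<partial>lebesgue_on {0::real..})"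
  have I: "I \<ge> 0" unfolding I_def by simp
  have "norm (orbit_integral w S \<rho> x) \<le> (K * I) * norm x" if "0 \<le> \<rho>" "\<rho> \<le> R" for \<rho> x
  proof -
    have "norm (orbit_integral w S \<rho> x) \<le> (\<integral>\<theta>. norm (w \<theta> *\<^sub>R S (\<rho> * \<theta>) x) \<partial>lebesgue_on {0..})"
      unfolding orbit_integral_def
      using orbit_integrable[OF S that(1)] by (intro norm_bochner_integral_le) auto
    also have "\<dots> \<le> (\<integral>\<theta>. K * norm x * exp (- \<theta>) \<partial>lebesgue_on {0..})"
      using K[OF that] integrable_exp_minus bochner_integrable_norm[OF _ orbit_integrable[OF S that(1)]]
      by (intro integral_mono) auto
    also have "\<dots> = (K * I) * norm x" by (simp add: I_def)
    finally show ?thesis .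
  qed
  moreover have "K * I \<ge> 0" using K0 I by simp
  ultimately show ?thesis using that by blast
qed

lemma weighted_orbit_bounded_linear:
  fixes S :: "real \<Rightarrow> 'h::{real_inner, banach} \<Rightarrow> 'h"
  assumes S: "C0_semigroup S" and \<rho>: "\<rho> \<ge> 0"
  shows "bounded_linear (orbit_integral w S \<rho>)"
proof -
  obtain K where K: "\<And>\<rho>' x. 0 \<le> \<rho>' \<Longrightarrow> \<rho>' \<le> \<rho> \<Longrightarrow> norm (orbit_integral w S \<rho>' x) \<le> K * norm x"
    using weighted_orbit_norm_le[OF S] by metis
  note int = bochner_integral_inner(1)[OF _ orbit_integrable[OF S \<rho>]]
  note lin = linear_simps[OF C0_semigroupD(1)[OF S]]
  show ?thesis
  proof (rule bounded_linear_intro)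
    fix x y and c :: real
    have "orbit_integral w S \<rho> (x + y) \<bullet> z
        = (orbit_integral w S \<rho> x + orbit_integral w S \<rho> y) \<bullet> z" for z
    proof -
      have "(\<integral>\<theta>. w \<theta> *\<^sub>R S (\<rho> * \<theta>) (x + y) \<bullet> z \<partial>lebesgue_on {0..})
          = (\<integral>\<theta>. w \<theta> *\<^sub>R S (\<rho> * \<theta>) x \<bullet> z + w \<theta> *\<^sub>R S (\<rho> * \<theta>) y \<bullet> z \<partial>lebesgue_on {0..})"
        using \<rho> by (intro Bochner_Integration.integral_cong) (auto simp: lin algebra_simps)
      also have "\<dots> = (\<integral>\<theta>. w \<theta> *\<^sub>R S (\<rho> * \<theta>) x \<bullet> z \<partial>lebesgue_on {0..}) + (\<integral>\<theta>. w \<theta> *\<^sub>R S (\<rho> * \<theta>) y \<bullet> z \<partial>lebesgue_on {0..})"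
        by (intro Bochner_Integration.integral_add int) auto
      finally show ?thesis by (simp add: weighted_inner[OF _ S \<rho>] inner_add_left)
    qed
    then show "orbit_integral w S \<rho> (x + y) = orbit_integral w S \<rho> x + orbit_integral w S \<rho> y"
      by (metis vector_eq_rdot)
    have "orbit_integral w S \<rho> (c *\<^sub>R x) \<bullet> z = (c *\<^sub>R orbit_integral w S \<rho> x) \<bullet> z" for z
    proof -
      have "(\<integral>\<theta>. w \<theta> *\<^sub>R S (\<rho> * \<theta>) (c *\<^sub>R x) \<bullet> z \<partial>lebesgue_on {0..})
          = (\<integral>\<theta>. c * (w \<theta> *\<^sub>R S (\<rho> * \<theta>) x \<bullet> z) \<partial>lebesgue_on {0..})"
        using \<rho> by (intro Bochner_Integration.integral_cong) (auto simp: lin)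
      then show ?thesis by (simp add: weighted_inner[OF _ S \<rho>])
    qed
    then show "orbit_integral w S \<rho> (c *\<^sub>R x) = c *\<^sub>R orbit_integral w S \<rho> x"
      by (metis vector_eq_rdot)
    show "norm (orbit_integral w S \<rho> x) \<le> norm x * K"
      using K[OF \<rho> order_refl] by (simp add: mult.commute)
  qed
qed

text \<open>The weight is real, so taking adjoints only replaces the semigroup. Continuity of the
  adjoint operators thereby reduces to the continuity result for \<open>orbit_integral\<close>,
  applied to the adjoint semigroup.\<close>

lemma weighted_orbit_adjoint:
  fixes S :: "real \<Rightarrow> 'h::{real_inner, banach} \<Rightarrow> 'h"
  assumes S: "C0_semigroup S" and \<rho>: "\<rho> \<ge> 0"
  shows "adjoint (orbit_integral w S \<rho>) = orbit_integral w (\<lambda>r. adjoint (S r)) \<rho>"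
proof (rule adjoint_unique, intro allI)
  fix x y :: 'h
  have "orbit_integral w S \<rho> x \<bullet> y = (\<integral>\<theta>. w \<theta> *\<^sub>R S (\<rho> * \<theta>) x \<bullet> y \<partial>lebesgue_on {0..})"
    using weighted_inner[OF _ S \<rho>] by simp
  also have "\<dots> = (\<integral>\<theta>. w \<theta> *\<^sub>R adjoint (S (\<rho> * \<theta>)) y \<bullet> x \<partial>lebesgue_on {0..})"
    using \<rho> adjoint_bounded[OF C0_semigroupD(1)[OF S]]
    by (intro Bochner_Integration.integral_cong) (auto simp: inner_commute)
  also have "\<dots> = orbit_integral w (\<lambda>r. adjoint (S r)) \<rho> y \<bullet> x"
    using weighted_inner[OF _ adjoint_C0_semigroup[OF S] \<rho>] by simp
  finally show "orbit_integral w S \<rho> x \<bullet> y = x \<bullet> orbit_integral w (\<lambda>r. adjoint (S r)) \<rho> y"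
    by (simp add: inner_commute)
qed

lemma weighted_orbit_continuous:
  fixes S :: "real \<Rightarrow> 'h::{real_inner, banach} \<Rightarrow> 'h"
  assumes S: "C0_semigroup S"
  shows "continuous_on {0..} (\<lambda>\<rho>. orbit_integral w S \<rho> x)"
  unfolding continuous_on_sequentially
proof (intro allI ballI impI)
  fix f \<rho> assume "\<rho> \<in> {0::real..}" and "(\<forall>n. f n \<in> {0..}) \<and> f \<longlonglongrightarrow> \<rho>"
  then have \<rho>: "\<rho> \<ge> 0" and f0: "\<And>n. f n \<ge> 0" and f: "f \<longlonglongrightarrow> \<rho>" by auto
  let ?M = "lebesgue_on {0::real..}"
  obtain R where R: "\<And>n. f n \<le> R"
  proof -
    have "Bseq f" using f convergent_imp_Bseq convergentI by blast
    then obtain B where "\<And>n. norm (f n) \<le> B" by (auto simp: Bseq_def)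
    then show ?thesis using that[of B] abs_le_D1 by force
  qed
  have \<rho>R: "\<rho> \<le> R" using f R LIMSEQ_le_const2 by blast
  obtain K where K: "\<And>\<rho> \<theta> x. 0 \<le> \<rho> \<Longrightarrow> \<rho> \<le> R \<Longrightarrow> 0 \<le> \<theta> \<Longrightarrow>
      norm (w \<theta> *\<^sub>R S (\<rho> * \<theta>) x) \<le> K * norm x * exp (- \<theta>)"
    using orbit_bound[OF S] by metis
  define g where "g \<sigma> \<theta> = w \<theta> *\<^sub>R S (\<sigma> * \<theta>) x" for \<sigma> \<theta>
  have gi: "g \<sigma> bochner_integrable_on {0..}" if "\<sigma> \<ge> 0" for \<sigma>
    using orbit_integrable[OF S that] by (simp add: g_def[abs_def])
  have gK: "norm (g \<sigma> \<theta>) \<le> K * norm x * exp (- \<theta>)" if "0 \<le> \<sigma>" "\<sigma> \<le> R" "0 \<le> \<theta>" for \<sigma> \<theta>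
    unfolding g_def by (rule K[OF that])
  have gd: "(\<lambda>\<theta>. g (f n) \<theta> - g \<rho> \<theta>) bochner_integrable_on {0..}" for n
  proof (rule bochner_integrable_onI[where g="\<lambda>\<theta>. 2 * (K * norm x * exp (- \<theta>))"])
    show "strongly_measurable_on {0..} (\<lambda>\<theta>. g (f n) \<theta> - g \<rho> \<theta>)"
      using gi[OF f0] gi[OF \<rho>] by (intro strongly_measurable_diff) (auto simp: bochner_integrable_on_def)
    show "integrable ?M (\<lambda>\<theta>. 2 * (K * norm x * exp (- \<theta>)))" using integrable_exp_minus by simp
    show "AE \<theta> in ?M. norm (g (f n) \<theta> - g \<rho> \<theta>) \<le> 2 * (K * norm x * exp (- \<theta>))"
    proof (rule AE_I2)
      fix \<theta> assume "\<theta> \<in> space ?M"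
      then have "\<theta> \<ge> 0" by simp
      then show "norm (g (f n) \<theta> - g \<rho> \<theta>) \<le> 2 * (K * norm x * exp (- \<theta>))"
        using gK[OF f0[of n] R[of n], of \<theta>] gK[OF \<rho> \<rho>R, of \<theta>] norm_triangle_ineq4[of "g (f n) \<theta>" "g \<rho> \<theta>"] by linarith
    qed
  qed simp
  \<comment> \<open>Dominated convergence is applied to the real function of norms; the norm bound
    for the Bochner integral transfers the result to vectors.\<close>
  have "(\<lambda>n. \<integral>\<theta>. norm (g (f n) \<theta> - g \<rho> \<theta>) \<partial>?M) \<longlonglongrightarrow> (\<integral>\<theta>. 0 \<partial>?M)"
  proof (rule integral_dominated_convergence[where w="\<lambda>\<theta>. 2 * (K * norm x * exp (- \<theta>))"])
    show "(\<lambda>\<theta>. norm (g (f n) \<theta> - g \<rho> \<theta>)) \<in> borel_measurable ?M" for n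
      using bochner_integrable_norm[OF _ gd] by (intro borel_measurable_integrable) simp
    show "integrable ?M (\<lambda>\<theta>. 2 * (K * norm x * exp (- \<theta>)))" using integrable_exp_minus by simp
    show "AE \<theta> in ?M. (\<lambda>n. norm (g (f n) \<theta> - g \<rho> \<theta>)) \<longlonglongrightarrow> 0"
    proof (rule AE_I2)
      fix \<theta> assume "\<theta> \<in> space ?M"
      then have \<theta>: "\<theta> \<ge> 0" by simp
      have "continuous (at (\<rho> * \<theta>) within {0..}) (\<lambda>r. S r x)"
        using C0_semigroup_continuous[OF S] \<rho> \<theta> by (auto simp: continuous_on_eq_continuous_within)
      moreover have "(\<lambda>n. f n * \<theta>) \<longlonglongrightarrow> \<rho> * \<theta>" by (intro tendsto_intros f)
      ultimately have "(\<lambda>n. S (f n * \<theta>) x) \<longlonglongrightarrow> S (\<rho> * \<theta>) x"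
        using continuous_within_tendsto_compose'[of "\<rho> * \<theta>" "{0..}" "\<lambda>r. S r x" "\<lambda>n. f n * \<theta>"] f0 \<theta> by simp
      then have "(\<lambda>n. norm (g (f n) \<theta> - g \<rho> \<theta>)) \<longlonglongrightarrow> norm (g \<rho> \<theta> - g \<rho> \<theta>)"
        unfolding g_def by (intro tendsto_intros)
      then show "(\<lambda>n. norm (g (f n) \<theta> - g \<rho> \<theta>)) \<longlonglongrightarrow> 0" by simp
    qed
    show "AE \<theta> in ?M. norm (norm (g (f n) \<theta> - g \<rho> \<theta>)) \<le> 2 * (K * norm x * exp (- \<theta>))" for n
    proof (rule AE_I2)
      fix \<theta> assume "\<theta> \<in> space ?M"
      then have "\<theta> \<ge> 0" by simp
      then show "norm (norm (g (f n) \<theta> - g \<rho> \<theta>)) \<le> 2 * (K * norm x * exp (- \<theta>))"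
        using gK[OF f0[of n] R[of n], of \<theta>] gK[OF \<rho> \<rho>R, of \<theta>] norm_triangle_ineq4[of "g (f n) \<theta>" "g \<rho> \<theta>"] by simp
    qed
  qed auto
  then have lim0: "(\<lambda>n. \<integral>\<theta>. norm (g (f n) \<theta> - g \<rho> \<theta>) \<partial>?M) \<longlonglongrightarrow> 0" by simp
  have le: "norm (orbit_integral w S (f n) x - orbit_integral w S \<rho> x)
      \<le> (\<integral>\<theta>. norm (g (f n) \<theta> - g \<rho> \<theta>) \<partial>?M)" for n
  proof -
    have "bochner_integral {0..} (\<lambda>\<theta>. g (f n) \<theta> - g \<rho> \<theta>)
        = orbit_integral w S (f n) x - orbit_integral w S \<rho> x"
    proof (rule bochner_integral_eqI[OF _ gd])
      fix z
      have "(\<integral>\<theta>. (g (f n) \<theta> - g \<rho> \<theta>) \<bullet> z \<partial>?M) = (\<integral>\<theta>. g (f n) \<theta> \<bullet> z \<partial>?M) - (\<integral>\<theta>. g \<rho> \<theta> \<bullet> z \<partial>?M)"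
        unfolding inner_diff_left
        by (intro Bochner_Integration.integral_diff bochner_integral_inner(1) gi f0 \<rho>) auto
      also have "\<dots> = (orbit_integral w S (f n) x - orbit_integral w S \<rho> x) \<bullet> z"
        by (simp add: weighted_inner[OF _ S] f0 \<rho> g_def inner_diff_left)
      finally show "(\<integral>\<theta>. (g (f n) \<theta> - g \<rho> \<theta>) \<bullet> z \<partial>?M)
        = (orbit_integral w S (f n) x - orbit_integral w S \<rho> x) \<bullet> z" .
    qed simp
    then show ?thesis using norm_bochner_integral_le[OF _ gd[of n]] by simp
  qed
  have "(\<lambda>n. orbit_integral w S (f n) x - orbit_integral w S \<rho> x) \<longlonglongrightarrow> 0"
    by (rule Lim_null_comparison[OF _ lim0]) (use le in auto)
  then show "((\<lambda>\<rho>. orbit_integral w S \<rho> x) \<circ> f) \<longlonglongrightarrow> orbit_integral w S \<rho> x"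
    by (simp add: o_def LIM_zero_iff)
qed

lemma weighted_orbit_family:
  fixes S :: "real \<Rightarrow> 'h::{real_inner, banach} \<Rightarrow> 'h"
  assumes S: "C0_semigroup S" and a: "a > 0"
  shows "bounded_operator_family (\<lambda>r. orbit_integral w S (r powr a))"
  unfolding bounded_operator_family_def
proof (intro conjI allI impI)
  show "bounded_linear (orbit_integral w S (r powr a))" for r
    by (rule weighted_orbit_bounded_linear[OF S]) simp
  show "\<exists>K\<ge>0. \<forall>r\<in>{0..R}. \<forall>x. norm (orbit_integral w S (r powr a) x) \<le> K * norm x" for R
  proof -
    obtain K where "K \<ge> 0" and K: "\<And>\<rho> x. 0 \<le> \<rho> \<Longrightarrow> \<rho> \<le> R powr a \<Longrightarrow>
        norm (orbit_integral w S \<rho> x) \<le> K * norm x"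
      using weighted_orbit_norm_le[OF S] by metis
    moreover have "r powr a \<le> R powr a" if "r \<in> {0..R}" for r
      using that a by (intro powr_mono2) auto
    ultimately show ?thesis by (intro exI[of _ K]) auto
  qed
  show "continuous_on {0..} (\<lambda>r. orbit_integral w S (r powr a) x)" for x
  proof (rule continuous_on_compose2[OF weighted_orbit_continuous[OF S]])
    show "continuous_on {0..} (\<lambda>r::real. r powr a)"
      using a by (intro continuous_on_powr' continuous_intros) auto
  qed auto
qed

end

lemma exponential_weight_wright:
  assumes "0 < a" "a < 1"
  shows "exponential_weight (wright a)"
proof
  show "isCont (wright a) \<theta>" for \<theta> by (rule isCont_wright[OF assms])
  show "\<exists>C. \<forall>\<theta>\<ge>0. \<bar>wright a \<theta>\<bar> \<le> C * exp (- c * \<theta>)" for c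
    using wright_decay[OF assms, of c] by metis
qed

lemma exponential_weight_times:
  assumes "exponential_weight w"
  shows "exponential_weight (\<lambda>\<theta>. k * \<theta> * w \<theta>)"
proof
  interpret exponential_weight w by fact
  show "isCont (\<lambda>\<theta>. k * \<theta> * w \<theta>) \<theta>" for \<theta> using isCont_weight by (intro continuous_intros)
  show "\<exists>C. \<forall>\<theta>\<ge>0. \<bar>k * \<theta> * w \<theta>\<bar> \<le> C * exp (- c * \<theta>)" for c
  proof -
    \<comment> \<open>One unit of the rate is spent on the factor \<theta>, which is at most
      \<open>exp \<theta>\<close>.\<close>
    obtain C where C: "\<And>\<theta>. \<theta> \<ge> 0 \<Longrightarrow> \<bar>w \<theta>\<bar> \<le> C * exp (- (c + 1) * \<theta>)" using weight_decay by blast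
    have "\<bar>k * \<theta> * w \<theta>\<bar> \<le> (\<bar>k\<bar> * C) * exp (- c * \<theta>)" if \<theta>: "\<theta> \<ge> 0" for \<theta>
    proof -
      have "\<bar>k * \<theta> * w \<theta>\<bar> = \<bar>k\<bar> * (\<theta> * \<bar>w \<theta>\<bar>)" using \<theta> by (simp add: abs_mult)
      also have "\<theta> * \<bar>w \<theta>\<bar> \<le> exp \<theta> * (C * exp (- (c + 1) * \<theta>))"
      proof (rule mult_mono)
        show "\<theta> \<le> exp \<theta>" using exp_ge_add_one_self[of \<theta>] by linarith
      qed (use C[OF \<theta>] in auto)
      also have "\<dots> = C * exp (- c * \<theta>)" by (simp add: exp_add[symmetric] algebra_simps)
      finally show ?thesis by (simp add: mult_left_mono mult.assoc)
    qed
    then show ?thesis by blast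
  qed
qed

section \<open>The fractional operators and their adjoints as bounded families\<close>

context
  fixes S :: "real \<Rightarrow> 'h::{real_inner, banach} \<Rightarrow> 'h" and \<alpha> :: real
  assumes S: "C0_semigroup S" and \<alpha>: "0 < \<alpha>" "\<alpha> \<le> 1"
begin

lemma frac_family:
  "bounded_operator_family (frac_S \<alpha> S)" "bounded_operator_family (frac_P \<alpha> S)"
proof -
  have "frac_S \<alpha> S = (if \<alpha> = 1 then S else (\<lambda>r. orbit_integral (wright \<alpha>) S (r powr \<alpha>)))"
    "frac_P \<alpha> S = (if \<alpha> = 1 then S else (\<lambda>r. orbit_integral (\<lambda>\<theta>. \<alpha> * \<theta> * wright \<alpha> \<theta>) S (r powr \<alpha>)))"
    by (auto simp: frac_S_def frac_P_def orbit_integral_def fun_eq_iff)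
  moreover have "exponential_weight (wright \<alpha>)" "exponential_weight (\<lambda>\<theta>. \<alpha> * \<theta> * wright \<alpha> \<theta>)" if "\<alpha> \<noteq> 1"
    using exponential_weight_wright exponential_weight_times that \<alpha> by auto
  ultimately show "bounded_operator_family (frac_S \<alpha> S)" "bounded_operator_family (frac_P \<alpha> S)"
    using C0_semigroup_family[OF S] exponential_weight.weighted_orbit_family[OF _ S \<alpha>(1)] by auto
qed

lemma adjoint_frac_P:
  assumes r: "r \<ge> 0"
  shows "adjoint (frac_P \<alpha> S r) = frac_P \<alpha> (\<lambda>r. adjoint (S r)) r"
proof -
  have "frac_P \<alpha> T r = (if \<alpha> = 1 then T r else orbit_integral (\<lambda>\<theta>. \<alpha> * \<theta> * wright \<alpha> \<theta>) T (r powr \<alpha>))"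
    for T :: "real \<Rightarrow> 'h \<Rightarrow> 'h"
    by (auto simp: frac_P_def orbit_integral_def fun_eq_iff)
  moreover have "exponential_weight (\<lambda>\<theta>. \<alpha> * \<theta> * wright \<alpha> \<theta>)" if "\<alpha> \<noteq> 1"
    using exponential_weight_wright exponential_weight_times that \<alpha> by auto
  ultimately show ?thesis
    using exponential_weight.weighted_orbit_adjoint[OF _ S, of _ "r powr \<alpha>"] by auto
qed

end

lemma bounded_operator_family_cong:
  assumes "bounded_operator_family P" "\<And>r. r \<ge> 0 \<Longrightarrow> P r = Q r"
  shows "bounded_operator_family Q"
  unfolding bounded_operator_family_def
proof (intro conjI allI impI)
  show "bounded_linear (Q r)" if "r \<ge> 0" for r
    using bounded_operator_familyD(1)[OF assms(1) that] assms(2)[OF that] by simp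
  show "\<exists>K\<ge>0. \<forall>r\<in>{0..R}. \<forall>x. norm (Q r x) \<le> K * norm x" for R
    using bounded_operator_familyD(2)[OF assms(1), of R] assms(2) by fastforce
  show "continuous_on {0..} (\<lambda>r. Q r x)" for x
    using bounded_operator_familyD(3)[OF assms(1), of x] assms(2)
    by (metis (no_types, lifting) atLeast_iff continuous_on_cong)
qed

text \<open>The norm continuity in time obtained here is what makes the adjoint control strongly
  measurable, in \<open>control_adj_isCont\<close>.\<close>

lemma adjoint_frac_P_family:
  fixes S :: "real \<Rightarrow> 'h::{real_inner, banach} \<Rightarrow> 'h"
  assumes "C0_semigroup S" "0 < \<alpha>" "\<alpha> \<le> 1"
  shows "bounded_operator_family (\<lambda>r. adjoint (frac_P \<alpha> S r))"
  using frac_family(2)[OF adjoint_C0_semigroup[OF assms(1)] assms(2,3)]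
  by (rule bounded_operator_family_cong) (simp add: adjoint_frac_P[OF assms])

section \<open>Square integrable controls\<close>

lemma L2_on_iff:
  assumes I: "I \<in> sets lebesgue"
  shows "u \<in> L2_on I \<longleftrightarrow> strongly_measurable_on I u \<and> integrable (lebesgue_on I) (\<lambda>s. (norm (u s))\<^sup>2)"
proof -
  have "(\<lambda>s. (norm (u s))\<^sup>2) \<in> borel_measurable (lebesgue_on I)" if "strongly_measurable_on I u"
    using strongly_measurable_norm[OF that] strongly_measurable_real_iff[OF I]
    by (intro borel_measurable_power) blast
  then show ?thesis unfolding L2_on_def integrable_iff_bounded by auto
qed

lemma L2_on_inner_integrable:
  fixes u v :: "real \<Rightarrow> 'a::real_inner"
  assumes I: "I \<in> sets lebesgue" and u: "u \<in> L2_on I" and v: "v \<in> L2_on I"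
  shows "integrable (lebesgue_on I) (\<lambda>s. u s \<bullet> v s)"
proof (rule Bochner_Integration.integrable_bound)
  show "integrable (lebesgue_on I) (\<lambda>s. (norm (u s))\<^sup>2 + (norm (v s))\<^sup>2)"
    using u v by (intro Bochner_Integration.integrable_add) (auto simp: L2_on_iff[OF I])
  have "strongly_measurable_on I (\<lambda>s. u s \<bullet> v s)"
    using u v by (intro strongly_measurable_inner) (auto simp: L2_on_iff[OF I])
  then show "(\<lambda>s. u s \<bullet> v s) \<in> borel_measurable (lebesgue_on I)"
    by (simp add: strongly_measurable_real_iff[OF I])
  have "\<bar>u s \<bullet> v s\<bar> \<le> (norm (u s))\<^sup>2 + (norm (v s))\<^sup>2" for s
  proof -
    have "\<bar>u s \<bullet> v s\<bar> \<le> norm (u s) * norm (v s)" by (rule Cauchy_Schwarz_ineq2)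
    moreover have "2 * (norm (u s) * norm (v s)) \<le> (norm (u s))\<^sup>2 + (norm (v s))\<^sup>2"
      using sum_squares_bound[of "norm (u s)" "norm (v s)"] by (simp add: mult.assoc)
    moreover have "0 \<le> norm (u s) * norm (v s)" by simp
    ultimately show ?thesis by linarith
  qed
  then show "AE s in lebesgue_on I. norm (u s \<bullet> v s) \<le> norm ((norm (u s))\<^sup>2 + (norm (v s))\<^sup>2)"
    by simp
qed

lemma L2_on_add:
  fixes u v :: "real \<Rightarrow> 'a::real_inner"
  assumes I: "I \<in> sets lebesgue" and u: "u \<in> L2_on I" and v: "v \<in> L2_on I"
  shows "(\<lambda>s. u s + v s) \<in> L2_on I"
proof -
  have "(norm (u s + v s))\<^sup>2 = (norm (u s))\<^sup>2 + 2 * (u s \<bullet> v s) + (norm (v s))\<^sup>2" for s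
    by (simp add: power2_norm_eq_inner inner_commute algebra_simps)
  then show ?thesis
    using u v L2_on_inner_integrable[OF I u v] strongly_measurable_add
    by (auto simp: L2_on_iff[OF I])
qed

lemma L2_on_scaleR:
  assumes I: "I \<in> sets lebesgue" and u: "u \<in> L2_on I"
  shows "(\<lambda>s. c *\<^sub>R u s) \<in> L2_on I"
  using u strongly_measurable_scaleR[OF strongly_measurable_const]
  by (auto simp: L2_on_iff[OF I] power_mult_distrib)

lemma control_inner_commute: "control_inner n b p q = control_inner n b q p"
  by (simp add: control_inner_def inner_commute)

lemma control_inner_self:
  assumes "p \<in> controls n b"
  shows "control_inner n b p p \<ge> 0" and "control_inner n b p p = 0 \<longleftrightarrow> control_is_zero n b p"
proof -
  obtain u v where p: "p = (u, v)" by fastforce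
  have u: "u \<in> L2_on {0..b}" using assms by (simp add: p controls_def)
  have int: "integrable (lebesgue_on {0..b}) (\<lambda>s. u s \<bullet> u s)"
    using L2_on_inner_integrable[OF _ u u] by simp
  have 1: "(\<integral>s. u s \<bullet> u s \<partial>lebesgue_on {0..b}) \<ge> 0" by (intro integral_nonneg_AE) auto
  have 2: "(\<Sum>k=1..n. v k \<bullet> v k) \<ge> 0" by (intro sum_nonneg) auto
  have eq: "control_inner n b p p = (\<integral>s. u s \<bullet> u s \<partial>lebesgue_on {0..b}) + (\<Sum>k=1..n. v k \<bullet> v k)"
    by (simp add: control_inner_def p)
  show "control_inner n b p p \<ge> 0" using 1 2 unfolding eq by linarith
  have "control_inner n b p p = 0 \<longleftrightarrow> (\<integral>s. u s \<bullet> u s \<partial>lebesgue_on {0..b}) = 0 \<and> (\<Sum>k=1..n. v k \<bullet> v k) = 0"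
    using 1 2 unfolding eq by linarith
  also have "\<dots> \<longleftrightarrow> control_is_zero n b p"
    using integral_nonneg_eq_0_iff_AE[OF int] by (simp add: control_is_zero_def p sum_nonneg_eq_0_iff)
  finally show "control_inner n b p p = 0 \<longleftrightarrow> control_is_zero n b p" .
qed

lemma control_inner_is_zero:
  assumes "p \<in> controls n b" "q \<in> controls n b" "control_is_zero n b q"
  shows "control_inner n b p q = 0"
proof -
  have "(\<integral>s. fst p s \<bullet> fst q s \<partial>lebesgue_on {0..b}) = (\<integral>s. 0 \<partial>lebesgue_on {0..b})"
    using assms L2_on_inner_integrable[of "{0..b}" "fst p" "fst q"]
    by (intro integral_cong_AE) (auto simp: control_is_zero_def controls_def elim: eventually_mono)
  then show ?thesis using assms(3) by (simp add: control_inner_def control_is_zero_def)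
qed

lemma control_inner_add_left:
  assumes "(u, v) \<in> controls n b" "(u', v') \<in> controls n b" "q \<in> controls n b"
  shows "control_inner n b (\<lambda>s. u s + u' s, \<lambda>k\<in>{1..n}. v k + v' k) q =
    control_inner n b (u, v) q + control_inner n b (u', v') q"
  using assms L2_on_inner_integrable[of "{0..b}" u "fst q"] L2_on_inner_integrable[of "{0..b}" u' "fst q"]
  by (auto simp: control_inner_def controls_def inner_add_left sum.distrib)

lemma control_inner_scaleR_left:
  "control_inner n b (\<lambda>s. c *\<^sub>R u s, \<lambda>k\<in>{1..n}. c *\<^sub>R v k) q = c * control_inner n b (u, v) q"
  by (simp add: control_inner_def sum_distrib_left distrib_left)

text \<open>Applied with \<open>e = 2 * \<alpha> - 2\<close>, for which \<open>e > -1\<close> means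
  exactly \<alpha> > 1/2.\<close>

lemma integrable_powr_reflect:
  fixes a c e :: real
  assumes "a \<le> c" "e > -1"
  shows "integrable (lebesgue_on {a..c}) (\<lambda>s. (c - s) powr e)"
proof -
  have "(\<lambda>x. x powr e) integrable_on {0..c - a}"
    using assms by (intro integrable_on_powr_from_0) auto
  then obtain i where "((\<lambda>x. x powr e) has_integral i) {0..c - a}" by (auto simp: integrable_on_def)
  then have "((\<lambda>x. (- x) powr e) has_integral i) {- (c - a)..- 0}"
    by (rule has_integral_reflect_lemma_real)
  from has_integral_shift_real_ivl[OF this, of "- c"]
  have "((\<lambda>s. (c - s) powr e) has_integral i) {a..c}" by simp
  then have "(\<lambda>s. (c - s) powr e) absolutely_integrable_on {a..c}"
    by (intro nonnegative_absolutely_integrable_1) (auto simp: integrable_on_def)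
  then show ?thesis by (rule absolutely_integrable_imp_integrable) simp
qed

text \<open>Adjoints reverse the order of factors, which is why decreasing products pair with
  increasing ones.\<close>

lemma prod_adjoint:
  fixes T T' :: "nat \<Rightarrow> 'h::real_inner \<Rightarrow> 'h"
  assumes "\<And>j x y. i \<le> j \<Longrightarrow> j \<le> k \<Longrightarrow> T j x \<bullet> y = x \<bullet> T' j y"
  shows "prod_down T k i x \<bullet> y = x \<bullet> prod_up T' i k y"
proof -
  \<comment> \<open>Reversal places the first index innermost; this identity lets that factor be
    peeled off on the right.\<close>
  have fold: "foldr (\<lambda>j F. T j \<circ> F) js G = foldr (\<lambda>j F. T j \<circ> F) js id \<circ> G" for js and G :: "'h \<Rightarrow> 'h"
    by (induction js) (simp_all add: o_assoc)
  have prod: "foldr (\<lambda>j F. T j \<circ> F) (rev js) id x \<bullet> y = x \<bullet> foldr (\<lambda>j F. T' j \<circ> F) js id y"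
    if "\<And>j x y. j \<in> set js \<Longrightarrow> T j x \<bullet> y = x \<bullet> T' j y" for js x y
    using that
  proof (induction js arbitrary: x)
    case (Cons j js)
    have "foldr (\<lambda>j F. T j \<circ> F) (rev (j # js)) id x = foldr (\<lambda>j F. T j \<circ> F) (rev js) id (T j x)"
      using fun_cong[OF fold[of "rev js" "T j"], of x] by simp
    also have "\<dots> \<bullet> y = T j x \<bullet> foldr (\<lambda>j F. T' j \<circ> F) js id y"
      using Cons.prems by (intro Cons.IH) simp
    also have "\<dots> = x \<bullet> foldr (\<lambda>j F. T' j \<circ> F) (j # js) id y"
      using Cons.prems by simp
    finally show ?case .
  qed simp
  show ?thesis unfolding prod_down_def prod_up_def by (rule prod) (use assms in auto)
qed

section \<open>The controllability operator\<close>

locale impulsive_system =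
  fixes \<alpha> b :: real and n :: nat and t :: "nat \<Rightarrow> real"
    and S :: "real \<Rightarrow> 'h::{real_inner, banach} \<Rightarrow> 'h"
    and B :: "'u::{real_inner, banach} \<Rightarrow> 'h"
    and D :: "nat \<Rightarrow> 'h \<Rightarrow> 'h" and E :: "nat \<Rightarrow> 'u \<Rightarrow> 'h"
  assumes \<alpha>: "0 < \<alpha>" "\<alpha> \<le> 1" and n: "n \<ge> 1"
    and t0: "t 0 = 0" and t_step: "\<And>k. k \<le> n \<Longrightarrow> t k < t (k + 1)" and tb: "t (n + 1) = b"
    and S: "C0_semigroup S" and B: "bounded_linear B"
    and D: "\<And>k. k \<in> {1..n} \<Longrightarrow> bounded_linear (D k)"
    and E: "\<And>k. k \<in> {1..n} \<Longrightarrow> bounded_linear (E k)"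
    and bounded: "\<alpha> \<le> 1 / 2 \<Longrightarrow> bounded_control_map \<alpha> S B D E n t b"
begin

abbreviation "P \<equiv> frac_P \<alpha> S"
abbreviation "M \<equiv> control_map \<alpha> S B D E n t b"
abbreviation "G \<equiv> controllability_op \<alpha> S B D E n t b"
abbreviation "last_S \<equiv> frac_S \<alpha> S (b - t n)"

abbreviation "ival i \<equiv> {t (i - 1)..t i}"
abbreviation "integrand i \<equiv> control_integrand \<alpha> S B (t i)"

lemma t_less: "i < j \<Longrightarrow> j \<le> n + 1 \<Longrightarrow> t i < t j"
proof (induction j)
  case (Suc j)
  then show ?case using t_step[of j] by (cases "i = j") force+
qed simp

lemma t_le: "i \<le> j \<Longrightarrow> j \<le> n + 1 \<Longrightarrow> t i \<le> t j"
  using t_less[of i j] by (cases "i = j") auto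

lemma t_bounds: "k \<le> n + 1 \<Longrightarrow> 0 \<le> t k \<and> t k \<le> b"
  using t_le[of 0 k] t_le[of k "n + 1"] t0 tb by simp

lemmas P_family = frac_family(2)[OF S \<alpha>]
lemmas adjoint_P_family = adjoint_frac_P_family[OF S \<alpha>]
lemmas P_linear = bounded_operator_familyD(1)[OF P_family]

lemma frac_S_linear: "r \<ge> 0 \<Longrightarrow> bounded_linear (frac_S \<alpha> S r)"
  using bounded_operator_familyD(1)[OF frac_family(1)[OF S \<alpha>]] .

lemma last_S_linear: "bounded_linear last_S"
  using t_bounds[of n] by (intro frac_S_linear) simp

lemma jump_adjoint:
  assumes "j \<in> {1..n}"
  shows "jump_step \<alpha> S D t j x \<bullet> y = x \<bullet> jump_step_adj \<alpha> S D t j y"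
proof -
  have "bounded_linear (frac_S \<alpha> S (t j - t (j - 1)))"
    using assms t_le[of "j - 1" j] by (intro frac_S_linear) auto
  then show ?thesis using D[OF assms]
    by (simp add: jump_step_def jump_step_adj_def Let_def adjoint_bounded[symmetric] inner_add_left inner_add_right)
qed

text \<open>The final state, with the integrals of \<open>control_map\<close> replaced by vectors \<open>y i\<close>. Both
  \<open>control_map\<close> and \<open>controllability_op\<close> are instances.\<close>

definition response :: "(nat \<Rightarrow> 'h) \<Rightarrow> (nat \<Rightarrow> 'u) \<Rightarrow> 'h" where
  "response y v = y (n + 1)
     + last_S (\<Sum>i=1..n. prod_down (jump_step \<alpha> S D t) n (i + 1) (y i + D i (y i)))
     + last_S (\<Sum>i=2..n. prod_down (jump_step \<alpha> S D t) n i (E (i - 1) (v (i - 1))))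
     + last_S (E n (v n))"

text \<open>The terminal vector \<phi> transported back to the moment just after the jump at
  \<open>t i\<close>. Impulses enter at that moment, so they pair with this vector.\<close>

definition backward :: "'h \<Rightarrow> nat \<Rightarrow> 'h" where
  "backward \<phi> i = prod_up (jump_step_adj \<alpha> S D t) (i + 1) n (adjoint last_S \<phi>)"

text \<open>The same transport continued across the jump at \<open>t i\<close>, to the end of the
  \<open>i\<close>-th interval, where the distributed control has accumulated. The last interval
  ends at \<open>b\<close> without a jump, hence the separate case.\<close>

definition costate :: "'h \<Rightarrow> nat \<Rightarrow> 'h" where
  "costate \<phi> i = (if i = n + 1 then \<phi> else backward \<phi> i + adjoint (D i) (backward \<phi> i))"

definition impulse_adj :: "'h \<Rightarrow> nat \<Rightarrow> 'u" where
  "impulse_adj \<phi> = (\<lambda>k\<in>{1..n}. adjoint (E k) (backward \<phi> k))"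

text \<open>All the combinatorics of jumps and ordered products is settled here, once for both
  instances; afterwards the system is visible only through \<open>costate\<close> and
  \<open>impulse_adj\<close>.\<close>

lemma response_inner:
  "response y v \<bullet> \<phi> = (\<Sum>i=1..n + 1. y i \<bullet> costate \<phi> i) + (\<Sum>k=1..n. v k \<bullet> impulse_adj \<phi> k)"
proof -
  have pd: "prod_down (jump_step \<alpha> S D t) n (i + 1) x \<bullet> adjoint last_S \<phi> = x \<bullet> backward \<phi> i" for i x
    unfolding backward_def by (rule prod_adjoint) (auto intro: jump_adjoint)
  have LS: "last_S x \<bullet> \<phi> = x \<bullet> adjoint last_S \<phi>" for x
    by (rule adjoint_bounded[OF last_S_linear])
  have "(\<Sum>i=1..n. prod_down (jump_step \<alpha> S D t) n (i + 1) (y i + D i (y i))) \<bullet> adjoint last_S \<phi>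
      = (\<Sum>i=1..n. y i \<bullet> costate \<phi> i)"
    unfolding inner_sum_left
  proof (intro sum.cong refl)
    fix i assume i: "i \<in> {1..n}"
    then show "prod_down (jump_step \<alpha> S D t) n (i + 1) (y i + D i (y i)) \<bullet> adjoint last_S \<phi> = y i \<bullet> costate \<phi> i"
      by (simp only: pd) (simp add: costate_def inner_add_left inner_add_right adjoint_bounded[OF D[OF i]])
  qed
  moreover have "(\<Sum>i=2..n. prod_down (jump_step \<alpha> S D t) n i (E (i - 1) (v (i - 1)))) \<bullet> adjoint last_S \<phi>
      + E n (v n) \<bullet> adjoint last_S \<phi> = (\<Sum>k=1..n. v k \<bullet> impulse_adj \<phi> k)"
  proof -
    have Ek: "E k (v k) \<bullet> backward \<phi> k = v k \<bullet> impulse_adj \<phi> k" if "k \<in> {1..n}" for k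
      using that by (simp add: impulse_adj_def adjoint_bounded[OF E])
    have "prod_down (jump_step \<alpha> S D t) n i (E (i - 1) (v (i - 1))) \<bullet> adjoint last_S \<phi>
        = v (i - 1) \<bullet> impulse_adj \<phi> (i - 1)" if i: "i \<in> {2..n}" for i
    proof -
      have "i - 1 \<in> {1..n}" "i - 1 + 1 = i" using i by auto
      then show ?thesis using pd[of "i - 1" "E (i - 1) (v (i - 1))"] Ek[of "i - 1"] by metis
    qed
    then have "(\<Sum>i=2..n. prod_down (jump_step \<alpha> S D t) n i (E (i - 1) (v (i - 1)))) \<bullet> adjoint last_S \<phi>
        = (\<Sum>i=2..n. v (i - 1) \<bullet> impulse_adj \<phi> (i - 1))"
      unfolding inner_sum_left by (intro sum.cong) auto
    \<comment> \<open>The sum over \<open>i\<close> carries the impulses with index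
      \<open>i - 1\<close>, hence 1 to \<open>n - 1\<close>; the \<open>n\<close>-th impulse is
      followed by no further jump and stands alone in \<open>response\<close>.\<close>
    also have "\<dots> = (\<Sum>k=1..n - 1. v k \<bullet> impulse_adj \<phi> k)"
      by (rule sum.reindex_bij_witness[of _ "\<lambda>k. k + 1" "\<lambda>i. i - 1"]) auto
    finally have 1: "(\<Sum>i=2..n. prod_down (jump_step \<alpha> S D t) n i (E (i - 1) (v (i - 1)))) \<bullet> adjoint last_S \<phi>
        = (\<Sum>k=1..n - 1. v k \<bullet> impulse_adj \<phi> k)" .
    have "backward \<phi> n = adjoint last_S \<phi>" by (simp add: backward_def prod_up_def)
    then have 2: "E n (v n) \<bullet> adjoint last_S \<phi> = v n \<bullet> impulse_adj \<phi> n" using Ek[of n] n by simp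
    have "{1..n} = insert n {1..n - 1}" using n by auto
    then show ?thesis using 1 2 n by simp
  qed
  moreover have "costate \<phi> (n + 1) = \<phi>" by (simp add: costate_def)
  ultimately show ?thesis
    unfolding response_def inner_add_left LS by (simp add: algebra_simps)
qed

lemma control_map_response:
  "M (u, v) = response (\<lambda>i. bochner_integral (ival i) (integrand i u)) v"
  by (simp add: control_map_def response_def Let_def tb[simplified])

text \<open>Pure rearrangement, with the Gramians as unevaluated vectors; their integrability is
  addressed in \<open>gramian_eq\<close>.\<close>

lemma controllability_op_response:
  "G \<phi> = response (\<lambda>i. gramian \<alpha> S B (t (i - 1)) (t i) (costate \<phi> i)) (impulse_adj \<phi>)"
proof -
  have 1: "Psi_op \<alpha> S B D n t b \<phi> = last_S (\<Sum>i=1..n. prod_down (jump_step \<alpha> S D t) n (i + 1)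
      (gramian \<alpha> S B (t (i - 1)) (t i) (costate \<phi> i) + D i (gramian \<alpha> S B (t (i - 1)) (t i) (costate \<phi> i))))"
    unfolding Psi_op_def
    by (intro arg_cong[where f=last_S] sum.cong refl) (simp add: costate_def backward_def Let_def)
  have 2: "Psi_tilde_op \<alpha> S D E n t b \<phi> = last_S (\<Sum>i=2..n. prod_down (jump_step \<alpha> S D t) n i
      (E (i - 1) (impulse_adj \<phi> (i - 1))))"
    unfolding Psi_tilde_op_def
    by (intro arg_cong[where f=last_S] sum.cong refl) (auto simp: impulse_adj_def backward_def)
  have 3: "Omega_tilde_op \<alpha> S E n t b \<phi> = last_S (E n (impulse_adj \<phi> n))"
    using n by (simp add: Omega_tilde_op_def impulse_adj_def backward_def prod_up_def)
  have 4: "Omega_op \<alpha> S B n t b \<phi> = gramian \<alpha> S B (t n) (t (n + 1)) (costate \<phi> (n + 1))"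
    by (simp add: Omega_op_def costate_def tb[simplified])
  show ?thesis unfolding controllability_op_def response_def 1 2 3 4 by simp
qed

section \<open>The adjoint control and its square integrability\<close>

text \<open>The number of the interval containing \<open>s\<close>. Its values at the nodes
  \<open>t k\<close> affect no integral, and the arguments about it take place in the open
  intervals.\<close>

definition interval_index :: "real \<Rightarrow> nat" where
  "interval_index s = (LEAST i. s \<le> t i)"

text \<open>The function component of q(phi): at each time, the adjoint of the kernel of
  \<open>control_integrand\<close> applied to the costate of the interval.\<close>

definition control_adj :: "'h \<Rightarrow> real \<Rightarrow> 'u" where
  "control_adj \<phi> s = (let i = interval_index s in
     (t i - s) powr (\<alpha> - 1) *\<^sub>R adjoint B (adjoint (P (t i - s)) (costate \<phi> i)))"

lemma interval_index_eq:
  assumes "i \<in> {1..n + 1}" "t (i - 1) < s" "s < t i"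
  shows "interval_index s = i"
  unfolding interval_index_def
proof (rule Least_equality)
  fix j assume j: "s \<le> t j"
  show "i \<le> j"
  proof (rule ccontr)
    assume "\<not> i \<le> j"
    then have "t j \<le> t (i - 1)" using assms(1) by (intro t_le) auto
    then show False using j assms(2) by linarith
  qed
qed (use assms in simp)

lemma control_adj_eq:
  assumes "i \<in> {1..n + 1}" "t (i - 1) < s" "s < t i"
  shows "control_adj \<phi> s = (t i - s) powr (\<alpha> - 1) *\<^sub>R adjoint B (adjoint (P (t i - s)) (costate \<phi> i))"
  by (simp add: control_adj_def interval_index_eq[OF assms])

lemma AE_interior:
  "i \<in> {1..n + 1} \<Longrightarrow> AE s in lebesgue_on (ival i). t (i - 1) < s \<and> s < t i"
  using AE_lebesgue_on_notin_finite[of "{t (i - 1), t i}" "ival i"]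
    AE_space[of "lebesgue_on (ival i)"]
  by (auto elim!: eventually_elim2)

lemma AE_interior_all:
  "AE s in lebesgue_on {0..b}. \<exists>i\<in>{1..n + 1}. t (i - 1) < s \<and> s < t i"
proof -
  have "AE s in lebesgue_on {0..b}. s \<notin> t ` {0..n + 1}"
    by (intro AE_lebesgue_on_notin_finite) auto
  moreover have "AE s in lebesgue_on {0..b}. s \<in> {0..b}"
    using AE_space[of "lebesgue_on {0..b}"] by simp
  ultimately show ?thesis
  proof eventually_elim
    case (elim s)
    define i where "i = interval_index s"
    have ex: "s \<le> t (n + 1)" using elim tb by simp
    have si: "s \<le> t i" unfolding i_def interval_index_def using ex by (rule LeastI)
    have "i \<le> n + 1" unfolding i_def interval_index_def using ex by (rule Least_le)
    have "t 0 \<in> t ` {0..n + 1}" by (intro imageI) auto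
    then have "s \<noteq> t 0" using elim(1) by blast
    then have "0 < s" using elim(2) t0 by (simp add: less_le)
    then have "i \<noteq> 0" using si t0 by (intro notI) simp
    then have "\<not> s \<le> t (i - 1)"
      using not_less_Least[of "i - 1" "\<lambda>i. s \<le> t i"] by (simp add: i_def interval_index_def)
    moreover have "t i \<in> t ` {0..n + 1}" using \<open>i \<le> n + 1\<close> by (intro imageI) auto
    then have "s \<noteq> t i" using elim(1) by blast
    ultimately show ?case using si \<open>i \<le> n + 1\<close> \<open>i \<noteq> 0\<close> by (intro bexI[of _ i]) auto
  qed
qed

lemma control_adj_isCont:
  assumes i: "i \<in> {1..n + 1}" "t (i - 1) < s" "s < t i"
  shows "isCont (control_adj \<phi>) s"
proof -
  let ?h = "\<lambda>s. (t i - s) powr (\<alpha> - 1) *\<^sub>R adjoint B (adjoint (P (t i - s)) (costate \<phi> i))"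
  have "isCont (\<lambda>(r, x). adjoint (P r) x) (t i - s, costate \<phi> i)"
    using bounded_operator_family_isCont[OF adjoint_P_family] i by simp
  moreover have "isCont (\<lambda>s. (t i - s, costate \<phi> i)) s" by (intro continuous_intros)
  ultimately have "isCont (\<lambda>s. adjoint (P (t i - s)) (costate \<phi> i)) s"
    using isCont_o2[of s "\<lambda>s. (t i - s, costate \<phi> i)" "\<lambda>(r, x). adjoint (P r) x"] by simp
  then have h: "isCont ?h s"
    using i by (intro continuous_intros bounded_linear.isCont[OF bounded_linear_adjoint[OF B]]) auto
  have "\<forall>\<^sub>F s in nhds s. control_adj \<phi> s = ?h s"
  proof -
    have "\<forall>\<^sub>F s in nhds s. s \<in> {t (i - 1)<..<t i}"
      using i by (intro eventually_nhds_in_open) auto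
    then show ?thesis by eventually_elim (use control_adj_eq[OF i(1)] in auto)
  qed
  from isCont_cong[OF this] h show ?thesis by simp
qed

lemma control_adj_measurable: "strongly_measurable_on {0..b} (control_adj \<phi>)"
  using AE_interior_all control_adj_isCont
  by (intro strongly_measurable_AE_continuous) (auto elim!: eventually_mono)

lemma integral_split:
  fixes f :: "real \<Rightarrow> real"
  assumes "\<And>i. i \<in> {1..n + 1} \<Longrightarrow> integrable (lebesgue_on (ival i)) f"
  shows "integrable (lebesgue_on {0..b}) f"
    and "(\<integral>s. f s \<partial>lebesgue_on {0..b}) = (\<Sum>i=1..n + 1. \<integral>s. f s \<partial>lebesgue_on (ival i))"
proof -
  have "k \<le> n + 1 \<Longrightarrow> integrable (lebesgue_on {0..t k}) f \<and>
      (\<integral>s. f s \<partial>lebesgue_on {0..t k}) = (\<Sum>i=1..k. \<integral>s. f s \<partial>lebesgue_on (ival i))" for k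
  proof (induction k)
    case 0
    have "{0} \<in> null_sets (lebesgue :: real measure)" by (intro null_sets_completionI finite_imp_null_set_lborel) simp
    then have "has_bochner_integral (lebesgue_on {0}) f 0"
      by (intro has_bochner_integral_null) simp
    then show ?case by (simp add: t0 has_bochner_integral_iff)
  next
    case (Suc k)
    have f: "integrable (lebesgue_on {0..t k}) f" "integrable (lebesgue_on {t k..t (Suc k)}) f"
      using Suc assms[of "Suc k"] by auto
    have le: "0 \<le> t k" "t k \<le> t (Suc k)" using t_bounds[of k] t_le[of k "Suc k"] Suc.prems by auto
    have int: "integrable (lebesgue_on {0..t (Suc k)}) f" by (rule integrable_combine[OF f le])
    show ?case
      using int Equivalence_Measurable_On_Borel.integral_combine[OF int le] Suc by simp
  qed
  from this[of "n + 1"] show "integrable (lebesgue_on {0..b}) f"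
    "(\<integral>s. f s \<partial>lebesgue_on {0..b}) = (\<Sum>i=1..n + 1. \<integral>s. f s \<partial>lebesgue_on (ival i))"
    unfolding tb by auto
qed

lemma integrand_measurable:
  assumes i: "i \<in> {1..n + 1}" and u: "strongly_measurable_on {0..b} u"
  shows "strongly_measurable_on (ival i) (integrand i u)"
  unfolding control_integrand_def[abs_def]
\<comment> \<open>The integrand is a jointly continuous function of the time and of the value
  \<open>u s\<close> in the open interval, which reduces its measurability to that of
  \<open>u\<close>.\<close>
proof (rule strongly_measurable_compose2[OF strongly_measurable_id, where \<phi>="\<lambda>s x. (t i - s) powr (\<alpha> - 1) *\<^sub>R P (t i - s) (B x)"])
  have sub: "ival i \<subseteq> {0..b}" using t_bounds[of "i - 1"] t_bounds[of i] i by auto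
  show "strongly_measurable_on (ival i) u"
    by (rule strongly_measurable_subset[OF u sub]) auto
  show "AE s in lebesgue_on (ival i).
      isCont (\<lambda>(s, x). (t i - s) powr (\<alpha> - 1) *\<^sub>R P (t i - s) (B x)) (s, u s)"
    using AE_interior[OF i]
  proof eventually_elim
    case (elim s)
    have c: "isCont (\<lambda>z. (t i - fst z, B (snd z))) (s, u s)"
      by (intro continuous_intros bounded_linear.isCont[OF B])
    have "isCont (\<lambda>(r, x). P r x) (t i - s, B (u s))"
      using bounded_operator_family_isCont[OF P_family] elim by simp
    then have "isCont (\<lambda>z. P (t i - fst z) (B (snd z))) (s, u s)"
      using isCont_o2[OF c, of "\<lambda>(r, x). P r x"] by simp
    then show ?case
      unfolding case_prod_unfold using elim by (intro continuous_intros) auto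
  qed
qed simp

lemma solution_operator_bound:
  obtains K where "K \<ge> 0" "\<And>s x. 0 \<le> s \<Longrightarrow> s \<le> b \<Longrightarrow> norm (P s (B x)) \<le> K * norm x"
    "\<And>s y. 0 \<le> s \<Longrightarrow> s \<le> b \<Longrightarrow> norm (adjoint B (adjoint (P s) y)) \<le> K * norm y"
proof -
  obtain K1 where K1: "K1 \<ge> 0" "\<And>r x. 0 \<le> r \<Longrightarrow> r \<le> b \<Longrightarrow> norm (P r x) \<le> K1 * norm x"
    using bounded_operator_familyD(2)[OF P_family, of b] by fastforce
  obtain K2 where K2: "K2 \<ge> 0" "\<And>x. norm (B x) \<le> K2 * norm x"
    using bounded_linear.nonneg_bounded[OF B] by (metis mult.commute)
  have "norm (P s (B x)) \<le> (K1 * K2) * norm x" if "0 \<le> s" "s \<le> b" for s x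
    using K1(2)[OF that, of "B x"] mult_left_mono[OF K2(2)[of x] K1(1)] by (simp add: mult.assoc)
  moreover have "norm (adjoint B (adjoint (P s) y)) \<le> (K1 * K2) * norm y" if "0 \<le> s" "s \<le> b" for s y
  proof -
    have "norm (adjoint B (adjoint (P s) y)) \<le> K2 * norm (adjoint (P s) y)"
      using K2 by (intro norm_adjoint_le B)
    also have "\<dots> \<le> K2 * (K1 * norm y)"
      using K1(2)[OF that] that K1(1) K2(1) by (intro mult_left_mono norm_adjoint_le P_linear) auto
    finally show ?thesis by (simp add: mult_ac)
  qed
  ultimately show ?thesis using that K1(1) K2(1) by (metis mult_nonneg_nonneg)
qed

lemma integrand_integrable:
  assumes u: "u \<in> L2_on {0..b}" and i: "i \<in> {1..n + 1}"
  shows "integrand i u bochner_integrable_on (ival i)"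
proof (cases "\<alpha> \<le> 1 / 2")
  case True
  then show ?thesis using bounded u i by (auto simp: bounded_control_map_def)
next
  case False
  obtain K where K: "K \<ge> 0" "\<And>s x. 0 \<le> s \<Longrightarrow> s \<le> b \<Longrightarrow> norm (P s (B x)) \<le> K * norm x"
    using solution_operator_bound by metis
  have tt: "t (i - 1) \<le> t i" "0 \<le> t (i - 1)" "t i \<le> b"
    using t_le[of "i - 1" i] t_bounds[of "i - 1"] t_bounds[of i] i by auto
  have "integrable (lebesgue_on {0..b}) (\<lambda>s. (norm (u s))\<^sup>2)" using u by (simp add: L2_on_iff)
  then have ui: "integrable (lebesgue_on (ival i)) (\<lambda>s. (norm (u s))\<^sup>2)"
    by (rule integrable_lebesgue_on_subset) (use tt in auto)
  show ?thesis
  \<comment> \<open>The majorant comes from \<open>x * y \<le> x\<^sup>2 + y\<^sup>2\<close>,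
    separating the squared kernel, integrable for \<alpha> > 1/2, from the squared control.\<close>
  proof (rule bochner_integrable_onI[where g="\<lambda>s. K * ((t i - s) powr (2 * \<alpha> - 2) + (norm (u s))\<^sup>2)"])
    show "strongly_measurable_on (ival i) (integrand i u)"
      using u by (intro integrand_measurable i) (simp add: L2_on_iff)
    show "integrable (lebesgue_on (ival i)) (\<lambda>s. K * ((t i - s) powr (2 * \<alpha> - 2) + (norm (u s))\<^sup>2))"
      using ui integrable_powr_reflect[OF tt(1), of "2 * \<alpha> - 2"] False by simp
    show "AE s in lebesgue_on (ival i). norm (integrand i u s)
        \<le> K * ((t i - s) powr (2 * \<alpha> - 2) + (norm (u s))\<^sup>2)"
      using AE_interior[OF i]
    proof eventually_elim
      case (elim s)
      define x y where "x = (t i - s) powr (\<alpha> - 1)" and "y = norm (u s)"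
      have "norm (integrand i u s) = x * norm (P (t i - s) (B (u s)))"
        by (simp add: control_integrand_def x_def)
      also have "\<dots> \<le> x * (K * y)"
        unfolding y_def using elim tt by (intro mult_left_mono K) (auto simp: x_def)
      also have "\<dots> = K * (x * y)" by simp
      also have "\<dots> \<le> K * (x\<^sup>2 + y\<^sup>2)"
      proof (rule mult_left_mono[OF _ K(1)])
        have "0 \<le> x * y" by (simp add: x_def y_def)
        then show "x * y \<le> x\<^sup>2 + y\<^sup>2" using sum_squares_bound[of x y] by linarith
      qed
      also have "x\<^sup>2 = (t i - s) powr (2 * \<alpha> - 2)"
        unfolding x_def power2_eq_square powr_add[symmetric] by simp
      finally show ?case by (simp add: y_def)
    qed
  qed simp
qed

text \<open>Integrability of the pairing is taken from that of the integrand of \<open>M\<close>,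
  not from square integrability of \<open>control_adj \<phi>\<close>. The formula is therefore
  available in the proof of that square integrability.\<close>

lemma control_map_inner:
  assumes "(u, v) \<in> controls n b"
  shows "integrable (lebesgue_on {0..b}) (\<lambda>s. u s \<bullet> control_adj \<phi> s)"
    and "M (u, v) \<bullet> \<phi> = control_inner n b (u, v) (control_adj \<phi>, impulse_adj \<phi>)"
proof -
  have u: "u \<in> L2_on {0..b}" using assms by (simp add: controls_def)
  then have um: "strongly_measurable_on {0..b} u" by (simp add: L2_on_iff)
  have AEeq: "AE s in lebesgue_on (ival i).
      integrand i u s \<bullet> costate \<phi> i = u s \<bullet> control_adj \<phi> s" if i: "i \<in> {1..n + 1}" for i
    using AE_interior[OF i]
  proof eventually_elim
    case (elim s)
    have "P (t i - s) (B (u s)) \<bullet> costate \<phi> i = u s \<bullet> adjoint B (adjoint (P (t i - s)) (costate \<phi> i))"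
      using elim by (subst adjoint_bounded[OF P_linear]) (auto simp: adjoint_bounded[OF B])
    then show ?case using control_adj_eq[OF i] elim by (simp add: control_integrand_def)
  qed
  have meas: "(\<lambda>s. u s \<bullet> control_adj \<phi> s) \<in> borel_measurable (lebesgue_on (ival i))"
    if i: "i \<in> {1..n + 1}" for i
  proof -
    have "strongly_measurable_on {0..b} (\<lambda>s. u s \<bullet> control_adj \<phi> s)"
      by (intro strongly_measurable_inner um control_adj_measurable)
    then have "strongly_measurable_on (ival i) (\<lambda>s. u s \<bullet> control_adj \<phi> s)"
      by (rule strongly_measurable_subset) (use t_bounds[of "i - 1"] t_bounds[of i] i in auto)
    then show ?thesis by (simp add: strongly_measurable_real_iff)
  qed
  note BI = bochner_integral_inner[OF _ integrand_integrable[OF u]]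
  have int: "integrable (lebesgue_on (ival i)) (\<lambda>s. u s \<bullet> control_adj \<phi> s)"
    and eq: "(\<integral>s. u s \<bullet> control_adj \<phi> s \<partial>lebesgue_on (ival i))
      = bochner_integral (ival i) (integrand i u) \<bullet> costate \<phi> i"
    if i: "i \<in> {1..n + 1}" for i
  proof -
    have I: "integrable (lebesgue_on (ival i)) (\<lambda>s. integrand i u s \<bullet> costate \<phi> i)"
      using BI(1)[OF _ i] by simp
    show "integrable (lebesgue_on (ival i)) (\<lambda>s. u s \<bullet> control_adj \<phi> s)"
      using Bochner_Integration.integrable_cong_AE[OF borel_measurable_integrable[OF I] meas[OF i] AEeq[OF i]] I
      by blast
    have "(\<integral>s. integrand i u s \<bullet> costate \<phi> i \<partial>lebesgue_on (ival i))
        = (\<integral>s. u s \<bullet> control_adj \<phi> s \<partial>lebesgue_on (ival i))"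
      by (rule integral_cong_AE[OF borel_measurable_integrable[OF I] meas[OF i] AEeq[OF i]])
    then show "(\<integral>s. u s \<bullet> control_adj \<phi> s \<partial>lebesgue_on (ival i))
      = bochner_integral (ival i) (integrand i u) \<bullet> costate \<phi> i"
      using BI(2)[OF _ i] by simp
  qed
  show "integrable (lebesgue_on {0..b}) (\<lambda>s. u s \<bullet> control_adj \<phi> s)"
    using int by (rule integral_split(1))
  have "(\<integral>s. u s \<bullet> control_adj \<phi> s \<partial>lebesgue_on {0..b})
      = (\<Sum>i=1..n + 1. \<integral>s. u s \<bullet> control_adj \<phi> s \<partial>lebesgue_on (ival i))"
    using int by (rule integral_split(2))
  also have "\<dots> = (\<Sum>i=1..n + 1. bochner_integral (ival i) (integrand i u) \<bullet> costate \<phi> i)"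
    by (rule sum.cong[OF refl eq])
  finally show "M (u, v) \<bullet> \<phi> = control_inner n b (u, v) (control_adj \<phi>, impulse_adj \<phi>)"
    unfolding control_map_response response_inner by (simp add: control_inner_def)
qed

lemma control_adj_L2: "control_adj \<phi> \<in> L2_on {0..b}"
proof (cases "\<alpha> \<le> 1 / 2")
  case False
  obtain K where K: "K \<ge> 0" "\<And>s y. 0 \<le> s \<Longrightarrow> s \<le> b \<Longrightarrow> norm (adjoint B (adjoint (P s) y)) \<le> K * norm y"
    using solution_operator_bound by metis
  have nm: "(\<lambda>s. (norm (control_adj \<phi> s))\<^sup>2) \<in> borel_measurable (lebesgue_on {0..b})"
  proof -
    have "(\<lambda>s. norm (control_adj \<phi> s)) \<in> borel_measurable (lebesgue_on {0..b})"
      using strongly_measurable_norm[OF control_adj_measurable] by (simp add: strongly_measurable_real_iff)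
    then show ?thesis by (rule borel_measurable_power)
  qed
  have "integrable (lebesgue_on (ival i)) (\<lambda>s. (norm (control_adj \<phi> s))\<^sup>2)" if i: "i \<in> {1..n + 1}" for i
  proof (rule Bochner_Integration.integrable_bound)
    have tt: "t (i - 1) \<le> t i" "0 \<le> t (i - 1)" "t i \<le> b"
      using t_le[of "i - 1" i] t_bounds[of "i - 1"] t_bounds[of i] i by auto
    let ?c = "(K * norm (costate \<phi> i))\<^sup>2"
    show "integrable (lebesgue_on (ival i)) (\<lambda>s. ?c * (t i - s) powr (2 * \<alpha> - 2))"
      using integrable_powr_reflect[OF tt(1), of "2 * \<alpha> - 2"] False by simp
    have "strongly_measurable_on {0..b} (\<lambda>s. (norm (control_adj \<phi> s))\<^sup>2)"
      using nm by (simp add: strongly_measurable_real_iff)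
    then have "strongly_measurable_on (ival i) (\<lambda>s. (norm (control_adj \<phi> s))\<^sup>2)"
      by (rule strongly_measurable_subset) (use tt in auto)
    then show "(\<lambda>s. (norm (control_adj \<phi> s))\<^sup>2) \<in> borel_measurable (lebesgue_on (ival i))"
      by (simp add: strongly_measurable_real_iff)
    show "AE s in lebesgue_on (ival i). norm ((norm (control_adj \<phi> s))\<^sup>2)
        \<le> norm (?c * (t i - s) powr (2 * \<alpha> - 2))"
      using AE_interior[OF i]
    proof eventually_elim
      case (elim s)
      have "norm (control_adj \<phi> s) \<le> (t i - s) powr (\<alpha> - 1) * (K * norm (costate \<phi> i))"
        using control_adj_eq[OF i] elim tt by (simp add: mult_left_mono K)
      then have "(norm (control_adj \<phi> s))\<^sup>2 \<le> ((t i - s) powr (\<alpha> - 1) * (K * norm (costate \<phi> i)))\<^sup>2"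
        by (rule power_mono) simp
      also have "\<dots> = ?c * ((t i - s) powr (\<alpha> - 1))\<^sup>2" by (simp add: power_mult_distrib)
      also have "((t i - s) powr (\<alpha> - 1))\<^sup>2 = (t i - s) powr (2 * \<alpha> - 2)"
        unfolding power2_eq_square powr_add[symmetric] by simp
      finally show ?case by simp
    qed
  qed
  from integral_split(1)[OF this] show ?thesis
    using control_adj_measurable by (simp add: L2_on_iff)
next
  case True
  then obtain C where C: "\<And>p. p \<in> controls n b \<Longrightarrow> norm (M p) \<le> C * sqrt (control_inner n b p p)"
    using bounded by (auto simp: bounded_control_map_def)
  let ?L = "lebesgue_on {0..b}"
  let ?w = "control_adj \<phi>"
  have nw[measurable]: "(\<lambda>s. norm (?w s)) \<in> borel_measurable ?L"
    using strongly_measurable_norm[OF control_adj_measurable] by (simp add: strongly_measurable_real_iff)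
  \<comment> \<open>Truncation by size makes the adjoint control bounded, hence admissible, while
    its pairing with the original is still its own squared norm.\<close>
  define cut where "cut m s = (if norm (?w s) \<le> real m then 1 else 0 :: real)" for m s
  define u where "u m s = cut m s *\<^sub>R ?w s" for m s
  have [measurable]: "cut m \<in> borel_measurable ?L" for m unfolding cut_def[abs_def] by measurable
  have um: "strongly_measurable_on {0..b} (u m)" for m
    unfolding u_def[abs_def]
    by (intro strongly_measurable_scaleR control_adj_measurable) (simp add: strongly_measurable_real_iff)
  have nu: "norm (u m s) \<le> real m" for m s by (simp add: u_def cut_def)
  have uu: "(norm (u m s))\<^sup>2 = u m s \<bullet> ?w s" for m s
    by (simp add: u_def cut_def power2_norm_eq_inner)
  have nui: "integrable ?L (\<lambda>s. (norm (u m s))\<^sup>2)" for m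
  proof (rule Bochner_Integration.integrable_bound)
    show "integrable ?L (\<lambda>s. (real m)\<^sup>2)" by simp
    have "(\<lambda>s. norm (u m s)) \<in> borel_measurable ?L"
      using strongly_measurable_norm[OF um] by (simp add: strongly_measurable_real_iff)
    then show "(\<lambda>s. (norm (u m s))\<^sup>2) \<in> borel_measurable ?L" by (rule borel_measurable_power)
    show "AE s in ?L. norm ((norm (u m s))\<^sup>2) \<le> norm ((real m)\<^sup>2)"
      using nu by (intro AE_I2) (simp add: power_mono)
  qed
  have pc: "(u m, \<lambda>k\<in>{1..n}. 0) \<in> controls n b" for m
    using um nui by (auto simp: controls_def L2_on_iff)
  have bnd: "(\<integral>s. (norm (u m s))\<^sup>2 \<partial>?L) \<le> (C * norm \<phi>)\<^sup>2" for m
  proof -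
    define X where "X = (\<integral>s. (norm (u m s))\<^sup>2 \<partial>?L)"
    have X0: "X \<ge> 0" unfolding X_def by (intro integral_nonneg_AE) auto
    have cX: "control_inner n b (u m, \<lambda>k\<in>{1..n}. 0) (u m, \<lambda>k\<in>{1..n}. 0) = X"
      by (simp add: control_inner_def X_def power2_norm_eq_inner)
    \<comment> \<open>Boundedness of \<open>M\<close> bounds the squared norm \<open>X\<close> by a
      multiple of \<open>sqrt X\<close>. Dividing by \<open>sqrt X\<close> gives a bound independent
      of \<open>m\<close>.\<close>
    have "X = M (u m, \<lambda>k\<in>{1..n}. 0) \<bullet> \<phi>"
      unfolding control_map_inner(2)[OF pc] by (simp add: control_inner_def X_def uu)
    also have "\<dots> \<le> norm (M (u m, \<lambda>k\<in>{1..n}. 0)) * norm \<phi>" by (rule norm_cauchy_schwarz)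
    also have "\<dots> \<le> (C * sqrt X) * norm \<phi>" using C[OF pc[of m]] unfolding cX by (rule mult_right_mono) simp
    finally have "sqrt X * sqrt X \<le> (C * norm \<phi>) * sqrt X" using X0 by (simp add: mult_ac)
    then have "X = 0 \<or> sqrt X \<le> C * norm \<phi>" unfolding mult_le_cancel_right using X0 by force
    then have "X \<le> (C * norm \<phi>)\<^sup>2"
    proof
      assume "sqrt X \<le> C * norm \<phi>"
      then have "(sqrt X)\<^sup>2 \<le> (C * norm \<phi>)\<^sup>2" using X0 by (intro power_mono) auto
      then show ?thesis using X0 by simp
    qed simp
    then show ?thesis by (simp only: X_def)
  qed
  \<comment> \<open>Monotone convergence carries the uniform bound to the untruncated
    function.\<close>
  have "(\<lambda>m. \<integral>\<^sup>+s. ennreal ((norm (u m s))\<^sup>2) \<partial>?L) \<longlonglongrightarrow> (\<integral>\<^sup>+s. ennreal ((norm (?w s))\<^sup>2) \<partial>?L)"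
  proof (rule nn_integral_LIMSEQ)
    show "incseq (\<lambda>m s. ennreal ((norm (u m s))\<^sup>2))"
      by (auto simp: incseq_def le_fun_def u_def cut_def)
    show "(\<lambda>s. ennreal ((norm (u m s))\<^sup>2)) \<in> borel_measurable ?L" for m
      using borel_measurable_integrable[OF nui[of m]] by measurable
    show "(\<lambda>m. ennreal ((norm (u m s))\<^sup>2)) \<longlonglongrightarrow> ennreal ((norm (?w s))\<^sup>2)" for s
    proof (rule tendsto_eventually)
      obtain N :: nat where "norm (?w s) \<le> real N" using real_arch_simple by blast
      then show "\<forall>\<^sub>F m in sequentially. ennreal ((norm (u m s))\<^sup>2) = ennreal ((norm (?w s))\<^sup>2)"
        unfolding eventually_sequentially by (intro exI[of _ N]) (auto simp: u_def cut_def)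
    qed
  qed
  moreover have "(\<integral>\<^sup>+s. ennreal ((norm (u m s))\<^sup>2) \<partial>?L) \<le> ennreal ((C * norm \<phi>)\<^sup>2)" for m
    using bnd[of m] nn_integral_eq_integral[OF nui[of m]] by (simp add: ennreal_leI)
  ultimately have "(\<integral>\<^sup>+s. ennreal ((norm (?w s))\<^sup>2) \<partial>?L) \<le> ennreal ((C * norm \<phi>)\<^sup>2)"
    by (intro LIMSEQ_le_const2) auto
  then have "(\<integral>\<^sup>+s. ennreal ((norm (?w s))\<^sup>2) \<partial>?L) < \<infinity>" using le_less_trans by fastforce
  then show ?thesis using control_adj_measurable by (simp add: L2_on_def)
qed

abbreviation "M_adj \<phi> \<equiv> (control_adj \<phi>, impulse_adj \<phi>)"

lemma M_adj_controls: "M_adj \<phi> \<in> controls n b"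
  using control_adj_L2 by (auto simp: controls_def impulse_adj_def)

lemma M_inner: "p \<in> controls n b \<Longrightarrow> M p \<bullet> \<phi> = control_inner n b p (M_adj \<phi>)"
  using control_map_inner(2) by (metis surj_pair)

text \<open>The two kernels \<open>(t i - s) powr (\<alpha> - 1)\<close>, one from \<open>M\<close>
  and one from its adjoint, multiply to the kernel of the Gramian. Integrability is borrowed from
  the integrand of \<open>M\<close> at a square integrable control, which also covers \<alpha> \<le>
  1/2.\<close>

lemma gramian_eq:
  assumes i: "i \<in> {1..n + 1}"
  shows "gramian \<alpha> S B (t (i - 1)) (t i) (costate \<phi> i) =
    bochner_integral (ival i) (integrand i (control_adj \<phi>))"
  unfolding gramian_def
proof (rule bochner_integral_cong_AE)
  show "integrand i (control_adj \<phi>) bochner_integrable_on (ival i)"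
    by (rule integrand_integrable[OF control_adj_L2 i])
  show "AE s in lebesgue_on (ival i). integrand i (control_adj \<phi>) s =
      (t i - s) powr (2 * \<alpha> - 2) *\<^sub>R P (t i - s) (B (adjoint B (adjoint (P (t i - s)) (costate \<phi> i))))"
    using AE_interior[OF i]
  proof eventually_elim
    case (elim s)
    have "bounded_linear (P (t i - s))" using elim by (intro P_linear) simp
    moreover have "(t i - s) powr (\<alpha> - 1) * (t i - s) powr (\<alpha> - 1) = (t i - s) powr (2 * \<alpha> - 2)"
      unfolding powr_add[symmetric] by simp
    ultimately show ?case
      using control_adj_eq[OF i] elim by (simp add: control_integrand_def linear_simps(5) linear_simps(5)[OF B])
  qed
qed simp

section \<open>Symmetry, positivity and kernel of the controllability operator\<close>

lemma G_eq: "G \<phi> = M (M_adj \<phi>)"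
proof -
  have "G \<phi> \<bullet> \<psi> = M (M_adj \<phi>) \<bullet> \<psi>" for \<psi>
    unfolding controllability_op_response control_map_response response_inner
    using gramian_eq[of _ \<phi>] by simp
  then show ?thesis by (metis vector_eq_rdot)
qed

lemma G_inner: "G \<phi> \<bullet> \<psi> = control_inner n b (M_adj \<phi>) (M_adj \<psi>)"
  unfolding G_eq by (rule M_inner[OF M_adj_controls])

lemma G_sym: "G \<phi> \<bullet> \<psi> = \<phi> \<bullet> G \<psi>"
  by (metis G_inner control_inner_commute inner_commute)

text \<open>Symmetry moves \<open>G\<close> to the test vector, and what is left is linearity of the
  inner product.\<close>

lemma G_linear: "linear G"
proof (rule linearI)
  fix x y and c :: real
  have "G (x + y) \<bullet> z = (G x + G y) \<bullet> z" for z
    by (simp add: G_sym inner_add_left)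
  then show "G (x + y) = G x + G y" by (metis vector_eq_rdot)
  have "G (c *\<^sub>R x) \<bullet> z = (c *\<^sub>R G x) \<bullet> z" for z
    by (simp add: G_sym)
  then show "G (c *\<^sub>R x) = c *\<^sub>R G x" by (metis vector_eq_rdot)
qed

lemma G_nonneg: "G \<phi> \<bullet> \<phi> \<ge> 0"
  unfolding G_inner by (rule control_inner_self(1)[OF M_adj_controls])

text \<open>Orthogonality to the range of \<open>M\<close> is the common form to which the other
  conditions are reduced. One direction tests with the control \<open>M_adj \<phi>\<close>
  itself.\<close>

lemma G_eq_0_iff: "G \<phi> \<bullet> \<phi> = 0 \<longleftrightarrow> (\<forall>p\<in>controls n b. M p \<bullet> \<phi> = 0)"
proof
  assume "G \<phi> \<bullet> \<phi> = 0"
  then have "control_is_zero n b (M_adj \<phi>)"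
    unfolding G_inner using control_inner_self(2)[OF M_adj_controls] by blast
  then show "\<forall>p\<in>controls n b. M p \<bullet> \<phi> = 0"
    using control_inner_is_zero[OF _ M_adj_controls] M_inner by simp
qed (simp add: G_eq M_adj_controls)

text \<open>\<open>control_map_adj\<close> is a choice, so \<open>M_adj \<phi>\<close> has to
  witness that its description can be satisfied. Testing with the chosen control itself then decides
  whether it is zero almost everywhere.\<close>

lemma control_map_adj_is_zero_iff:
  "control_is_zero n b (control_map_adj \<alpha> S B D E n t b \<phi>) \<longleftrightarrow> (\<forall>p\<in>controls n b. M p \<bullet> \<phi> = 0)"
proof -
  define a where "a = control_map_adj \<alpha> S B D E n t b \<phi>"
  have "a \<in> controls n b \<and> (\<forall>p\<in>controls n b. M p \<bullet> \<phi> = control_inner n b p a)"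
    unfolding a_def control_map_adj_def
    by (rule someI_ex) (use M_adj_controls M_inner in blast)
  then have a: "a \<in> controls n b" "\<And>p. p \<in> controls n b \<Longrightarrow> M p \<bullet> \<phi> = control_inner n b p a" by auto
  show ?thesis unfolding a_def[symmetric]
    using a control_inner_is_zero[OF _ a(1)] control_inner_self(2)[OF a(1)] by metis
qed

text \<open>Closure under the operations is read off \<open>M_inner\<close>, since
  \<open>control_inner\<close> is linear in its first argument; the impulses are restricted to
  \<open>{1..n}\<close> to stay among the extensional families.\<close>

lemma range_subspace: "subspace (M ` controls n b)"
proof (rule subspaceI)
  let ?z = "(\<lambda>s. 0, \<lambda>k\<in>{1..n}. 0) :: (real \<Rightarrow> 'u) \<times> (nat \<Rightarrow> 'u)"
  have z: "?z \<in> controls n b"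
    by (auto simp: controls_def L2_on_def strongly_measurable_const)
  have "M ?z \<bullet> \<psi> = 0" for \<psi> unfolding M_inner[OF z] by (simp add: control_inner_def)
  then have Mz: "M ?z = 0" by (metis inner_eq_zero_iff)
  show "0 \<in> M ` controls n b" using imageI[OF z, of M] unfolding Mz .
next
  fix x y assume "x \<in> M ` controls n b" "y \<in> M ` controls n b"
  then obtain u v u' v' where p: "(u, v) \<in> controls n b" "(u', v') \<in> controls n b"
    and xy: "x = M (u, v)" "y = M (u', v')" by auto
  let ?q = "(\<lambda>s. u s + u' s, \<lambda>k\<in>{1..n}. v k + v' k)"
  have q: "?q \<in> controls n b" using p L2_on_add[of "{0..b}" u u'] by (auto simp: controls_def)
  have "M ?q \<bullet> \<psi> = (x + y) \<bullet> \<psi>" for \<psi>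
    unfolding xy inner_add_left M_inner[OF q] M_inner[OF p(1)] M_inner[OF p(2)]
    by (rule control_inner_add_left[OF p M_adj_controls])
  then have Mq: "M ?q = x + y" by (metis vector_eq_rdot)
  show "x + y \<in> M ` controls n b" using imageI[OF q, of M] unfolding Mq .
next
  fix c :: real and x assume "x \<in> M ` controls n b"
  then obtain u v where p: "(u, v) \<in> controls n b" and x: "x = M (u, v)" by auto
  let ?q = "(\<lambda>s. c *\<^sub>R u s, \<lambda>k\<in>{1..n}. c *\<^sub>R v k)"
  have q: "?q \<in> controls n b" using p L2_on_scaleR[of "{0..b}" u c] by (auto simp: controls_def)
  have "M ?q \<bullet> \<psi> = (c *\<^sub>R x) \<bullet> \<psi>" for \<psi>
    unfolding x inner_scaleR_left M_inner[OF q] M_inner[OF p] control_inner_scaleR_left ..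
  then have Mq: "M ?q = c *\<^sub>R x" by (metis vector_eq_rdot)
  show "c *\<^sub>R x \<in> M ` controls n b" using imageI[OF q, of M] unfolding Mq .
qed

lemma approximately_controllable_iff:
  "approximately_controllable \<alpha> S B D E n t b \<longleftrightarrow>
     (\<forall>\<phi>. (\<forall>p\<in>controls n b. M p \<bullet> \<phi> = 0) \<longrightarrow> \<phi> = 0)"
  unfolding approximately_controllable_def dense_subspace_iff[OF range_subspace] by simp

lemma strictly_positive_iff: "strictly_positive G \<longleftrightarrow> approximately_controllable \<alpha> S B D E n t b"
proof -
  have "strictly_positive G \<longleftrightarrow> (\<forall>\<phi>. G \<phi> \<bullet> \<phi> = 0 \<longrightarrow> \<phi> = 0)"
  proof
    assume "strictly_positive G"
    then show "\<forall>\<phi>. G \<phi> \<bullet> \<phi> = 0 \<longrightarrow> \<phi> = 0" unfolding strictly_positive_def by force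
  next
    assume *: "\<forall>\<phi>. G \<phi> \<bullet> \<phi> = 0 \<longrightarrow> \<phi> = 0"
    have "G y \<bullet> y > 0" if "y \<noteq> 0" for y
      using * that G_nonneg[of y] by (simp add: less_le) metis
    then show "strictly_positive G" unfolding strictly_positive_def by blast
  qed
  then show ?thesis unfolding approximately_controllable_iff G_eq_0_iff .
qed

text \<open>A vector with vanishing quadratic form is orthogonal to the range of \<open>M\<close>,
  hence to the range of \<open>G\<close>, and symmetry turns this into
  \<open>G \<phi> = 0\<close>.\<close>

lemma G_kernel: "G \<phi> \<bullet> \<phi> = 0 \<Longrightarrow> G \<phi> = 0"
proof -
  assume "G \<phi> \<bullet> \<phi> = 0"
  then have "M (M_adj \<psi>) \<bullet> \<phi> = 0" for \<psi> using G_eq_0_iff M_adj_controls by blast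
  then have "\<psi> \<bullet> G \<phi> = 0" for \<psi> using G_sym[of \<psi> \<phi>] by (simp add: G_eq)
  then show ?thesis by (metis inner_eq_zero_iff)
qed

lemmas G_bij = bij_resolvent(1)[OF G_linear G_sym G_nonneg]

lemma G_convergence_iff:
  "converges_SOT (scaled_resolvent G) (\<lambda>_. 0) (at_right 0) \<longleftrightarrow> strictly_positive G"
  "converges_WOT (scaled_resolvent G) (\<lambda>_. 0) (at_right 0) \<longleftrightarrow> strictly_positive G"
proof -
  have "\<And>x. G x \<bullet> x = 0 \<Longrightarrow> G x = 0" by (rule G_kernel)
  note res = resolvent_convergence[of G, OF G_linear G_sym G_nonneg this]
  show "converges_SOT (scaled_resolvent G) (\<lambda>_. 0) (at_right 0) \<longleftrightarrow> strictly_positive G"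
    using res(1) res(3)[OF _ res(2)] by blast
  show "converges_WOT (scaled_resolvent G) (\<lambda>_. 0) (at_right 0) \<longleftrightarrow> strictly_positive G"
    using res(3) res(2)[OF _ res(1)] by blast
qed

end

theorem theorem4:
  fixes \<alpha> b :: real
    and n :: nat
    and t :: "nat \<Rightarrow> real"
    and DA :: "'h::{real_inner, banach} set"
    and A :: "'h \<Rightarrow> 'h"
    and S :: "real \<Rightarrow> 'h \<Rightarrow> 'h"
    and B :: "'u::{real_inner, banach} \<Rightarrow> 'h"
    and D :: "nat \<Rightarrow> 'h \<Rightarrow> 'h"
    and E :: "nat \<Rightarrow> 'u \<Rightarrow> 'h"
  assumes "0 < \<alpha>" and "\<alpha> \<le> 1"
    and "n \<ge> 1"
    and "t 0 = 0" and "\<And>k. k \<le> n \<Longrightarrow> t k < t (k + 1)" and "t (n + 1) = b"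
    and "generates_C0_semigroup DA A S"
    and "bounded_linear B"
    and "\<And>k. k \<in> {1..n} \<Longrightarrow> bounded_linear (D k)"
    and "\<And>k. k \<in> {1..n} \<Longrightarrow> bounded_linear (E k)"
    and "\<alpha> \<le> 1 / 2 \<Longrightarrow> bounded_control_map \<alpha> S B D E n t b"
  shows "(approximately_controllable \<alpha> S B D E n t b \<longleftrightarrow>
            (\<forall>\<phi>. control_is_zero n b (control_map_adj \<alpha> S B D E n t b \<phi>) \<longrightarrow> \<phi> = 0)) \<and>
         (approximately_controllable \<alpha> S B D E n t b \<longleftrightarrow> strictly_positive (controllability_op \<alpha> S B D E n t b)) \<and>
         (approximately_controllable \<alpha> S B D E n t b \<longleftrightarrow>
            (\<forall>\<epsilon>>0. bij (\<lambda>x. \<epsilon> *\<^sub>R x + controllability_op \<alpha> S B D E n t b x)) \<and>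
            converges_SOT (scaled_resolvent (controllability_op \<alpha> S B D E n t b)) (\<lambda>_. 0) (at_right 0)) \<and>
         (approximately_controllable \<alpha> S B D E n t b \<longleftrightarrow>
            (\<forall>\<epsilon>>0. bij (\<lambda>x. \<epsilon> *\<^sub>R x + controllability_op \<alpha> S B D E n t b x)) \<and>
            converges_WOT (scaled_resolvent (controllability_op \<alpha> S B D E n t b)) (\<lambda>_. 0) (at_right 0))"
proof -
  have C0: "C0_semigroup S" using assms(7) by (simp add: generates_C0_semigroup_def)
  interpret impulsive_system \<alpha> b n t S B D E
  proof (rule impulsive_system.intro)
    show "t k < t (k + 1)" if "k \<le> n" for k using that by (rule assms(5))
    show "bounded_linear (D k)" if "k \<in> {1..n}" for k using that by (rule assms(9))
    show "bounded_linear (E k)" if "k \<in> {1..n}" for k using that by (rule assms(10))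
    show "bounded_control_map \<alpha> S B D E n t b" if "\<alpha> \<le> 1 / 2" using that by (rule assms(11))
  qed (fact assms C0)+
  \<comment> \<open>Holds unconditionally for every positive \<epsilon>, and makes
    \<open>inv\<close> in \<open>scaled_resolvent\<close> a genuine inverse.\<close>
  have bij: "\<forall>\<epsilon>>0. bij (\<lambda>x. \<epsilon> *\<^sub>R x + G x)" using G_bij by simp
  show ?thesis
    unfolding G_convergence_iff strictly_positive_iff control_map_adj_is_zero_iff
      approximately_controllable_iff[symmetric]
    using bij by simp
qed

end
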